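(* Fix $\epsilon>0$. Let $\{\alpha_i\}_{i\in\mathbb{N}}\subseteq \mathrm{Bad}$ be a countable set of badly approximable numbers and let $\{\mathcal{D}_j\}_{j\in\mathbb{N}}$ be a countable set of pseudo-absolute value sequences. Then there is a set $G\subseteq\mathrm{Bad}$ of Hausdorff dimension $1$ such that for every $\beta\in G$: (i) for every $i\in\mathbb{N}$ and every $\gamma\in\mathbb{R}$ the inequality \[ q\,\|q\alpha_i\|\,\|q\beta-\gamma\| < \frac{1}{(\log q)^{1/2-\epsilon}} \] has infinitely many solutions $q\in\mathbb{N}$; and (ii) for every $j\in\mathbb{N}$ and every $\delta\in\mathbb{R}$, \[ \liminf_{q\to\infty} q\,|q|_{\mathcal{D}_j}\,\|q\beta-\delta\| = 0. \] Furthermore, for each $j$ such that $\mathcal{D}_j=(n_k)_{k\ge 0}$ satisfies $n_k\le C^k$ for all $k$ for some constant $C>1$, statement (ii) for this $j$ may be strengthened to: for every $\delta\in\mathbb{R}$ the inequality \[ q\,|q|_{\mathcal{D}_j}\,\|q\beta-\delta\| < \frac{1}{(\log q)^{1/2-\epsilon}} \] has infinitely many solutions $q\in\mathbb{N}$.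
   Context: $\|x\|$ denotes the distance from $x\in\mathbb{R}$ to the nearest integer. $\mathrm{Bad}$ is the set of badly approximable real numbers, i.e. irrational $\alpha$ with bounded partial quotients in the simple continued fraction expansion (equivalently $\liminf_{q\to\infty} q\|q\alpha\|>0$). A pseudo-absolute value sequence is a sequence $\mathcal{D}=(n_k)_{k=0}^\infty$ of positive integers with $n_0=1$ and $n_{k-1}\mid n_k$ for all $k\ge1$; the associated pseudo-absolute value of an integer $q$ is $|q|_{\mathcal{D}}=\min\{n_k^{-1} : q\in n_k\mathbb{Z}\}$.
   Formalization: The formal theorem assumes each pseudo-absolute value sequence is strictly increasing; with repetitions allowed, the constant sequence n_k = 1 gives liminf q‖qβ‖ > 0 for every β in Bad, so (ii) fails at δ = 0. *)

theory Defs
  imports "HOL-Analysis.Analysis"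
begin

definition nint_dist :: "real \<Rightarrow> real" where
  "nint_dist x = infdist x \<int>"

text \<open>
  Simple continued fraction expansion. The complete quotients of \<open>x\<close> are \<open>x\<^sub>0 = x\<close> and
  \<open>x\<^sub>n\<^sub>+\<^sub>1 = 1 / frac x\<^sub>n\<close>, and the partial quotients are \<open>a\<^sub>n = \<lfloor>x\<^sub>n\<rfloor>\<close>. For irrational \<open>x\<close> the
  recursion never divides by zero; for rational \<open>x\<close> the values after termination are meaningless,
  but these definitions are only used for irrational \<open>x\<close>.
\<close>

primrec complete_quotient :: "real \<Rightarrow> nat \<Rightarrow> real" where
  "complete_quotient x 0 = x"
| "complete_quotient x (Suc n) = 1 / frac (complete_quotient x n)"

definition partial_quotient :: "real \<Rightarrow> nat \<Rightarrow> int" where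
  "partial_quotient x n = \<lfloor>complete_quotient x n\<rfloor>"

text \<open>
  An upper bound suffices in the next definition, since \<open>a\<^sub>n \<ge> 1\<close> for \<open>n \<ge> 1\<close>.
\<close>

definition Bad :: "real set" where
  "Bad = {x. x \<notin> \<rat> \<and> (\<exists>M. \<forall>n. partial_quotient x n \<le> M)}"

text \<open>
  Repetitions \<open>D (k - 1) = D k\<close> are allowed here; strict monotonicity, where wanted, is a separate
  hypothesis.
\<close>

definition pseudo_abs_seq :: "(nat \<Rightarrow> nat) \<Rightarrow> bool" where
  "pseudo_abs_seq D \<longleftrightarrow> (\<forall>k. D k > 0) \<and> D 0 = 1 \<and> (\<forall>k\<ge>1. D (k - 1) dvd D k)"

text \<open>
  For \<open>q \<noteq> 0\<close> the infimum is over a finite nonempty set and hence is a minimum; see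
  \<open>pseudo_abs_eq_Min\<close>. For \<open>q = 0\<close> and unbounded \<open>D\<close> no minimum exists and the infimum is \<open>0\<close>.
\<close>

definition pseudo_abs :: "(nat \<Rightarrow> nat) \<Rightarrow> int \<Rightarrow> real" where
  "pseudo_abs D q = Inf {1 / real (D k) | k. int (D k) dvd q}"

lemma pseudo_abs_eq_Min:
  assumes "pseudo_abs_seq D" and "q \<noteq> 0"
  shows "finite {1 / real (D k) | k. int (D k) dvd q}"
    and "pseudo_abs D q = Min {1 / real (D k) | k. int (D k) dvd q}"
proof -
  let ?S = "{1 / real (D k) | k. int (D k) dvd q}"
  have "?S \<subseteq> (\<lambda>d. 1 / real d) ` {..nat \<bar>q\<bar>}"
  proof clarify
    fix k assume "int (D k) dvd q"
    then have "int (D k) \<le> \<bar>q\<bar>" using dvd_imp_le_int[OF assms(2)] by fastforce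
    then show "1 / real (D k) \<in> (\<lambda>d. 1 / real d) ` {..nat \<bar>q\<bar>}" by auto
  qed
  then show fin: "finite ?S" by (rule finite_subset) simp
  have "int (D 0) dvd q" using assms(1) by (simp add: pseudo_abs_seq_def)
  then have "?S \<noteq> {}" by blast
  with fin show "pseudo_abs D q = Min ?S" by (simp add: pseudo_abs_def cInf_eq_Min)
qed

text \<open>
  Hausdorff measure and dimension. The library function \<^const>\<open>diameter\<close> is meaningless on unbounded
  sets, so boundedness of the covering sets is required explicitly. Finite covers are included by
  padding with the empty set. In \<open>diam_powr\<close> the usual conventions are fixed: the empty set
  contributes \<open>0\<close>, and a nonempty set contributes \<open>1\<close> when \<open>s = 0\<close> (whereas \<open>0 powr 0 = 0\<close> in HOL).
\<close>

definition diam_powr :: "real \<Rightarrow> 'a::metric_space set \<Rightarrow> ennreal" where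
  "diam_powr s U = (if U = {} then 0 else if s = 0 then 1 else ennreal (diameter U powr s))"

definition hausdorff_premeasure :: "real \<Rightarrow> real \<Rightarrow> 'a::metric_space set \<Rightarrow> ennreal" where
  "hausdorff_premeasure s \<delta> A =
     Inf {(\<Sum>i. diam_powr s (U i)) | U :: nat \<Rightarrow> 'a set.
            A \<subseteq> (\<Union>i. U i) \<and> (\<forall>i. bounded (U i) \<and> diameter (U i) \<le> \<delta>)}"

definition hausdorff_measure :: "real \<Rightarrow> 'a::metric_space set \<Rightarrow> ennreal" where
  "hausdorff_measure s A = (SUP \<delta>\<in>{0<..}. hausdorff_premeasure s \<delta> A)"

definition hausdorff_dim :: "'a::metric_space set \<Rightarrow> ennreal" where
  "hausdorff_dim A = Inf {ennreal s | s. 0 \<le> s \<and> hausdorff_measure s A = 0}"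

end

theory Submission
  imports Defs
begin

text \<open>
  Only few digits of \<open>\<beta>\<close> have to be prescribed. A word \<open>p\<close> of partial quotients with \<open>n / q\<^sup>2\<close> of size a
  power of \<open>2\<^sup>l\<close>, where \<open>q\<close> is the denominator of \<open>p\<close>, can be continued by \<open>O(l)\<close> bounded digits such that
  \<open>n \<beta>\<close> comes within \<open>2 / 2\<^sup>l\<close> of any given point modulo 1, whatever the later digits are: continue \<open>p\<close> by
  words \<open>w @ v\<close>; as functions of the tail, the phases belonging to different \<open>w\<close> have almost independent
  oscillations, so by a second moment estimate they all avoid the target only on a set of tails of measure
  smaller than that of the tails \<open>v\<close> with bounded digits.

  If \<open>S\<close> at least doubles at each step, one can thus hit all \<open>2\<^sup>l\<close> points of the grid of mesh \<open>1 / 2\<^sup>l\<close> by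
  \<open>S k * \<beta>\<close> with \<open>4\<^sup>l \<le> k \<le> 2 * 4\<^sup>l\<close>, at the expense of \<open>O(l 2\<^sup>l)\<close> digits out of at least \<open>4\<^sup>l\<close>. For every bound
  \<open>M\<close> on the digits this does not affect the Hausdorff dimension, which tends to 1 with \<open>M\<close>. If \<open>ln (S k)\<close>
  is at most a multiple of \<open>k\<close>, then \<open>3 / 2\<^sup>l\<close> is eventually smaller than \<open>(ln (S k)) powr - (1/2 - \<epsilon>)\<close>.
  The theorem follows by taking for \<open>S\<close> the denominators of the convergents of \<open>\<alpha> i\<close>, and the sequences \<open>D j\<close> themselves.
\<close>

section \<open>Continued fractions with prescribed digits\<close>

text \<open>\<open>Bad\<close> is a Lebesgue null set, so results on almost every \<beta> do not
  reach it. Lebesgue measure is usable all the same, because only the next 153 l digits have to be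
  bounded while a target is being hit: for M \<ge> 611 the tails that begin with such digits still
  have measure at least 2^(-l), whereas the tails at which all phases miss have measure at most
  17168 / 2^(3 l). Past these digits the phase is frozen to within 2^(-l).

  The exponent 1/2 comes from the layout of the indices: 2^l targets placed 2^l indices apart end at
  index 2 * 4^l. For sequences of at most exponential growth the logarithm of the multiplier is then
  of order 4^l, so precision 2^(-l) is about its power -1/2; the \<epsilon> absorbs the constants.

  A block can only be chosen when the digits before it are known. The set of \<beta> is therefore
  not a product of digit sets but a tree with a strategy that sees the whole past, and its dimension
  is bounded from below by a direct argument on covers.\<close>

primrec cf :: "nat list \<Rightarrow> real \<Rightarrow> real" where
  "cf [] x = x"
| "cf (a # w) x = 1 / (real a + cf w x)"

text \<open>The state is the pair of the last two convergent denominators. \<open>den1\<close> and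
  \<open>den2\<close> fold it from the left, so that appending a digit is one step of the recursion;
  \<open>cf\<close>, by contrast, recurses from the front.\<close>

definition cont_step :: "real \<times> real \<Rightarrow> nat \<Rightarrow> real \<times> real" where
  "cont_step z a = (real a * fst z + snd z, fst z)"

definition den1 :: "nat list \<Rightarrow> real" where
  "den1 w = fst (foldl cont_step (1, 0) w)"

definition den2 :: "nat list \<Rightarrow> real" where
  "den2 w = snd (foldl cont_step (1, 0) w)"

text \<open>The length of the interval of all \<open>cf w x\<close> with x in [0, 1]; see
  \<open>cf_ends\<close>.\<close>

definition cyl_len :: "nat list \<Rightarrow> real" where
  "cyl_len w = 1 / (den1 w * (den1 w + den2 w))"

lemma den_Nil [simp]: "den1 [] = 1" "den2 [] = 0"
  by (simp_all add: den1_def den2_def)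

lemma den_snoc [simp]:
  "den1 (w @ [a]) = real a * den1 w + den2 w" "den2 (w @ [a]) = den1 w"
  by (simp_all add: den1_def den2_def cont_step_def)

lemma cf_append: "cf (u @ v) x = cf u (cf v x)"
  by (induction u) auto

lemma cf_bounds:
  assumes "0 \<notin> set w" "0 \<le> x" "x \<le> 1"
  shows "0 \<le> cf w x \<and> cf w x \<le> 1"
  using assms
proof (induction w)
  case (Cons a w)
  then have "real a \<ge> 1" "0 \<le> cf w x" by (auto simp: Suc_le_eq)
  then show ?case by (simp add: field_simps)
qed simp

lemma cf_open_bounds:
  assumes "0 \<notin> set w" "0 < x" "x < 1"
  shows "0 < cf w x \<and> cf w x < 1"
  using assms
proof (induction w)
  case (Cons a w)
  then have "real a \<ge> 1" "0 < cf w x" by (auto simp: Suc_le_eq)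
  then show ?case by (simp add: field_simps)
qed simp

lemma den_bounds:
  assumes "0 \<notin> set w"
  shows "1 \<le> den1 w \<and> 0 \<le> den2 w \<and> den2 w \<le> den1 w"
  using assms
proof (induction w rule: rev_induct)
  case (snoc a w)
  then have "real a \<ge> 1" and IH: "1 \<le> den1 w" "0 \<le> den2 w" by (auto simp: Suc_le_eq)
  then have "1 * den1 w \<le> real a * den1 w" by (intro mult_right_mono) auto
  then have "den1 w \<le> real a * den1 w" by simp
  with IH show ?case unfolding den_snoc by linarith
qed simp

lemma den1_ge_1: "0 \<notin> set w \<Longrightarrow> 1 \<le> den1 w"
  and den2_nonneg: "0 \<notin> set w \<Longrightarrow> 0 \<le> den2 w"
  and den2_le_den1: "0 \<notin> set w \<Longrightarrow> den2 w \<le> den1 w"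
  using den_bounds by auto

lemma den1_snoc_ge: "0 \<notin> set (w @ [a]) \<Longrightarrow> den1 w \<le> den1 (w @ [a])"
  using den2_le_den1[of "w @ [a]"] by simp

lemma den1_append_ge: "0 \<notin> set (w @ v) \<Longrightarrow> den1 w \<le> den1 (w @ v)"
proof (induction v rule: rev_induct)
  case (snoc a v)
  then have "den1 w \<le> den1 (w @ v)" by simp
  also have "\<dots> \<le> den1 ((w @ v) @ [a])"
    using snoc.prems by (intro den1_snoc_ge) auto
  finally show ?case by simp
qed simp

lemma den1_snoc_le:
  assumes "0 \<notin> set w" "a \<le> M"
  shows "den1 (w @ [a]) \<le> (real M + 1) * den1 w"
proof -
  have "real a * den1 w \<le> real M * den1 w"
    using assms den1_ge_1[of w] by (intro mult_right_mono) auto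
  then show ?thesis using den2_le_den1[OF assms(1)] by (simp add: algebra_simps)
qed

lemma den1_append_le:
  assumes "0 \<notin> set w" "set v \<subseteq> {1..M}"
  shows "den1 (w @ v) \<le> (real M + 1) ^ length v * den1 w"
  using assms(2)
proof (induction v rule: rev_induct)
  case (snoc a v)
  have "den1 ((w @ v) @ [a]) \<le> (real M + 1) * den1 (w @ v)"
    using snoc.prems assms by (intro den1_snoc_le) auto
  also have "\<dots> \<le> (real M + 1) * ((real M + 1) ^ length v * den1 w)"
    using snoc by (intro mult_left_mono) auto
  finally show ?case by simp
qed simp

text \<open>Stated for the reciprocal of \<open>cyl_len\<close>, which at least doubles with every
  digit; \<open>den1\<close> itself need not grow, as \<open>den1 [1] = 1\<close>.\<close>

lemma den_growth:
  assumes "0 \<notin> set w"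
  shows "2 ^ length w \<le> den1 w * (den1 w + den2 w)"
  using assms
proof (induction w rule: rev_induct)
  case (snoc a w)
  let ?q = "den1 w" and ?r = "den2 w"
  have a: "real a \<ge> 1" and b: "1 \<le> ?q" "0 \<le> ?r" "?r \<le> ?q"
    using snoc.prems den_bounds[of w] by (auto simp: Suc_le_eq)
  have c: "?q \<le> real a * ?q" using mult_right_mono[OF a, of ?q] b by simp
  have "2 * (?q * (?q + ?r)) \<le> (?q + ?r) * (?q + ?r + ?q)"
    using b by (simp add: algebra_simps)
  also have "\<dots> \<le> (real a * ?q + ?r) * (real a * ?q + ?r + ?q)"
    using b c by (intro mult_mono) auto
  finally show ?case using snoc by auto
qed simp

lemma cyl_len_pos: "0 \<notin> set w \<Longrightarrow> 0 < cyl_len w"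
  using den_bounds[of w] by (simp add: cyl_len_def)

lemma cyl_len_Nil [simp]: "cyl_len [] = 1" by (simp add: cyl_len_def)

lemma cyl_len_le_power: "0 \<notin> set w \<Longrightarrow> cyl_len w \<le> (1/2) ^ length w"
  using den_growth[of w] den_bounds[of w]
  by (simp add: cyl_len_def power_one_over frac_le)

text \<open>\<open>cf w\<close> is a Moebius map of determinant 1 or -1 with denominator
  \<open>den1 w + den2 w * x\<close>. Taking absolute differences keeps numerators and signs out of
  the induction.\<close>

lemma cf_diff:
  assumes "0 \<notin> set w" "0 \<le> x" "0 \<le> y"
  shows "\<bar>cf w x - cf w y\<bar> = \<bar>x - y\<bar> / ((den1 w + den2 w * x) * (den1 w + den2 w * y))"
  using assms
proof (induction w arbitrary: x y rule: rev_induct)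
  case (snoc a w)
  have a: "real a \<ge> 1" and b: "1 \<le> den1 w" "0 \<le> den2 w"
    using snoc.prems den_bounds[of w] by (auto simp: Suc_le_eq)
  have p: "real a + x > 0" "real a + y > 0" using a snoc.prems by auto
  have e: "1 / (real a + x) - 1 / (real a + y) = (y - x) / ((real a + x) * (real a + y))"
    using p by (simp add: field_simps)
  have q: "(den1 w + den2 w * (1 / (real a + x))) = (real a * den1 w + den2 w + den1 w * x) / (real a + x)"
    "(den1 w + den2 w * (1 / (real a + y))) = (real a * den1 w + den2 w + den1 w * y) / (real a + y)"
    using p by (simp_all add: field_simps)
  have "\<bar>cf (w @ [a]) x - cf (w @ [a]) y\<bar> = \<bar>cf w (1 / (real a + x)) - cf w (1 / (real a + y))\<bar>"
    by (simp add: cf_append)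
  also have "\<dots> = \<bar>1 / (real a + x) - 1 / (real a + y)\<bar> /
      ((den1 w + den2 w * (1 / (real a + x))) * (den1 w + den2 w * (1 / (real a + y))))"
    using snoc.prems p by (intro snoc.IH) auto
  also have "\<dots> = \<bar>x - y\<bar> / ((real a * den1 w + den2 w + den1 w * x) * (real a * den1 w + den2 w + den1 w * y))"
    unfolding e q using p by (simp add: abs_mult abs_minus_commute)
  finally show ?case by simp
qed simp

lemma cf_diff_le:
  assumes "0 \<notin> set w" "0 \<le> x" "0 \<le> y"
  shows "\<bar>cf w x - cf w y\<bar> \<le> \<bar>x - y\<bar> / (den1 w)\<^sup>2"
proof -
  have b: "1 \<le> den1 w" "0 \<le> den2 w" using den_bounds[OF assms(1)] by auto
  then have "(den1 w)\<^sup>2 \<le> (den1 w + den2 w * x) * (den1 w + den2 w * y)"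
    unfolding power2_eq_square using assms by (intro mult_mono) auto
  moreover have "0 < den1 w + den2 w * x" "0 < den1 w + den2 w * y"
    using b assms by (simp_all add: add_pos_nonneg)
  moreover have "0 < (den1 w)\<^sup>2" using b by simp
  ultimately show ?thesis unfolding cf_diff[OF assms]
    by (intro divide_left_mono mult_pos_pos) auto
qed

lemma cf_diff_le_len:
  assumes "0 \<notin> set w" "0 \<le> x" "x \<le> 1" "0 \<le> y" "y \<le> 1"
  shows "\<bar>cf w x - cf w y\<bar> \<le> cyl_len w"
proof -
  have b: "1 \<le> den1 w" "0 \<le> den2 w" "den2 w \<le> den1 w" using den_bounds[OF assms(1)] by auto
  have *: "\<bar>cf w x - cf w y\<bar> \<le> cyl_len w" if "0 \<le> x" "x \<le> y" "y \<le> 1" for x y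
  proof -
    let ?q = "den1 w" and ?r = "den2 w"
    have "?q * (?q + ?r) * (y - x) \<le> (?q + ?r * x) * (?q + ?r * y)"
    proof -
      \<comment> \<open>Equality holds exactly for x = 0 and y = 1, the two ends of the
        cylinder.\<close>
      have "(?q + ?r * x) * (?q + ?r * y) - ?q * (?q + ?r) * (y - x)
        = ?q * ?q * (1 - (y - x)) + 2 * ?q * ?r * x + ?r * ?r * x * y"
        by (simp add: algebra_simps)
      also have "\<dots> \<ge> 0" using that b by (intro add_nonneg_nonneg mult_nonneg_nonneg) auto
      finally show ?thesis by simp
    qed
    moreover have "0 < (?q + ?r * x) * (?q + ?r * y)" "0 < ?q * (?q + ?r)"
      using that b by (auto intro!: mult_pos_pos add_pos_nonneg)
    ultimately have "(y - x) / ((?q + ?r * x) * (?q + ?r * y)) \<le> 1 / (?q * (?q + ?r))"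
      by (simp add: pos_divide_le_eq pos_le_divide_eq mult.commute)
    then show ?thesis
      using that by (subst cf_diff[OF assms(1)]) (auto simp: cyl_len_def)
  qed
  show ?thesis
    using *[of x y] *[of y x] assms by (cases "x \<le> y") (auto simp: abs_minus_commute)
qed

lemma cf_ends: "0 \<notin> set w \<Longrightarrow> \<bar>cf w 1 - cf w 0\<bar> = cyl_len w"
  by (subst cf_diff) (auto simp: cyl_len_def mult.commute)

text \<open>The derivative is taken within \<open>{0..}\<close>, a set that each map x -> 1 / (a +
  x) sends into itself; so the chain rule needs no exception at the end point 0.\<close>

lemma cf_has_deriv:
  assumes "0 \<notin> set w" "0 \<le> x"
  shows "(cf w has_field_derivative (-1) ^ length w / (den1 w + den2 w * x)\<^sup>2) (at x within {0..})"
  using assms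
proof (induction w arbitrary: x rule: rev_induct)
  case Nil
  have "((\<lambda>x. x) has_field_derivative 1) (at x within {0..})" by (rule DERIV_ident)
  then show ?case by simp
next
  case (snoc a w)
  have a: "real a \<ge> 1" and b: "1 \<le> den1 w" "0 \<le> den2 w"
    using snoc.prems den_bounds[of w] by (auto simp: Suc_le_eq)
  have p: "real a + x > 0" using a snoc.prems by auto
  have "(cf w has_field_derivative (-1) ^ length w / (den1 w + den2 w * (1 / (real a + x)))\<^sup>2) (at (1 / (real a + x)) within {0..})"
    using snoc.IH[of "1 / (real a + x)"] snoc.prems p by simp
  then have 1: "(cf w has_field_derivative (-1) ^ length w / (den1 w + den2 w * (1 / (real a + x)))\<^sup>2)
      (at (1 / (real a + x)) within (\<lambda>x. 1 / (real a + x)) ` {0..})"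
    by (rule DERIV_subset) auto
  have 2: "((\<lambda>x. 1 / (real a + x)) has_field_derivative - 1 / (real a + x)\<^sup>2) (at x within {0..})"
    using p by (auto intro!: derivative_eq_intros simp: power2_eq_square)
  have 3: "((cf w \<circ> (\<lambda>x. 1 / (real a + x))) has_field_derivative
      (-1) ^ length w / (den1 w + den2 w * (1 / (real a + x)))\<^sup>2 * (- 1 / (real a + x)\<^sup>2)) (at x within {0..})"
    by (rule DERIV_image_chain[OF 1 2])
  have e: "(-1) ^ length w / (den1 w + den2 w * (1 / (real a + x)))\<^sup>2 * (- 1 / (real a + x)\<^sup>2)
     = (-1) ^ length (w @ [a]) / (den1 (w @ [a]) + den2 (w @ [a]) * x)\<^sup>2"
  proof -
    have q: "(den1 w + den2 w * (1 / (real a + x))) = (real a * den1 w + den2 w + den1 w * x) / (real a + x)"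
      using p by (simp_all add: field_simps)
    show ?thesis unfolding q using p by (simp add: power_divide)
  qed
  have f: "cf w \<circ> (\<lambda>x. 1 / (real a + x)) = cf (w @ [a])"
    by (auto simp: cf_append)
  show ?case using 3 unfolding e f .
qed

text \<open>The first digit is the integer part of the reciprocal. Tails strictly between 0 and 1
  exclude the ambiguity between a + 1 and (a + 1) + 0.\<close>

lemma cf_open_disjoint:
  assumes "cf v x = cf w y" "0 \<notin> set v" "0 \<notin> set w" "0 < x" "x < 1" "0 < y" "y < 1"
    "length v \<le> length w"
  shows "v = take (length v) w"
  using assms
proof (induction v arbitrary: w)
  case (Cons a v)
  then obtain b w' where w: "w = b # w'" by (cases w) auto
  have f: "0 < cf v x" "cf v x < 1" "0 < cf w' y" "cf w' y < 1"
    using Cons.prems w cf_open_bounds[of v x] cf_open_bounds[of w' y] by auto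
  have "1 / (real a + cf v x) = 1 / (real b + cf w' y)" using Cons.prems w by simp
  then have e: "real a + cf v x = real b + cf w' y" using f by (simp add: add_pos_pos)
  then have "a = b"
    using f by linarith
  then show ?case using e Cons w by auto
qed simp

section \<open>Infinite continued fractions\<close>

definition pre :: "(nat \<Rightarrow> nat) \<Rightarrow> nat \<Rightarrow> nat list" where
  "pre a m = map a [0..<m]"

lemma pre_0 [simp]: "pre a 0 = []" and pre_Suc: "pre a (Suc m) = pre a m @ [a m]"
  and length_pre [simp]: "length (pre a m) = m"
  by (auto simp: pre_def)

lemma pre_add: "pre a (m + k) = pre a m @ pre (\<lambda>i. a (m + i)) k"
  by (induction k) (auto simp: pre_Suc)

lemma set_pre: "(\<And>i. a i \<in> A) \<Longrightarrow> set (pre a m) \<subseteq> A"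
  by (auto simp: pre_def)

lemma pre_nonzero: "(\<And>i. a i \<ge> 1) \<Longrightarrow> 0 \<notin> set (pre a m)"
proof
  assume *: "\<And>i. a i \<ge> 1" and "0 \<in> set (pre a m)"
  then obtain i where "a i = 0" by (auto simp: pre_def)
  with *[of i] show False by simp
qed

definition cfval :: "(nat \<Rightarrow> nat) \<Rightarrow> real" where
  "cfval a = lim (\<lambda>m. cf (pre a m) 0)"

lemma cfval_tendsto:
  assumes "\<And>i. a i \<ge> 1"
  shows "(\<lambda>m. cf (pre a m) 0) \<longlonglongrightarrow> cfval a"
proof -
  have "Cauchy (\<lambda>m. cf (pre a m) 0)"
  proof (rule metric_CauchyI)
    fix e :: real assume "0 < e"
    then obtain N where N: "(1/2) ^ N < e" using real_arch_pow_inv[of e "1/2"] by auto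
    have *: "dist (cf (pre a m) 0) (cf (pre a n) 0) < e" if "N \<le> m" "m \<le> n" for m n
    proof -
      obtain k where n: "n = m + k" using \<open>m \<le> n\<close> le_Suc_ex by blast
      have y: "0 \<le> cf (pre (\<lambda>i. a (m + i)) k) 0 \<and> cf (pre (\<lambda>i. a (m + i)) k) 0 \<le> 1"
        using assms by (intro cf_bounds pre_nonzero) auto
      have "\<bar>cf (pre a m) 0 - cf (pre a n) 0\<bar> \<le> cyl_len (pre a m)"
        unfolding n pre_add cf_append using y pre_nonzero[of a, OF assms] by (intro cf_diff_le_len) auto
      also have "\<dots> \<le> (1/2) ^ m" using cyl_len_le_power[OF pre_nonzero[of a, OF assms], of m] by simp
      also have "\<dots> \<le> (1/2) ^ N" using that by (intro power_decreasing) auto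
      finally show ?thesis using N by (simp add: dist_real_def)
    qed
    show "\<exists>N. \<forall>m\<ge>N. \<forall>n\<ge>N. dist (cf (pre a m) 0) (cf (pre a n) 0) < e"
      using * by (metis dist_commute nle_le)
  qed
  then show ?thesis
    unfolding cfval_def using Cauchy_convergent convergent_LIMSEQ_iff by blast
qed

lemma cfval_bounds:
  assumes "\<And>i. a i \<ge> 1"
  shows "0 \<le> cfval a" "cfval a \<le> 1"
proof -
  have b: "0 \<le> cf (pre a m) 0 \<and> cf (pre a m) 0 \<le> 1" for m
    using assms by (intro cf_bounds pre_nonzero) auto
  show "0 \<le> cfval a" "cfval a \<le> 1"
    using LIMSEQ_le_const[OF cfval_tendsto[of a, OF assms]] LIMSEQ_le_const2[OF cfval_tendsto[of a, OF assms]] b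
    by blast+
qed

lemma cfval_unfold:
  assumes "\<And>i. a i \<ge> 1"
  shows "cfval a = 1 / (real (a 0) + cfval (\<lambda>i. a (Suc i)))"
proof -
  have e: "cf (pre a (Suc m)) 0 = 1 / (real (a 0) + cf (pre (\<lambda>i. a (Suc i)) m) 0)" for m
    using pre_add[of a 1 m] by (simp add: pre_Suc[of _ 0, simplified])
  have t: "(\<lambda>m. cf (pre (\<lambda>i. a (Suc i)) m) 0) \<longlonglongrightarrow> cfval (\<lambda>i. a (Suc i))"
    using assms by (intro cfval_tendsto) auto
  have "real (a 0) + cfval (\<lambda>i. a (Suc i)) \<noteq> 0"
    using assms[of 0] cfval_bounds(1)[of "\<lambda>i. a (Suc i)"] assms by fastforce
  then have "(\<lambda>m. cf (pre a (Suc m)) 0) \<longlonglongrightarrow> 1 / (real (a 0) + cfval (\<lambda>i. a (Suc i)))"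
    unfolding e by (intro tendsto_intros t)
  moreover have "(\<lambda>m. cf (pre a (Suc m)) 0) \<longlonglongrightarrow> cfval a"
    using cfval_tendsto[of a, OF assms] by (rule LIMSEQ_Suc)
  ultimately show ?thesis using LIMSEQ_unique by blast
qed

lemma cfval_pre:
  assumes "\<And>i. a i \<ge> 1"
  shows "cfval a = cf (pre a m) (cfval (\<lambda>i. a (m + i)))"
proof (induction m)
  case (Suc m)
  have "cfval (\<lambda>i. a (m + i)) = 1 / (real (a m) + cfval (\<lambda>i. a (Suc m + i)))"
    using cfval_unfold[of "\<lambda>i. a (m + i)"] assms by simp
  then show ?case using Suc by (simp add: pre_Suc cf_append)
qed simp

lemma cfval_strict_bounds:
  assumes "\<And>i. a i \<ge> 1"
  shows "0 < cfval a" "cfval a < 1"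
proof -
  have p: "0 < cfval b" if "\<And>i. b i \<ge> 1" for b
    using cfval_unfold[of b] cfval_bounds(1)[of "\<lambda>i. b (Suc i)"] that that[of 0]
    by (simp add: add_pos_nonneg Suc_le_eq)
  then show "0 < cfval a" using assms by blast
  have "0 < cfval (\<lambda>i. a (Suc i))" using assms p by auto
  moreover have "real (a 0) \<ge> 1" using assms[of 0] by simp
  ultimately show "cfval a < 1" using cfval_unfold[of a, OF assms] by simp
qed

text \<open>Infinite descent along Euclid's algorithm: if the value is p / q then p < q, and the
  tail is a fraction with the smaller denominator p.\<close>

lemma cfval_irrational:
  assumes "\<And>i. a i \<ge> 1"
  shows "cfval a \<notin> \<rat>"
proof -
  have "cfval a \<noteq> real p / real q" if "\<And>i. a i \<ge> 1" for a p q
    using that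
  proof (induction q arbitrary: a p rule: less_induct)
    case (less q)
    show ?case
    proof
      assume e: "cfval a = real p / real q"
      have s: "0 < cfval a" "cfval a < 1" using cfval_strict_bounds[of a, OF less.prems] by auto
      have q: "q > 0" using e s by (cases q) auto
      have p: "p > 0" using e s by (cases p) auto
      have pq: "p < q" using e s q by simp
      have b: "0 < cfval (\<lambda>i. a (Suc i))"
        using less.prems by (intro cfval_strict_bounds) auto
      then have f: "cfval (\<lambda>i. a (Suc i)) = real q / real p - real (a 0)"
        using cfval_unfold[of a, OF less.prems] e q p by (simp add: field_simps)
      moreover have "real p * real (a 0) + real p * cfval (\<lambda>i. a (Suc i)) = real q"
        using f p by (simp add: field_simps)
      moreover have "0 < real p * cfval (\<lambda>i. a (Suc i))" using b p by simp
      ultimately have "real (a 0) * real p < real q" by (simp add: mult.commute)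
      then have "a 0 * p \<le> q" by (metis less_imp_le of_nat_less_iff of_nat_mult)
      then have "cfval (\<lambda>i. a (Suc i)) = real (q - a 0 * p) / real p"
        using f p by (simp add: field_simps of_nat_diff)
      then show False using less.IH[OF pq, of "\<lambda>i. a (Suc i)"] less.prems by blast
    qed
  qed
  then have *: "cfval a \<noteq> real p / real q" for p q using assms by blast
  show ?thesis
  proof
    assume "cfval a \<in> \<rat>"
    then obtain m n :: nat where "\<bar>cfval a\<bar> = real m / real n"
      using Rats_abs_nat_div_natE by blast
    then show False using * cfval_bounds[of a, OF assms] by auto
  qed
qed

text \<open>The index shift comes from the integer part 0 of \<open>cfval a\<close>: digit
  \<open>a n\<close> is partial quotient number n + 1.\<close>

lemma cfval_complete_quotient:
  assumes "\<And>i. a i \<ge> 1"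
  shows "complete_quotient (cfval a) (Suc n) = real (a n) + cfval (\<lambda>i. a (Suc n + i))"
proof (induction n)
  case 0
  have "frac (cfval a) = cfval a"
    using cfval_strict_bounds[of a] assms by (simp add: frac_eq)
  then show ?case using cfval_unfold[of a, OF assms] by simp
next
  case (Suc n)
  have "frac (real (a n) + cfval (\<lambda>i. a (Suc n + i))) = cfval (\<lambda>i. a (Suc n + i))"
    using cfval_strict_bounds[of "\<lambda>i. a (Suc n + i)"] assms
    by (simp add: frac_unique_iff)
  then show ?case
    using Suc cfval_unfold[of "\<lambda>i. a (Suc n + i)"] assms by simp
qed

lemma cfval_Bad:
  assumes "\<And>i. a i \<in> {1..M}"
  shows "cfval a \<in> Bad"
proof -
  have a: "a i \<ge> 1" for i using assms[of i] by simp
  have "partial_quotient (cfval a) n \<le> int M" for n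
  proof (cases n)
    case 0
    have "\<lfloor>cfval a\<rfloor> = 0" using cfval_strict_bounds[of a] a by (simp add: floor_eq_iff)
    then show ?thesis using 0 by (simp add: partial_quotient_def)
  next
    case (Suc k)
    have "\<lfloor>real (a k) + cfval (\<lambda>i. a (Suc k + i))\<rfloor> = int (a k)"
      using cfval_strict_bounds[of "\<lambda>i. a (Suc k + i)"] a by (simp add: floor_eq_iff)
    then show ?thesis using Suc assms[of k] cfval_complete_quotient[of a k] a
      by (simp add: partial_quotient_def)
  qed
  then show ?thesis using cfval_irrational[of a] a by (auto simp: Bad_def)
qed

section \<open>Oscillatory integrals\<close>

text \<open>A linear function whose coefficients are not both small is small only near its zero. If
  l = 0 or r = 1, the outer piece on that side is absent and nothing is claimed there: the end point
  may lie in the exceptional interval.\<close>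

lemma linear_away_from_zero:
  fixes c0 c1 :: real
  assumes "\<sigma> \<le> \<bar>c0\<bar> + \<bar>c1\<bar>" "0 < \<sigma>" "0 < \<tau>"
  obtains l r where "0 \<le> l" "l \<le> r" "r \<le> 1" "r - l \<le> 8 * \<tau> / \<sigma>"
    "\<And>x. 0 < l \<Longrightarrow> 0 \<le> x \<Longrightarrow> x \<le> l \<Longrightarrow> \<tau> \<le> \<bar>c0 + c1 * x\<bar>"
    "\<And>x. r < 1 \<Longrightarrow> r \<le> x \<Longrightarrow> x \<le> 1 \<Longrightarrow> \<tau> \<le> \<bar>c0 + c1 * x\<bar>"
proof (cases "\<bar>c1\<bar> \<ge> \<sigma> / 4")
  case True
  with assms have c: "\<bar>c1\<bar> > 0" by linarith
  define z \<rho> where "z = - c0 / c1" and "\<rho> = \<tau> / \<bar>c1\<bar>"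
  have \<rho>: "0 < \<rho>" "\<rho> \<le> 4 * \<tau> / \<sigma>"
    using True assms c by (auto simp: \<rho>_def field_simps)
  have e: "\<bar>c0 + c1 * x\<bar> = \<bar>c1\<bar> * \<bar>x - z\<bar>" for x
    using c by (simp add: z_def field_simps flip: abs_mult)
  have far: "\<tau> \<le> \<bar>c0 + c1 * x\<bar>" if "\<rho> \<le> \<bar>x - z\<bar>" for x
    using that c unfolding e by (simp add: \<rho>_def field_simps)
  define l r where "l = max 0 (min 1 (z - \<rho>))" and "r = max 0 (min 1 (z + \<rho>))"
  show ?thesis
  proof (rule that[of l r])
    show "0 \<le> l" "l \<le> r" "r \<le> 1" using \<rho> by (auto simp: l_def r_def)
    have "r - l \<le> 2 * \<rho>" using \<rho> by (auto simp: l_def r_def)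
    then show "r - l \<le> 8 * \<tau> / \<sigma>" using \<rho> by simp
    show "\<tau> \<le> \<bar>c0 + c1 * x\<bar>" if "0 < l" "0 \<le> x" "x \<le> l" for x
      using that \<rho> by (intro far) (auto simp: l_def)
    show "\<tau> \<le> \<bar>c0 + c1 * x\<bar>" if "r < 1" "r \<le> x" "x \<le> 1" for x
      using that \<rho> by (intro far) (auto simp: r_def)
  qed
next
  case False
  show ?thesis
  proof (cases "\<tau> \<le> \<sigma> / 2")
    case True
    have "\<tau> \<le> \<bar>c0 + c1 * x\<bar>" if "0 \<le> x" "x \<le> 1" for x
    proof -
      have "\<bar>c1 * x\<bar> \<le> \<bar>c1\<bar>" using that by (simp add: abs_mult mult_left_le)
      then show ?thesis using False True assms by linarith
    qed
    then show ?thesis using assms by (intro that[of 1 1]) auto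
  next
    case False
    \<comment> \<open>Here \<tau> is so large compared with \<sigma> that the whole unit interval
      may be given up.\<close>
    then have "1 \<le> 8 * \<tau> / \<sigma>" using assms by (simp add: field_simps)
    then show ?thesis by (intro that[of 0 1]) auto
  qed
qed

text \<open>
  Van der Corput's first derivative estimate: integrate \<open>cis \<psi> = (cis \<psi>)' / (\<i> \<psi>')\<close> by parts.
\<close>

lemma oscillatory_integral_piece:
  fixes \<psi> d e :: "real \<Rightarrow> real"
  assumes "a \<le> b" "b - a \<le> 1" "A \<noteq> 0" "0 < \<tau>" "\<tau> \<le> 1"
    and d: "\<And>x. x \<in> {a..b} \<Longrightarrow> 1 \<le> d x \<and> d x \<le> B"
      "\<And>x. x \<in> {a..b} \<Longrightarrow> (d has_real_derivative d1) (at x within {a..b})"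
      "\<And>x. x \<in> {a..b} \<Longrightarrow> 0 \<le> d1 \<and> d1 \<le> d x"
    and e: "\<And>x. x \<in> {a..b} \<Longrightarrow> 1 \<le> e x \<and> e x \<le> B"
      "\<And>x. x \<in> {a..b} \<Longrightarrow> (e has_real_derivative e1) (at x within {a..b})"
      "\<And>x. x \<in> {a..b} \<Longrightarrow> 0 \<le> e1 \<and> e1 \<le> e x"
    and far: "\<And>x. x \<in> {a..b} \<Longrightarrow> \<tau> \<le> \<bar>d x - e x\<bar>"
    and \<psi>: "\<And>x. x \<in> {a..b} \<Longrightarrow>
      (\<psi> has_real_derivative A * (1 / (d x)\<^sup>2 - 1 / (e x)\<^sup>2)) (at x within {a..b})"
  shows "norm (integral {a..b} (\<lambda>x. cis (\<psi> x))) \<le> 2 * B ^ 8 / (\<bar>A\<bar> * \<tau>\<^sup>2)"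
proof -
  define y where "y x = 1 / (d x)\<^sup>2 - 1 / (e x)\<^sup>2" for x
  define y' where "y' x = - 2 * d1 / (d x) ^ 3 + 2 * e1 / (e x) ^ 3" for x
  define u where "u x = 1 / (A * y x)" for x
  define u' where "u' x = - y' x / (A * (y x)\<^sup>2)" for x
  \<comment> \<open>\<open>A * y\<close> is the derivative of \<psi> and \<open>u\<close> its
    reciprocal. \<open>G\<close> is the boundary term of the integration by parts: its derivative is
    \<open>cis \<psi> + R\<close>, so \<open>G\<close> and \<open>R\<close> are what has to be
    bounded.\<close>
  define G where "G x = - \<i> * (cis (\<psi> x) * complex_of_real (u x))" for x
  define R where "R x = - \<i> * (cis (\<psi> x) * complex_of_real (u' x))" for x
  have B: "1 \<le> B" using d(1)[of a] assms(1) by auto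
  have y_lower: "2 * \<tau> / B ^ 4 \<le> \<bar>y x\<bar>" if x: "x \<in> {a..b}" for x
  proof -
    have p: "1 \<le> d x" "d x \<le> B" "1 \<le> e x" "e x \<le> B" using d(1) e(1) x by auto
    have "y x = (e x - d x) * (e x + d x) / ((d x)\<^sup>2 * (e x)\<^sup>2)"
      using p by (simp add: y_def divide_simps) (simp add: algebra_simps power2_eq_square)
    then have "\<bar>y x\<bar> = \<bar>d x - e x\<bar> * (e x + d x) / ((d x)\<^sup>2 * (e x)\<^sup>2)"
      using p by (simp add: abs_mult abs_minus_commute)
    moreover have "\<tau> * 2 \<le> \<bar>d x - e x\<bar> * (e x + d x)"
      using far[OF x] p assms by (intro mult_mono) auto
    moreover have "(d x)\<^sup>2 * (e x)\<^sup>2 \<le> B\<^sup>2 * B\<^sup>2"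
      using p by (intro mult_mono power_mono) auto
    ultimately show ?thesis
      using p B assms by (auto intro!: frac_le mult_pos_pos simp: power2_eq_square power4_eq_xxxx mult.assoc mult.commute)
  qed
  have y0: "y x \<noteq> 0" if "x \<in> {a..b}" for x
  proof -
    have "0 < 2 * \<tau> / B ^ 4" using assms B by simp
    then show ?thesis using y_lower[OF that] by auto
  qed
  have y'_bound: "\<bar>y' x\<bar> \<le> 2" if x: "x \<in> {a..b}" for x
  proof -
    have *: "0 \<le> 2 * t / s ^ 3 \<and> 2 * t / s ^ 3 \<le> 2" if "0 \<le> t" "t \<le> s" "1 \<le> s" for s t :: real
    proof -
      have "s ^ 1 \<le> s ^ 3" using that by (intro power_increasing) auto
      then have "t \<le> s ^ 3" using that by simp
      then show ?thesis using that by (simp add: field_simps)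
    qed
    have "0 \<le> 2 * d1 / d x ^ 3 \<and> 2 * d1 / d x ^ 3 \<le> 2" "0 \<le> 2 * e1 / e x ^ 3 \<and> 2 * e1 / e x ^ 3 \<le> 2"
      using d(1,3)[OF x] e(1,3)[OF x] by (auto intro!: *[THEN conjunct1] *[THEN conjunct2])
    moreover have "y' x = 2 * e1 / e x ^ 3 - 2 * d1 / d x ^ 3" by (simp add: y'_def)
    ultimately show ?thesis by linarith
  qed
  have y_deriv: "(y has_real_derivative y' x) (at x within {a..b})" if x: "x \<in> {a..b}" for x
  proof -
    have p: "d x \<noteq> 0" "e x \<noteq> 0" using d(1)[OF x] e(1)[OF x] by auto
    have "(y has_real_derivative (0 * (d x)\<^sup>2 - 1 * (of_nat 2 * (d1 * d x ^ (2 - Suc 0)))) / ((d x)\<^sup>2 * (d x)\<^sup>2)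
       - (0 * (e x)\<^sup>2 - 1 * (of_nat 2 * (e1 * e x ^ (2 - Suc 0)))) / ((e x)\<^sup>2 * (e x)\<^sup>2)) (at x within {a..b})"
      unfolding y_def[abs_def] using p
      by (intro DERIV_diff DERIV_divide DERIV_power d(2) e(2) x DERIV_const) auto
    also have "(0 * (d x)\<^sup>2 - 1 * (of_nat 2 * (d1 * d x ^ (2 - Suc 0)))) / ((d x)\<^sup>2 * (d x)\<^sup>2)
       - (0 * (e x)\<^sup>2 - 1 * (of_nat 2 * (e1 * e x ^ (2 - Suc 0)))) / ((e x)\<^sup>2 * (e x)\<^sup>2) = y' x"
      using p by (simp add: y'_def divide_simps power2_eq_square power3_eq_cube)
    finally show ?thesis .
  qed
  have u_deriv: "(u has_real_derivative u' x) (at x within {a..b})" if x: "x \<in> {a..b}" for x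
    unfolding u_def[abs_def] u'_def using y0[OF x] assms(3)
    by (auto intro!: derivative_eq_intros y_deriv x simp: divide_simps power2_eq_square)
  have \<psi>': "(\<psi> has_real_derivative A * y x) (at x within {a..b})" if x: "x \<in> {a..b}" for x
    using \<psi>[OF x] by (simp add: y_def)
  have G_deriv: "(G has_vector_derivative cis (\<psi> x) + R x) (at x within {a..b})" if x: "x \<in> {a..b}" for x
  proof -
    have c: "((\<lambda>x. cis (\<psi> x)) has_vector_derivative of_real (A * y x) * (\<i> * cis (\<psi> x))) (at x within {a..b})"
      using has_derivative_cis[OF \<psi>'[OF x, unfolded has_field_derivative_def]]
      by (simp add: has_vector_derivative_def scaleR_conv_of_real mult_ac)
    have v: "((\<lambda>x. complex_of_real (u x)) has_vector_derivative of_real (u' x)) (at x within {a..b})"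
      using u_deriv[OF x] by (intro has_vector_derivative_of_real) (simp add: has_real_derivative_iff_has_vector_derivative)
    have "(G has_vector_derivative - \<i> * (cis (\<psi> x) * of_real (u' x)
       + of_real (A * y x) * (\<i> * cis (\<psi> x)) * of_real (u x))) (at x within {a..b})"
      unfolding G_def[abs_def]
      by (intro has_vector_derivative_mult_right has_vector_derivative_mult c v)
    moreover have "complex_of_real (A * y x) * of_real (u x) = 1"
      using y0[OF x] assms(3) by (simp add: u_def flip: of_real_mult)
    then have "- \<i> * (cis (\<psi> x) * of_real (u' x) + of_real (A * y x) * (\<i> * cis (\<psi> x)) * of_real (u x))
       = cis (\<psi> x) + R x"
      by (simp add: R_def algebra_simps del: of_real_mult)
    ultimately show ?thesis by simp
  qed
  have u_bound: "\<bar>u x\<bar> \<le> B ^ 4 / (2 * \<bar>A\<bar> * \<tau>)" if x: "x \<in> {a..b}" for x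
  proof -
    have "\<bar>A\<bar> * (2 * \<tau> / B ^ 4) \<le> \<bar>A * y x\<bar>"
      using y_lower[OF x] by (simp add: abs_mult mult_left_mono del: times_divide_eq_right)
    moreover have p: "0 < \<bar>A\<bar> * (2 * \<tau> / B ^ 4)" using assms B by simp
    ultimately have "1 / \<bar>A * y x\<bar> \<le> 1 / (\<bar>A\<bar> * (2 * \<tau> / B ^ 4))"
      by (intro divide_left_mono mult_pos_pos[OF less_le_trans[OF p] p]) auto
    then show ?thesis by (simp add: u_def field_simps)
  qed
  have R_bound: "norm (R x) \<le> B ^ 8 / (2 * \<bar>A\<bar> * \<tau>\<^sup>2)" if x: "x \<in> {a..b}" for x
  proof -
    have p: "0 < 2 * \<tau> / B ^ 4" using assms B by simp
    have "(2 * \<tau> / B ^ 4)\<^sup>2 \<le> \<bar>y x\<bar>\<^sup>2" using y_lower[OF x] p by (intro power_mono) auto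
    then have "\<bar>A\<bar> * (2 * \<tau> / B ^ 4)\<^sup>2 \<le> \<bar>A\<bar> * (y x)\<^sup>2" by (intro mult_left_mono) auto
    then have "\<bar>y' x\<bar> / (\<bar>A\<bar> * (y x)\<^sup>2) \<le> 2 / (\<bar>A\<bar> * (2 * \<tau> / B ^ 4)\<^sup>2)"
      using y'_bound[OF x] assms(3) by (intro frac_le mult_pos_pos zero_less_power p) auto
    also have "\<dots> = B ^ 8 / (2 * \<bar>A\<bar> * \<tau>\<^sup>2)"
      using B assms by (simp add: field_simps flip: power_mult)
    finally show ?thesis by (simp add: R_def u'_def norm_mult norm_divide norm_power)
  qed
  have int1: "((\<lambda>x. cis (\<psi> x) + R x) has_integral G b - G a) {a..b}"
    by (rule fundamental_theorem_of_calculus[OF assms(1)]) (use G_deriv in auto)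
  have cont: "continuous_on {a..b} (\<lambda>x. cis (\<psi> x))"
    by (intro continuous_intros DERIV_continuous_on[of _ \<psi>]) (use \<psi>' in auto)
  have int2: "((\<lambda>x. cis (\<psi> x)) has_integral integral {a..b} (\<lambda>x. cis (\<psi> x))) {a..b}"
    using cont integrable_continuous_real by blast
  have int3: "(R has_integral (G b - G a) - integral {a..b} (\<lambda>x. cis (\<psi> x))) {a..b}"
    using has_integral_diff[OF int1 int2] by simp
  let ?K = "B ^ 8 / (2 * \<bar>A\<bar> * \<tau>\<^sup>2)"
  have K0: "0 \<le> ?K" using B by simp
  have "norm ((G b - G a) - integral {a..b} (\<lambda>x. cis (\<psi> x))) \<le> ?K * Henstock_Kurzweil_Integration.content (cbox a b)"
    by (rule has_integral_bound[OF K0, of R]) (use int3 R_bound in auto)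
  also have "\<dots> \<le> ?K * 1" using K0 assms by (intro mult_left_mono) auto
  finally have 1: "norm ((G b - G a) - integral {a..b} (\<lambda>x. cis (\<psi> x))) \<le> ?K" by simp
  have G: "norm (G x) \<le> ?K" if x: "x \<in> {a..b}" for x
  proof -
    \<comment> \<open>The boundary term has only one factor \<tau> in the denominator; as \<tau>
      \<le> 1 \<le> B, it obeys the bound of the remainder.\<close>
    have "B ^ 4 * \<tau> \<le> B ^ 8 * 1" using assms B by (intro mult_mono power_increasing) auto
    then have "B ^ 4 / (2 * \<bar>A\<bar> * \<tau>) \<le> ?K"
      using assms by (simp add: field_simps power2_eq_square)
    then show ?thesis using u_bound[OF x] by (simp add: G_def norm_mult)
  qed
  have "norm (integral {a..b} (\<lambda>x. cis (\<psi> x))) \<le>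
      norm ((G b - G a) - integral {a..b} (\<lambda>x. cis (\<psi> x))) + norm (G b) + norm (G a)"
    by norm
  also have "\<dots> \<le> ?K + ?K + ?K" using 1 G[of a] G[of b] assms(1) by (intro add_mono) auto
  also have "\<dots> \<le> 4 * ?K" using K0 by linarith
  finally show ?thesis by simp
qed

text \<open>The interval where the two linear denominators nearly agree is estimated by its length,
  the two outer pieces by the first derivative estimate. The parameter \<tau> stays free, so that
  the two errors can be balanced later.\<close>

lemma oscillatory_integral_linear:
  fixes \<psi> :: "real \<Rightarrow> real"
  assumes "A \<noteq> 0" "0 < \<tau>" "\<tau> \<le> 1" "0 < \<sigma>"
    and d: "1 \<le> d0" "0 \<le> d1" "d1 \<le> d0" "d0 + d1 \<le> B"
    and e: "1 \<le> e0" "0 \<le> e1" "e1 \<le> e0" "e0 + e1 \<le> B"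
    and sep: "\<sigma> \<le> \<bar>d0 - e0\<bar> + \<bar>d1 - e1\<bar>"
    and \<psi>: "\<And>x. x \<in> {0..1} \<Longrightarrow>
      (\<psi> has_real_derivative A * (1 / (d0 + d1 * x)\<^sup>2 - 1 / (e0 + e1 * x)\<^sup>2)) (at x within {0..1})"
  shows "norm (integral {0..1} (\<lambda>x. cis (\<psi> x))) \<le> 8 * \<tau> / \<sigma> + 4 * B ^ 8 / (\<bar>A\<bar> * \<tau>\<^sup>2)"
proof -
  obtain l r where lr: "0 \<le> l" "l \<le> r" "r \<le> 1" "r - l \<le> 8 * \<tau> / \<sigma>"
    and far: "\<And>x. 0 < l \<Longrightarrow> 0 \<le> x \<Longrightarrow> x \<le> l \<Longrightarrow> \<tau> \<le> \<bar>(d0 - e0) + (d1 - e1) * x\<bar>"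
    "\<And>x. r < 1 \<Longrightarrow> r \<le> x \<Longrightarrow> x \<le> 1 \<Longrightarrow> \<tau> \<le> \<bar>(d0 - e0) + (d1 - e1) * x\<bar>"
    using linear_away_from_zero[OF sep assms(4,2)] by blast
  let ?K = "2 * B ^ 8 / (\<bar>A\<bar> * \<tau>\<^sup>2)"
  have B: "1 \<le> B" using d by auto
  have piece: "norm (integral {a..b} (\<lambda>x. cis (\<psi> x))) \<le> ?K"
    if ab: "0 \<le> a" "a \<le> b" "b \<le> 1" and f: "\<And>x. a \<le> x \<Longrightarrow> x \<le> b \<Longrightarrow> \<tau> \<le> \<bar>(d0 - e0) + (d1 - e1) * x\<bar>" for a b
  proof (rule oscillatory_integral_piece[where d = "\<lambda>x. d0 + d1 * x" and e = "\<lambda>x. e0 + e1 * x" and ?d1.0 = d1 and ?e1.0 = e1])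
    have *: "1 \<le> c0 + c1 * x \<and> c0 + c1 * x \<le> B \<and> c1 \<le> c0 + c1 * x"
      if "1 \<le> c0" "0 \<le> c1" "c1 \<le> c0" "c0 + c1 \<le> B" "x \<in> {a..b}" for c0 c1 x
    proof -
      have "0 \<le> c1 * x" "c1 * x \<le> c1" using that ab by (auto intro: mult_left_le)
      then show ?thesis using that by simp
    qed
    show "1 \<le> d0 + d1 * x \<and> d0 + d1 * x \<le> B" "0 \<le> d1 \<and> d1 \<le> d0 + d1 * x" if "x \<in> {a..b}" for x
      using *[OF d that] d by auto
    show "1 \<le> e0 + e1 * x \<and> e0 + e1 * x \<le> B" "0 \<le> e1 \<and> e1 \<le> e0 + e1 * x" if "x \<in> {a..b}" for x
      using *[OF e that] e by auto
    show "((\<lambda>x. d0 + d1 * x) has_real_derivative d1) (at x within {a..b})"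
      "((\<lambda>x. e0 + e1 * x) has_real_derivative e1) (at x within {a..b})" for x
      by (auto intro!: derivative_eq_intros)
    show "\<tau> \<le> \<bar>d0 + d1 * x - (e0 + e1 * x)\<bar>" if "x \<in> {a..b}" for x
      using f[of x] that by (simp add: algebra_simps)
    show "(\<psi> has_real_derivative A * (1 / (d0 + d1 * x)\<^sup>2 - 1 / (e0 + e1 * x)\<^sup>2)) (at x within {a..b})"
      if "x \<in> {a..b}" for x
      by (rule DERIV_subset[OF \<psi>]) (use that ab in auto)
  qed (use ab assms in auto)
  have K0: "0 \<le> ?K" using B by simp
  have cont: "continuous_on {0..1} (\<lambda>x. cis (\<psi> x))"
    by (intro continuous_intros DERIV_continuous_on[of _ \<psi>]) (use \<psi> in auto)
  have i: "(\<lambda>x. cis (\<psi> x)) integrable_on {a..b}" if "0 \<le> a" "b \<le> 1" for a b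
    by (rule integrable_continuous_real, rule continuous_on_subset[OF cont]) (use that in auto)
  have I1: "norm (integral {0..l} (\<lambda>x. cis (\<psi> x))) \<le> ?K"
    using piece[of 0 l] far(1) lr K0 by (cases "l = 0") auto
  have I3: "norm (integral {r..1} (\<lambda>x. cis (\<psi> x))) \<le> ?K"
    using piece[of r 1] far(2) lr K0 by (cases "r = 1") auto
  have I2: "norm (integral {l..r} (\<lambda>x. cis (\<psi> x))) \<le> r - l"
    using integral_bound[of l r "\<lambda>x. cis (\<psi> x)" 1] lr continuous_on_subset[OF cont, of "{l..r}"] by auto
  have "integral {0..1} (\<lambda>x. cis (\<psi> x)) = integral {0..r} (\<lambda>x. cis (\<psi> x)) + integral {r..1} (\<lambda>x. cis (\<psi> x))"
    using lr i[of 0 1] by (intro Henstock_Kurzweil_Integration.integral_combine[symmetric]) auto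
  also have "integral {0..r} (\<lambda>x. cis (\<psi> x)) = integral {0..l} (\<lambda>x. cis (\<psi> x)) + integral {l..r} (\<lambda>x. cis (\<psi> x))"
    using lr i[of 0 r] by (intro Henstock_Kurzweil_Integration.integral_combine[symmetric]) auto
  finally have "norm (integral {0..1} (\<lambda>x. cis (\<psi> x))) \<le>
    norm (integral {0..l} (\<lambda>x. cis (\<psi> x))) + norm (integral {l..r} (\<lambda>x. cis (\<psi> x)))
     + norm (integral {r..1} (\<lambda>x. cis (\<psi> x)))" by (metis add_mono_thms_linordered_semiring(3) norm_triangle_ineq order_trans)
  also have "\<dots> \<le> ?K + 8 * \<tau> / \<sigma> + ?K" using I1 I2 I3 lr by linarith
  finally show ?thesis by simp
qed

section \<open>Cylinders\<close>

definition words :: "nat \<Rightarrow> nat \<Rightarrow> nat list set" where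
  "words M k = {v. set v \<subseteq> {1..M} \<and> length v = k}"

lemma finite_words [simp]: "finite (words M k)"
  unfolding words_def by (rule finite_lists_length_eq) simp

lemma card_words: "card (words M k) = M ^ k"
  unfolding words_def by (subst card_lists_length_eq) auto

lemma words_nonzero: "v \<in> words M k \<Longrightarrow> 0 \<notin> set v"
  by (auto simp: words_def)

lemma words_Suc: "words M (Suc k) = (\<lambda>(v, a). v @ [a]) ` (words M k \<times> {1..M})"
proof
  show "words M (Suc k) \<subseteq> (\<lambda>(v, a). v @ [a]) ` (words M k \<times> {1..M})"
  proof
    fix w assume w: "w \<in> words M (Suc k)"
    then obtain v a where "w = v @ [a]" by (cases w rule: rev_cases) (auto simp: words_def)
    with w have "(v, a) \<in> words M k \<times> {1..M}" "w = (\<lambda>(v, a). v @ [a]) (v, a)"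
      by (auto simp: words_def)
    then show "w \<in> (\<lambda>(v, a). v @ [a]) ` (words M k \<times> {1..M})" by blast
  qed
qed (auto simp: words_def)

text \<open>\<open>cf w\<close> increases or decreases according to the parity of
  \<open>length w\<close>, hence min and max. The interval is open so that words none of which is a
  prefix of another have disjoint cylinders.\<close>

definition cyl :: "nat list \<Rightarrow> real set" where
  "cyl w = {min (cf w 0) (cf w 1)<..<max (cf w 0) (cf w 1)}"

lemma continuous_on_cf:
  "0 \<notin> set w \<Longrightarrow> continuous_on {0..1} (cf w)"
  by (rule continuous_on_subset[of "{0..}"], rule DERIV_continuous_on, rule cf_has_deriv) auto

lemma cyl_subset_image:
  assumes "0 \<notin> set w" shows "cyl w \<subseteq> cf w ` {0<..<1}"
proof
  fix y assume y: "y \<in> cyl w"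
  have "\<exists>x. 0 \<le> x \<and> x \<le> 1 \<and> cf w x = y"
  proof (cases "cf w 0 \<le> cf w 1")
    case True
    then show ?thesis using y IVT'[of "cf w" 0 y 1] continuous_on_cf[OF assms] by (auto simp: cyl_def)
  next
    case False
    then show ?thesis using y IVT2'[of "cf w" 1 y 0] continuous_on_cf[OF assms] by (auto simp: cyl_def)
  qed
  then obtain x where x: "0 \<le> x" "x \<le> 1" "cf w x = y" by blast
  with y have "x \<noteq> 0" "x \<noteq> 1" by (auto simp: cyl_def)
  with x show "y \<in> cf w ` {0<..<1}" by force
qed

lemma measure_cyl: "0 \<notin> set w \<Longrightarrow> measure lebesgue (cyl w) = cyl_len w"
  using cf_ends[of w] by (cases "cf w 0 \<le> cf w 1") (simp_all add: cyl_def)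

lemma cyl_lmeasurable [simp]: "cyl w \<in> lmeasurable"
  by (simp add: cyl_def)

lemma cyl_subset_unit: "0 \<notin> set w \<Longrightarrow> cyl w \<subseteq> {0..1}"
  using cf_bounds[of w 0] cf_bounds[of w 1] by (auto simp: cyl_def)

text \<open>The last hypothesis says that no word of S is a proper prefix of another; by
  \<open>cf_open_disjoint\<close> the cylinders are then disjoint.\<close>

lemma measure_UN_cyl:
  assumes "finite S" "\<And>w. w \<in> S \<Longrightarrow> 0 \<notin> set w"
    and anti: "\<And>v w. v \<in> S \<Longrightarrow> w \<in> S \<Longrightarrow> length v \<le> length w \<Longrightarrow> v = take (length v) w \<Longrightarrow> v = w"
  shows "measure lebesgue (\<Union>w\<in>S. cyl w) = (\<Sum>w\<in>S. cyl_len w)"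
proof -
  have "v = w" if v: "v \<in> S" "w \<in> S" "length v \<le> length w" and z: "z \<in> cyl v" "z \<in> cyl w" for v w z
  proof -
    have nz: "0 \<notin> set v" "0 \<notin> set w" using v assms(2) by blast+
    obtain x where x: "0 < x" "x < 1" "z = cf v x"
      using subsetD[OF cyl_subset_image[OF nz(1)] z(1)] by auto
    obtain y where y: "0 < y" "y < 1" "z = cf w y"
      using subsetD[OF cyl_subset_image[OF nz(2)] z(2)] by auto
    have "v = take (length v) w"
      by (rule cf_open_disjoint[of v x w y]) (use x y nz v in simp_all)
    then show ?thesis using anti v by blast
  qed
  then have "pairwise (\<lambda>v w. disjnt (cyl v) (cyl w)) S"
    unfolding pairwise_def disjnt_iff by (metis nle_le)
  then have "measure lebesgue (\<Union>w\<in>S. cyl w) = (\<Sum>w\<in>S. measure lebesgue (cyl w))"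
    using assms(1) by (intro measure_UNION') auto
  then show ?thesis using assms(2) by (simp add: measure_cyl)
qed

text \<open>The digits above M belong to the tails below 1 / (M + 1), whose share of the cylinder is
  the subtracted fraction. The induction on M telescopes.\<close>

lemma sum_cyl_len_children:
  assumes "0 \<notin> set v"
  shows "(\<Sum>a=1..M. cyl_len (v @ [a])) = cyl_len v * (1 - (den1 v + den2 v) / ((real M + 1) * den1 v + den2 v))"
proof -
  let ?q = "den1 v" and ?r = "den2 v"
  have b: "1 \<le> ?q" "0 \<le> ?r" using den_bounds[OF assms] by auto
  have p: "0 < real k * ?q + ?r" if "1 \<le> k" for k
    using b that by (intro add_pos_nonneg mult_pos_pos) auto
  show ?thesis
  proof (induction M)
    case (Suc M)
    let ?x = "(real M + 1) * ?q + ?r"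
    have x: "0 < ?x" "0 < ?x + ?q" using p[of "Suc M"] b by (auto simp: add.commute)
    have e: "cyl_len (v @ [Suc M]) = 1 / (?x * (?x + ?q))"
      unfolding cyl_len_def den_snoc by (simp add: algebra_simps)
    have "(\<Sum>a=1..Suc M. cyl_len (v @ [a])) = 1 / (?q * (?q + ?r)) * (1 - (?q + ?r) / ?x) + 1 / (?x * (?x + ?q))"
      using Suc.IH by (simp add: e) (simp add: cyl_len_def)
    also have "\<dots> = 1 / (?q * (?q + ?r)) * (1 - (?q + ?r) / (?x + ?q))"
    proof -
      have *: "1 / (q * s) * (1 - s / x) + 1 / (x * (x + q)) = 1 / (q * s) * (1 - s / (x + q))"
        if "q > 0" "s > 0" "x > 0" for q s x :: real
        using that by (simp add: divide_simps add_pos_pos) (simp add: algebra_simps)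
      show ?thesis using x b by (intro *) auto
    qed
    also have "?x + ?q = (real (Suc M) + 1) * ?q + ?r" by (simp add: algebra_simps)
    finally show ?case by (simp add: cyl_len_def)
  qed (use b in simp)
qed

lemma sum_cyl_len_children_ge:
  assumes "0 \<notin> set v"
  shows "cyl_len v * (1 - 2 / (real M + 1)) \<le> (\<Sum>a=1..M. cyl_len (v @ [a]))"
proof -
  let ?q = "den1 v" and ?r = "den2 v"
  have b: "1 \<le> ?q" "0 \<le> ?r" "?r \<le> ?q" using den_bounds[OF assms] by auto
  then have "(?q + ?r) / ((real M + 1) * ?q + ?r) \<le> (2 * ?q) / ((real M + 1) * ?q)"
    by (intro frac_le) auto
  also have "\<dots> = 2 / (real M + 1)" using b by simp
  finally show ?thesis
    unfolding sum_cyl_len_children[OF assms] using cyl_len_pos[OF assms] by (intro mult_left_mono) auto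
qed

lemma sum_cyl_len_words:
  assumes "M \<ge> 1"
  shows "(1 - 2 / (real M + 1)) ^ k \<le> (\<Sum>v\<in>words M k. cyl_len v)"
proof (induction k)
  case 0
  have "words M 0 = {[]}" by (auto simp: words_def)
  then show ?case by simp
next
  case (Suc k)
  have c: "0 \<le> 1 - 2 / (real M + 1)" using assms by (simp add: field_simps)
  have "inj_on (\<lambda>(v, a). v @ [a]) (words M k \<times> {1..M})" by (auto simp: inj_on_def)
  then have "(\<Sum>v\<in>words M (Suc k). cyl_len v) = (\<Sum>(v, a)\<in>words M k \<times> {1..M}. cyl_len (v @ [a]))"
    unfolding words_Suc by (subst sum.reindex) (auto simp: case_prod_unfold)
  also have "\<dots> = (\<Sum>v\<in>words M k. \<Sum>a=1..M. cyl_len (v @ [a]))"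
    by (subst sum.cartesian_product) simp
  also have "\<dots> \<ge> (\<Sum>v\<in>words M k. cyl_len v * (1 - 2 / (real M + 1)))"
    by (intro sum_mono sum_cyl_len_children_ge words_nonzero)
  also have "(\<Sum>v\<in>words M k. cyl_len v * (1 - 2 / (real M + 1))) \<ge> (1 - 2 / (real M + 1)) ^ k * (1 - 2 / (real M + 1))"
    using Suc c by (simp add: mult_right_mono flip: sum_distrib_right)
  finally show ?case by (simp add: mult.commute)
qed

lemma measure_words_cyl:
  assumes "M \<ge> 1"
  shows "(1 - 2 / (real M + 1)) ^ k \<le> measure lebesgue (\<Union>v\<in>words M k. cyl v)"
proof -
  have "measure lebesgue (\<Union>v\<in>words M k. cyl v) = (\<Sum>v\<in>words M k. cyl_len v)"
    by (rule measure_UN_cyl) (auto simp: words_nonzero, auto simp: words_def)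
  then show ?thesis using sum_cyl_len_words[OF assms] by simp
qed

section \<open>Separation of the denominators of distinct words\<close>

lemma den_separation_step:
  fixes r s r' s' t :: real
  shows "t \<le> \<bar>r - r'\<bar> + \<bar>s - s'\<bar> \<Longrightarrow> a = 1 \<or> a = 2 \<Longrightarrow>
      t / 3 \<le> \<bar>(real a * r + s) - (real a * r' + s')\<bar> + \<bar>r - r'\<bar>"
    and "t \<le> r \<Longrightarrow> t \<le> r' \<Longrightarrow> s \<le> r \<Longrightarrow> s' \<le> r' \<Longrightarrow> t / 2 \<le> s \<Longrightarrow> t / 2 \<le> s' \<Longrightarrow> 0 \<le> t \<Longrightarrow>
      t / 18 \<le> \<bar>(r + s) - (2 * r' + s')\<bar> + \<bar>r - r'\<bar>"
proof -
  show "t / 3 \<le> \<bar>(real a * r + s) - (real a * r' + s')\<bar> + \<bar>r - r'\<bar>"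
    if t: "t \<le> \<bar>r - r'\<bar> + \<bar>s - s'\<bar>" "a = 1 \<or> a = 2"
  proof -
    have "\<bar>s - s'\<bar> \<le> \<bar>(real a * r + s) - (real a * r' + s')\<bar> + 2 * \<bar>r - r'\<bar>"
    proof -
      have "(real a * r + s) - (real a * r' + s') = real a * (r - r') + (s - s')" by (simp add: algebra_simps)
      moreover have "\<bar>real a * (r - r')\<bar> \<le> 2 * \<bar>r - r'\<bar>" using t(2) by (auto simp: abs_mult)
      ultimately show ?thesis by linarith
    qed
    moreover have "0 \<le> \<bar>(real a * r + s) - (real a * r' + s')\<bar>" by simp
    ultimately show ?thesis using t(1) by argo
  qed
next
  show "t / 18 \<le> \<bar>(r + s) - (2 * r' + s')\<bar> + \<bar>r - r'\<bar>"
    if "t \<le> r" "t \<le> r'" "s \<le> r" "s' \<le> r'" "t / 2 \<le> s" "t / 2 \<le> s'" "0 \<le> t"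
    \<comment> \<open>If r and r' nearly agree, then agreement of r + s with 2 r' + s' would force s
      to be near r' + s', which is impossible as s \<le> r and s' \<ge> t / 2.\<close>
    using that by linarith
qed

text \<open>Compare the words from the right. Where they differ last, the digits are 1 and 2, and
  the denominators differ by a fixed proportion of \<open>den1 p\<close>; each common digit after
  that divides the separation by at most 3. The hypothesis on \<open>den2 p\<close> keeps the second
  denominator at least half of \<open>den1 p\<close>, as the comparison of the digits 1 and 2
  requires.\<close>

lemma den_separation:
  assumes p: "0 \<notin> set p" "den1 p \<le> 2 * den2 p"
  shows "w \<in> words 2 k \<Longrightarrow> w' \<in> words 2 k \<Longrightarrow> w \<noteq> w' \<Longrightarrow>
    den1 p / 6 * (1/3) ^ k \<le> \<bar>den1 (p @ w) - den1 (p @ w')\<bar> + \<bar>den2 (p @ w) - den2 (p @ w')\<bar>"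
proof (induction k arbitrary: w w')
  case (Suc k)
  obtain v a v' b where w: "w = v @ [a]" "v \<in> words 2 k" "a \<in> {1..2}"
    "w' = v' @ [b]" "v' \<in> words 2 k" "b \<in> {1..2}"
    using Suc.prems(1,2) unfolding words_Suc by auto
  have q: "0 < den1 p" using den1_ge_1[OF p(1)] by simp
  have low: "den1 p \<le> den1 (p @ u) \<and> den1 p / 2 \<le> den2 (p @ u) \<and> den2 (p @ u) \<le> den1 (p @ u)"
    if "u \<in> words 2 k" for u
  proof -
    have nz: "0 \<notin> set (p @ u)" using p(1) words_nonzero[OF that] by simp
    have "den1 p / 2 \<le> den2 (p @ u)"
    proof (cases u rule: rev_cases)
      case (snoc u' c)
      then have "den1 p \<le> den1 (p @ u')" using nz by (intro den1_append_ge) auto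
      moreover have "den2 (p @ u) = den1 (p @ u')" using den_snoc(2)[of "p @ u'" c] snoc by simp
      ultimately show ?thesis using q by simp
    qed (use p in simp)
    then show ?thesis using den1_append_ge[OF nz] den2_le_den1[OF nz] by simp
  qed
  let ?r = "den1 (p @ v)" and ?s = "den2 (p @ v)" and ?r' = "den1 (p @ v')" and ?s' = "den2 (p @ v')"
  have e: "den1 (p @ w) = real a * ?r + ?s" "den2 (p @ w) = ?r"
    "den1 (p @ w') = real b * ?r' + ?s'" "den2 (p @ w') = ?r'"
    using den_snoc[of "p @ v" a] den_snoc[of "p @ v'" b] w by simp_all
  have t: "0 \<le> den1 p * (1/3) ^ k" "den1 p * (1/3) ^ k \<le> den1 p"
    using q by (auto intro: mult_left_le power_le_one)
  show ?case
  proof (cases "a = b")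
    case True
    then have "v \<noteq> v'" using w Suc.prems by auto
    then have IH: "den1 p / 6 * (1/3) ^ k \<le> \<bar>?r - ?r'\<bar> + \<bar>?s - ?s'\<bar>" using Suc.IH w by blast
    have "a = 1 \<or> a = 2" using w by auto
    then show ?thesis
      unfolding e True[symmetric] using den_separation_step(1)[OF IH] by simp
  next
    case False
    then have ab: "(a = 1 \<and> b = 2) \<or> (a = 2 \<and> b = 1)" using w by auto
    have "den1 p / 6 * (1/3) ^ Suc k \<le> den1 p / 18" using t by simp
    moreover have "den1 p / 18 \<le> \<bar>(?r + ?s) - (2 * ?r' + ?s')\<bar> + \<bar>?r - ?r'\<bar>"
      "den1 p / 18 \<le> \<bar>(?r' + ?s') - (2 * ?r + ?s)\<bar> + \<bar>?r' - ?r\<bar>"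
      using low[OF w(2)] low[OF w(5)] q
      by (intro den_separation_step(2); simp)+
    ultimately show ?thesis
      unfolding e using ab by (elim disjE) (simp_all add: abs_minus_commute)
  qed
qed (auto simp: words_def)

section \<open>Hitting a target with one of many phases\<close>

lemma nint_dist_le: "nint_dist x \<le> \<bar>x - of_int m\<bar>"
  unfolding nint_dist_def using infdist_le[of "of_int m" \<int> x] by (simp add: dist_real_def)

lemma nint_dist_eq_round: "nint_dist x = \<bar>x - of_int (round x)\<bar>"
proof (rule antisym)
  have "infdist x \<int> = (INF a\<in>\<int>. dist x a)" by (rule infdist_notempty) auto
  also have "\<dots> \<ge> \<bar>x - of_int (round x)\<bar>"
    by (rule cINF_greatest) (auto elim!: Ints_cases simp: dist_real_def round_diff_minimal)
  finally show "\<bar>x - of_int (round x)\<bar> \<le> nint_dist x" by (simp add: nint_dist_def)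
qed (rule nint_dist_le)

lemma nint_dist_nonneg [simp]: "0 \<le> nint_dist x"
  by (simp add: nint_dist_eq_round)

lemma nint_dist_triangle: "nint_dist x \<le> nint_dist y + \<bar>x - y\<bar>"
  unfolding nint_dist_def using infdist_triangle[of x \<int> y] by (simp add: dist_real_def)

text \<open>The chord has length 2 |sin (pi s)|, where s is the signed distance from t to the
  nearest integer. The crude bound |sin y| \<ge> |y| / 3 for |y| \<le> 2 is enough because pi >
  3.\<close>

lemma norm_cis_minus_one_ge: "2 * nint_dist t \<le> norm (cis (2 * pi * t) - 1)"
proof -
  define s where "s = t - of_int (round t)"
  have s: "\<bar>s\<bar> \<le> 1/2" using of_int_round_abs_le[of t] by (simp add: s_def abs_minus_commute)
  have "cis (2 * pi * t) = cis (2 * pi * s) * cis (2 * pi * of_int (round t))"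
    by (simp add: s_def cis_mult algebra_simps)
  then have e: "cis (2 * pi * t) = cis (2 * pi * s)" by (simp add: cis_multiple_2pi)
  define y where "y = pi * s"
  have y2: "2 * pi * s = 2 * y" by (simp add: y_def)
  have "(norm (cis (2 * pi * s) - 1))\<^sup>2 = (cos (2 * y) - 1)\<^sup>2 + (sin (2 * y))\<^sup>2"
    unfolding y2 by (simp add: cmod_power2)
  also have "\<dots> = 2 - 2 * cos (2 * y)"
    using sin_cos_squared_add[of "2 * y"] by (simp add: power2_eq_square algebra_simps)
  also have "\<dots> = (2 * \<bar>sin y\<bar>)\<^sup>2"
    by (simp add: cos_double_sin power2_eq_square)
  finally have n: "norm (cis (2 * pi * s) - 1) = 2 * \<bar>sin y\<bar>"
    by (metis abs_ge_zero abs_of_nonneg mult_nonneg_nonneg norm_ge_zero power2_eq_iff_nonneg zero_le_numeral)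
  have "\<bar>s\<bar> \<le> \<bar>sin y\<bar>"
  proof -
    have "\<bar>sin y - (\<Sum>m<3. sin_coeff m * y ^ m)\<bar> \<le> inverse (fact 3) * \<bar>y\<bar> ^ 3"
      by (rule Maclaurin_sin_bound)
    moreover have "(\<Sum>m<3. sin_coeff m * y ^ m) = y"
      by (simp add: eval_nat_numeral sin_coeff_def)
    ultimately have 1: "\<bar>sin y - y\<bar> \<le> \<bar>y\<bar> ^ 3 / 6" by (simp add: fact_numeral)
    have y: "\<bar>y\<bar> = pi * \<bar>s\<bar>" by (simp add: y_def abs_mult)
    have "\<bar>y\<bar> \<le> 4 * (1/2)" unfolding y using s pi_less_4 by (intro mult_mono) auto
    then have "\<bar>y\<bar> ^ 2 \<le> 2 ^ 2" by (intro power_mono) auto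
    then have "\<bar>y\<bar> * \<bar>y\<bar> ^ 2 \<le> \<bar>y\<bar> * 2 ^ 2" by (intro mult_left_mono) auto
    then have "\<bar>y\<bar> ^ 3 \<le> 4 * \<bar>y\<bar>" by (simp add: power3_eq_cube power2_eq_square mult.commute)
    then have "\<bar>sin y\<bar> \<ge> \<bar>y\<bar> / 3" using 1 by linarith
    moreover have "\<bar>y\<bar> \<ge> 3 * \<bar>s\<bar>" unfolding y using pi_gt3 by (intro mult_right_mono) auto
    ultimately show ?thesis by linarith
  qed
  then show ?thesis using n e by (simp add: nint_dist_eq_round s_def)
qed

lemma geometric_cis_bound:
  assumes "0 < nint_dist t"
  shows "norm (\<Sum>k<H. cis (2 * pi * (real k * t))) \<le> 1 / nint_dist t"
proof -
  let ?z = "cis (2 * pi * t)"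
  have g: "2 * nint_dist t \<le> norm (?z - 1)" by (rule norm_cis_minus_one_ge)
  then have z: "?z \<noteq> 1" using assms by auto
  have "(\<Sum>k<H. cis (2 * pi * (real k * t))) = (\<Sum>k<H. ?z ^ k)"
    by (intro sum.cong refl) (simp add: Complex.DeMoivre mult_ac)
  also have "\<dots> = (?z ^ H - 1) / (?z - 1)" using z by (rule geometric_sum)
  finally have "norm (\<Sum>k<H. cis (2 * pi * (real k * t))) = norm (?z ^ H - 1) / norm (?z - 1)"
    by (simp add: norm_divide)
  also have "\<dots> \<le> 2 / (2 * nint_dist t)"
    using norm_triangle_ineq4[of "?z ^ H" 1] g assms by (intro frac_le) (auto simp: norm_power)
  finally show ?thesis by simp
qed

lemma norm_sum_cis_square:
  "complex_of_real ((norm (\<Sum>i\<in>I. cis (\<theta> i)))\<^sup>2) = (\<Sum>i\<in>I. \<Sum>j\<in>I. cis (\<theta> i - \<theta> j))"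
  unfolding complex_norm_square cnj_sum cis_cnj sum_product cis_mult by simp

text \<open>When the square is expanded, the diagonal pairs give \<open>card W\<close> and each
  other pair at most \<omega>.\<close>

lemma integral_exponential_sum_le:
  fixes \<Phi> :: "'w \<Rightarrow> real \<Rightarrow> real"
  assumes W: "finite W" and \<omega>: "0 \<le> \<omega>"
    and cont: "\<And>w. w \<in> W \<Longrightarrow> continuous_on {0..1} (\<Phi> w)"
    and osc: "\<And>w w'. w \<in> W \<Longrightarrow> w' \<in> W \<Longrightarrow> w \<noteq> w' \<Longrightarrow>
      norm (integral {0..1} (\<lambda>x. cis (2 * pi * h * (\<Phi> w x - \<Phi> w' x)))) \<le> \<omega>"
  shows "integral {0..1} (\<lambda>x. (norm (\<Sum>w\<in>W. cis (2 * pi * h * \<Phi> w x)))\<^sup>2) \<le> real (card W) + (real (card W))\<^sup>2 * \<omega>"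
proof -
  let ?g = "\<lambda>w w' x. cis (2 * pi * h * (\<Phi> w x - \<Phi> w' x))"
  let ?f = "\<lambda>x. (norm (\<Sum>w\<in>W. cis (2 * pi * h * \<Phi> w x)))\<^sup>2"
  have e: "complex_of_real (?f x) = (\<Sum>w\<in>W. \<Sum>w'\<in>W. ?g w w' x)" for x
    unfolding norm_sum_cis_square by (simp add: right_diff_distrib)
  have i: "?g w w' integrable_on {0..1}" if "w \<in> W" "w' \<in> W" for w w'
    using cont that by (intro integrable_continuous_real continuous_intros) auto
  have "continuous_on {0..1} ?f" using cont by (intro continuous_intros) auto
  then have fi: "?f integrable_on {0..1}" by (rule integrable_continuous_real)
  have "complex_of_real (integral {0..1} ?f) = integral {0..1} (\<lambda>x. complex_of_real (?f x))"
    by (rule integral_unique[OF has_integral_of_real[OF integrable_integral[OF fi]], symmetric])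
  also have "\<dots> = integral {0..1} (\<lambda>x. \<Sum>w\<in>W. \<Sum>w'\<in>W. ?g w w' x)"
    by (simp only: e)
  also have "\<dots> = (\<Sum>w\<in>W. integral {0..1} (\<lambda>x. \<Sum>w'\<in>W. ?g w w' x))"
    using W i by (intro integral_sum integrable_sum) auto
  also have "\<dots> = (\<Sum>w\<in>W. \<Sum>w'\<in>W. integral {0..1} (?g w w'))"
    using W i by (intro sum.cong integral_sum refl) auto
  finally have "norm (complex_of_real (integral {0..1} ?f)) \<le> (\<Sum>w\<in>W. \<Sum>w'\<in>W. norm (integral {0..1} (?g w w')))"
    by (simp only:) (intro order_trans[OF norm_sum] sum_mono order_trans[OF norm_sum] order_refl)
  also have "\<dots> \<le> (\<Sum>w\<in>W. \<Sum>w'\<in>W. (if w' = w then 1 else 0) + \<omega>)"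
    using osc \<omega> by (intro sum_mono) auto
  also have "\<dots> = real (card W) + (real (card W))\<^sup>2 * \<omega>"
    using W by (simp add: sum.distrib sum.delta power2_eq_square algebra_simps)
  finally show ?thesis by simp
qed

text \<open>
  Fejer's kernel \<open>\<bar>\<Sum>k<H. e(k t)\<bar>\<^sup>2\<close> has mean \<open>H\<close> but is at most \<open>H / 2\<close> when \<open>t\<close> is not within \<open>\<delta>\<close> of an
  integer. If no phase were to hit \<open>\<gamma>\<close> on \<open>E\<close>, the sum of the kernels would therefore have a variance
  that is incompatible with the small correlations of the phases.
\<close>

lemma phases_hit:
  fixes \<Phi> :: "'w \<Rightarrow> real \<Rightarrow> real" and H :: nat
  assumes W: "finite W" "W \<noteq> {}" and \<omega>: "0 \<le> \<omega>" and \<delta>: "0 < \<delta>" "2 / \<delta>\<^sup>2 \<le> real H"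
    and E: "E \<in> lmeasurable" "E \<subseteq> {0..1}"
    and cont: "\<And>w. w \<in> W \<Longrightarrow> continuous_on {0..1} (\<Phi> w)"
    and osc: "\<And>w w' h. w \<in> W \<Longrightarrow> w' \<in> W \<Longrightarrow> w \<noteq> w' \<Longrightarrow> h \<in> \<int> \<Longrightarrow> h \<noteq> 0 \<Longrightarrow>
      norm (integral {0..1} (\<lambda>x. cis (2 * pi * h * (\<Phi> w x - \<Phi> w' x)))) \<le> \<omega>"
    and big: "4 * (real H)\<^sup>2 * (1 / real (card W) + \<omega>) < measure lebesgue E"
  shows "\<exists>w\<in>W. \<exists>x\<in>E. nint_dist (\<Phi> w x - \<gamma>) < \<delta>"
proof (rule ccontr)
  assume no: "\<not> ?thesis"
  define N where "N = real (card W)"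
  have N: "0 < N" using W by (simp add: N_def card_gt_0_iff)
  have H: "0 < real H" using \<delta> by (smt (verit) divide_pos_pos zero_less_power)
  define f where "f h x = (\<Sum>w\<in>W. cis (2 * pi * h * \<Phi> w x))" for h x
  define K where "K w x = (norm (\<Sum>k<H. cis (2 * pi * (real k * (\<Phi> w x - \<gamma>)))))\<^sup>2" for w x
  \<comment> \<open>Subtracting H removes the diagonal k = l from each kernel, so only nonzero
    frequencies remain in \<open>G\<close>; they are indexed by \<open>P\<close>.\<close>
  define G where "G x = (\<Sum>w\<in>W. K w x - real H)" for x
  define P where "P = {..<H} \<times> {..<H} - {(k, k) | k. True}"
  have P: "finite P" "real (card P) \<le> (real H)\<^sup>2"
  proof -
    show "finite P" by (simp add: P_def)
    have "card P \<le> card ({..<H} \<times> {..<H})" unfolding P_def by (rule card_mono) auto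
    then have "card P \<le> H * H" by (simp add: card_cartesian_product)
    then show "real (card P) \<le> (real H)\<^sup>2" by (simp add: power2_eq_square flip: of_nat_mult)
  qed
  have Kc: "complex_of_real (K w x - real H) = (\<Sum>(k, l)\<in>P. cis (- 2 * pi * (real k - real l) * \<gamma>) * cis (2 * pi * (real k - real l) * \<Phi> w x))" for w x
  proof -
    let ?c = "\<lambda>k l. cis (2 * pi * (real k - real l) * (\<Phi> w x - \<gamma>))"
    have "complex_of_real (K w x) = (\<Sum>k<H. \<Sum>l<H. ?c k l)"
      unfolding K_def norm_sum_cis_square
      by (intro sum.cong refl arg_cong[where f = cis]) (simp add: algebra_simps)
    also have "\<dots> = (\<Sum>(k, l)\<in>{..<H} \<times> {..<H}. ?c k l)" by (rule sum.cartesian_product)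
    also have "{..<H} \<times> {..<H} = P \<union> (\<lambda>k. (k, k)) ` {..<H}" by (auto simp: P_def)
    also have "(\<Sum>(k, l)\<in>\<dots>. ?c k l) = (\<Sum>(k, l)\<in>P. ?c k l) + (\<Sum>(k, l)\<in>(\<lambda>k. (k, k)) ` {..<H}. ?c k l)"
      using P by (intro sum.union_disjoint) (auto simp: P_def)
    also have "(\<Sum>(k, l)\<in>(\<lambda>k. (k, k)) ` {..<H}. ?c k l) = of_nat H"
      by (subst sum.reindex) (auto simp: inj_on_def)
    finally show ?thesis
      by (simp add: cis_mult algebra_simps)
  qed
  have Gc: "complex_of_real (G x) = (\<Sum>(k, l)\<in>P. cis (- 2 * pi * (real k - real l) * \<gamma>) * f (real k - real l) x)" for x
  proof -
    have "complex_of_real (G x) = (\<Sum>w\<in>W. complex_of_real (K w x - real H))" by (simp add: G_def)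
    also have "\<dots> = (\<Sum>w\<in>W. \<Sum>(k, l)\<in>P. cis (- 2 * pi * (real k - real l) * \<gamma>) * cis (2 * pi * (real k - real l) * \<Phi> w x))"
      by (simp only: Kc)
    also have "\<dots> = (\<Sum>p\<in>P. \<Sum>w\<in>W. case p of (k, l) \<Rightarrow> cis (- 2 * pi * (real k - real l) * \<gamma>) * cis (2 * pi * (real k - real l) * \<Phi> w x))"
      by (rule sum.swap)
    also have "\<dots> = (\<Sum>(k, l)\<in>P. cis (- 2 * pi * (real k - real l) * \<gamma>) * f (real k - real l) x)"
      by (intro sum.cong refl) (auto simp: f_def sum_distrib_left)
    finally show ?thesis .
  qed
  \<comment> \<open>Cauchy-Schwarz over the frequencies, which reduces the variance of
    \<open>G\<close> to the second moments of the single \<open>f h\<close>.\<close>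
  have G2: "(G x)\<^sup>2 \<le> (real H)\<^sup>2 * (\<Sum>(k, l)\<in>P. (norm (f (real k - real l) x))\<^sup>2)" for x
  proof -
    have "\<bar>G x\<bar> = norm (complex_of_real (G x))" by simp
    also have "\<dots> \<le> (\<Sum>p\<in>P. norm (f (real (fst p) - real (snd p)) x))"
      unfolding Gc by (rule order_trans[OF norm_sum]) (auto intro!: sum_mono simp: norm_mult)
    finally have "(G x)\<^sup>2 \<le> (\<Sum>p\<in>P. norm (f (real (fst p) - real (snd p)) x))\<^sup>2"
      by (metis abs_ge_zero power2_abs power_mono)
    also have "\<dots> \<le> (\<Sum>p\<in>P. (norm (f (real (fst p) - real (snd p)) x))\<^sup>2) * real (card P)"
      by (rule sum_squared_le_sum_of_squares)
    also have "\<dots> \<le> (\<Sum>p\<in>P. (norm (f (real (fst p) - real (snd p)) x))\<^sup>2) * (real H)\<^sup>2"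
      using P by (intro mult_left_mono sum_nonneg) auto
    finally show ?thesis by (simp add: mult.commute case_prod_unfold)
  qed
  have cf: "continuous_on {0..1} (f h)" for h
    unfolding f_def[abs_def] using cont by (intro continuous_intros) auto
  have cK: "continuous_on {0..1} (K w)" if "w \<in> W" for w
    unfolding K_def[abs_def] using cont that by (intro continuous_intros) auto
  have cG0: "continuous_on {0..1} G"
    unfolding G_def[abs_def] using cK by (intro continuous_intros) auto
  then have cG: "continuous_on {0..1} (\<lambda>x. (G x)\<^sup>2)" by (intro continuous_intros)
  have If: "integral {0..1} (\<lambda>x. (norm (f h x))\<^sup>2) \<le> N + N\<^sup>2 * \<omega>" if "h \<in> \<int>" "h \<noteq> 0" for h
    unfolding f_def N_def using W \<omega> cont osc that by (intro integral_exponential_sum_le) auto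
  have "integral {0..1} (\<lambda>x. (G x)\<^sup>2) \<le>
      integral {0..1} (\<lambda>x. (real H)\<^sup>2 * (\<Sum>(k, l)\<in>P. (norm (f (real k - real l) x))\<^sup>2))"
    using cG0 cf G2 by (intro integral_le integrable_continuous_real continuous_intros) (auto simp: case_prod_unfold intro!: continuous_intros)
  also have "\<dots> = (real H)\<^sup>2 * (\<Sum>p\<in>P. integral {0..1} (\<lambda>x. (norm (f (real (fst p) - real (snd p)) x))\<^sup>2))"
    using P cf by (subst integral_mult_right, subst case_prod_unfold, subst integral_sum)
      (auto intro!: integrable_continuous_real continuous_intros)
  also have "\<dots> \<le> (real H)\<^sup>2 * (\<Sum>p\<in>P. N + N\<^sup>2 * \<omega>)"
  proof (intro mult_left_mono sum_mono If)
    fix p assume "p \<in> P"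
    then show "real (fst p) - real (snd p) \<noteq> 0" by (auto simp: P_def)
  qed auto
  also have "\<dots> \<le> (real H)\<^sup>2 * ((real H)\<^sup>2 * (N + N\<^sup>2 * \<omega>))"
    unfolding sum_constant using P N \<omega> by (intro mult_left_mono mult_right_mono) auto
  finally have upper: "integral {0..1} (\<lambda>x. (G x)\<^sup>2) \<le> (real H)\<^sup>2 * ((real H)\<^sup>2 * (N + N\<^sup>2 * \<omega>))" .
  \<comment> \<open>Away from the target each kernel is at most 1 / \<delta>^2 \<le> H / 2, so the
    centred sum is at most - N H / 2 on all of E.\<close>
  have G_low: "(N * real H / 2)\<^sup>2 \<le> (G x)\<^sup>2" if x: "x \<in> E" for x
  proof -
    have "K w x \<le> real H / 2" if "w \<in> W" for w
    proof -
      have d: "\<delta> \<le> nint_dist (\<Phi> w x - \<gamma>)" using no that x by force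
      then have "norm (\<Sum>k<H. cis (2 * pi * (real k * (\<Phi> w x - \<gamma>)))) \<le> 1 / nint_dist (\<Phi> w x - \<gamma>)"
        using \<delta> by (intro geometric_cis_bound) auto
      also have "\<dots> \<le> 1 / \<delta>" using d \<delta> by (intro divide_left_mono) auto
      finally have "K w x \<le> (1 / \<delta>)\<^sup>2" unfolding K_def by (intro power_mono) auto
      then show ?thesis using \<delta> by (simp add: power_divide)
    qed
    then have "G x \<le> (\<Sum>w\<in>W. - (real H / 2))" unfolding G_def by (intro sum_mono) (fastforce simp: algebra_simps)
    then have "N * real H / 2 \<le> - G x" by (simp add: N_def)
    then have "(N * real H / 2)\<^sup>2 \<le> (- G x)\<^sup>2" using N by (intro power_mono) auto
    then show ?thesis by simp
  qed
  have ai: "(\<lambda>x. (G x)\<^sup>2) absolutely_integrable_on {0..1}"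
    using cG by (rule absolutely_integrable_continuous_real)
  have "(\<lambda>x. (G x)\<^sup>2) absolutely_integrable_on E"
    by (rule set_integrable_subset[OF ai]) (use E in auto)
  then have Ei: "(\<lambda>x. (G x)\<^sup>2) integrable_on E" by (rule set_lebesgue_integral_eq_integral(1))
  have Ec: "(\<lambda>x. 1::real) integrable_on E" using E(1) by (simp add: integrable_on_const)
  have "measure lebesgue E * (N * real H / 2)\<^sup>2 = integral E (\<lambda>x. 1 * (N * real H / 2)\<^sup>2)"
    unfolding lmeasure_integral[OF E(1)] using Ec by (simp only: integral_mult_left)
  also have "\<dots> \<le> integral E (\<lambda>x. (G x)\<^sup>2)"
    using Ei Ec G_low by (intro integral_le integrable_on_mult_left) auto
  also have "\<dots> \<le> integral {0..1} (\<lambda>x. (G x)\<^sup>2)"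
    using E Ei cG by (intro integral_subset_le integrable_continuous_real) auto
  finally have "measure lebesgue E * (N * real H / 2)\<^sup>2 \<le> (real H)\<^sup>2 * ((real H)\<^sup>2 * (N + N\<^sup>2 * \<omega>))"
    using upper by simp
  also have "\<dots> = (4 * (real H)\<^sup>2 * (1 / N + \<omega>)) * (N * real H / 2)\<^sup>2"
    using N by (simp add: field_simps power2_eq_square)
  finally have "measure lebesgue E \<le> 4 * (real H)\<^sup>2 * (1 / N + \<omega>)"
    using N H by (subst (asm) mult_le_cancel_right) auto
  then show False using big by (simp add: N_def)
qed

text \<open>
  The frequencies of the phases \<open>x \<mapsto> n * cf (p @ w) x\<close> are governed by the linear functions
  \<open>den1 (p @ w) + den2 (p @ w) * x\<close>, which differ enough for distinct \<open>w\<close> to make the phases uncorrelated.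
\<close>

lemma cf_phase_correlation:
  fixes n h :: real
  assumes p: "0 \<notin> set p" "den1 p \<le> 2 * den2 p" and l: "8 \<le> l"
    and w: "w \<in> words 2 (8 * l)" "w' \<in> words 2 (8 * l)" "w \<noteq> w'"
    and n: "2 ^ (151 * l) \<le> 4 * n / (den1 p)\<^sup>2"
    and h: "h \<in> \<int>" "h \<noteq> 0"
  shows "norm (integral {0..1} (\<lambda>x. cis (2 * pi * h * (n * cf (p @ w) x - n * cf (p @ w') x)))) \<le> 1072 / 2 ^ (7 * l)"
proof -
  define q where "q = den1 p"
  have q: "1 \<le> q" using den1_ge_1[OF p(1)] by (simp add: q_def)
  \<comment> \<open>The sign is common to both words because they have the same length; so the two
    derivatives combine into a difference.\<close>
  define A where "A = 2 * pi * h * n * (-1) ^ (length p + 8 * l) / q\<^sup>2"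
  \<comment> \<open>The separation of the denominators is at least 3^(-8 l) / 6, hence at least
    \<sigma>, and \<tau> is 2^(-7 l) times smaller up to a constant; this is the first error. Since
    B^8 is about 2^(104 l) and 1 / \<tau>^2 is 2^(40 l), a frequency of 2^(151 l), where 151 = 104 +
    40 + 7, makes the second error equally small.\<close>
  define \<tau> where "\<tau> = (1/2 :: real) ^ (20 * l)"
  define \<sigma> where "\<sigma> = (1/2 :: real) ^ (13 * l) / 6"
  define B where "B = 2 * (2 :: real) ^ (13 * l)"
  have n0: "0 < n"
  proof -
    have "0 < 4 * n / (den1 p)\<^sup>2" using n by (smt (verit) zero_less_power)
    then show ?thesis by (simp add: zero_less_divide_iff)
  qed
  have h1: "1 \<le> \<bar>h\<bar>" using h by (rule Ints_nonzero_abs_ge1)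
  have three: "(3::real) ^ (8 * l) \<le> 2 ^ (13 * l)"
  proof -
    have "(3::real) ^ (8 * l) = 6561 ^ l" by (simp add: power_mult)
    also have "\<dots> \<le> 8192 ^ l" by (intro power_mono) auto
    also have "\<dots> = 2 ^ (13 * l)" by (simp add: power_mult)
    finally show ?thesis .
  qed
  have A: "2 ^ (151 * l) \<le> \<bar>A\<bar>"
  proof -
    have "2 * 1 \<le> pi * \<bar>h\<bar>" using h1 pi_gt3 by (intro mult_mono) auto
    then have "4 * n / q\<^sup>2 \<le> 2 * pi * \<bar>h\<bar> * n / q\<^sup>2"
      using n0 by (intro divide_right_mono mult_right_mono) auto
    moreover have "\<bar>A\<bar> = 2 * pi * \<bar>h\<bar> * n / q\<^sup>2" using n0 by (simp add: A_def abs_mult)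
    ultimately show ?thesis using n by (simp add: q_def)
  qed
  have norms: "1 \<le> den1 (p @ v) / q \<and> 0 \<le> den2 (p @ v) / q \<and> den2 (p @ v) / q \<le> den1 (p @ v) / q \<and>
     den1 (p @ v) / q + den2 (p @ v) / q \<le> B" if "v \<in> words 2 (8 * l)" for v
  proof -
    have nz: "0 \<notin> set (p @ v)" using p words_nonzero[OF that] by simp
    have "den1 (p @ v) \<le> (real 2 + 1) ^ length v * q"
      unfolding q_def using that by (intro den1_append_le p) (auto simp: words_def)
    then have "den1 (p @ v) \<le> 3 ^ (8 * l) * q" using that by (simp add: words_def)
    also have "\<dots> \<le> 2 ^ (13 * l) * q" using three q by (intro mult_right_mono) auto
    finally have "den1 (p @ v) / q \<le> 2 ^ (13 * l)" using q by (simp add: field_simps)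
    moreover have "1 \<le> den1 (p @ v) / q" using den1_append_ge[OF nz] q by (simp add: q_def)
    moreover have "0 \<le> den2 (p @ v) / q" "den2 (p @ v) / q \<le> den1 (p @ v) / q"
      using den2_nonneg[OF nz] den2_le_den1[OF nz] q by (auto simp: divide_right_mono)
    ultimately show ?thesis by (simp add: B_def)
  qed
  have "norm (integral {0..1} (\<lambda>x. cis (2 * pi * h * (n * cf (p @ w) x - n * cf (p @ w') x))))
     \<le> 8 * \<tau> / \<sigma> + 4 * B ^ 8 / (\<bar>A\<bar> * \<tau>\<^sup>2)"
  proof (rule oscillatory_integral_linear[where ?d0.0 = "den1 (p @ w) / q" and ?d1.0 = "den2 (p @ w) / q"
        and ?e0.0 = "den1 (p @ w') / q" and ?e1.0 = "den2 (p @ w') / q"])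
    show "A \<noteq> 0" using A by (smt (verit) zero_less_power)
    show "0 < \<tau>" "\<tau> \<le> 1" "0 < \<sigma>" by (auto simp: \<tau>_def \<sigma>_def power_le_one)
    have "q / 6 * (1/3) ^ (8 * l) \<le> \<bar>den1 (p @ w) - den1 (p @ w')\<bar> + \<bar>den2 (p @ w) - den2 (p @ w')\<bar>"
      unfolding q_def using den_separation[OF p w] .
    then have "(1/3) ^ (8 * l) / 6 \<le> (\<bar>den1 (p @ w) - den1 (p @ w')\<bar> + \<bar>den2 (p @ w) - den2 (p @ w')\<bar>) / q"
      using q by (simp add: field_simps)
    also have "\<dots> = \<bar>den1 (p @ w) / q - den1 (p @ w') / q\<bar> + \<bar>den2 (p @ w) / q - den2 (p @ w') / q\<bar>"
      using q by (simp add: add_divide_distrib flip: diff_divide_distrib)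
    finally have "(1/3) ^ (8 * l) / 6 \<le> \<dots>" .
    moreover have "\<sigma> \<le> (1/3) ^ (8 * l) / 6"
      using three by (simp add: \<sigma>_def power_one_over field_simps)
    ultimately show "\<sigma> \<le> \<bar>den1 (p @ w) / q - den1 (p @ w') / q\<bar> + \<bar>den2 (p @ w) / q - den2 (p @ w') / q\<bar>"
      by linarith
    show "((\<lambda>x. 2 * pi * h * (n * cf (p @ w) x - n * cf (p @ w') x)) has_real_derivative
        A * (1 / (den1 (p @ w) / q + den2 (p @ w) / q * x)\<^sup>2 - 1 / (den1 (p @ w') / q + den2 (p @ w') / q * x)\<^sup>2)) (at x within {0..1})"
      if x: "x \<in> {0..1}" for x
    proof -
      have d: "(cf (p @ v) has_real_derivative (-1) ^ (length p + 8 * l) / q\<^sup>2 * (1 / (den1 (p @ v) / q + den2 (p @ v) / q * x)\<^sup>2)) (at x within {0..1})"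
        if v: "v \<in> words 2 (8 * l)" for v
      proof -
        have nz: "0 \<notin> set (p @ v)" using p words_nonzero[OF v] by simp
        have "(cf (p @ v) has_real_derivative (-1) ^ length (p @ v) / (den1 (p @ v) + den2 (p @ v) * x)\<^sup>2) (at x within {0..1})"
          by (rule DERIV_subset[OF cf_has_deriv[OF nz]]) (use x in auto)
        moreover have "den1 (p @ v) / q + den2 (p @ v) / q * x = (den1 (p @ v) + den2 (p @ v) * x) / q"
          by (simp add: add_divide_distrib)
        moreover have "length (p @ v) = length p + 8 * l" using v by (simp add: words_def)
        ultimately show ?thesis using q by (simp add: power_divide)
      qed
      show ?thesis
        by (rule DERIV_cong[OF DERIV_cmult[OF DERIV_diff[OF DERIV_cmult[OF d[OF w(1)]] DERIV_cmult[OF d[OF w(2)]]]]])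
           (simp add: A_def algebra_simps diff_divide_distrib)
    qed
  qed (use norms[OF w(1)] norms[OF w(2)] in auto)
  also have "8 * \<tau> / \<sigma> = 48 / 2 ^ (7 * l)"
  proof -
    have "(2::real) ^ (20 * l) = 2 ^ (13 * l) * 2 ^ (7 * l)" by (simp flip: power_add)
    then show ?thesis by (simp add: \<tau>_def \<sigma>_def power_one_over field_simps)
  qed
  also have "4 * B ^ 8 / (\<bar>A\<bar> * \<tau>\<^sup>2) \<le> 4 * B ^ 8 / (2 ^ (151 * l) * \<tau>\<^sup>2)"
  proof -
    have "0 < \<bar>A\<bar>" using A by (rule less_le_trans[rotated]) simp
    then show ?thesis using A
      by (intro divide_left_mono mult_right_mono mult_pos_pos) (auto simp: B_def \<tau>_def)
  qed
  also have "\<dots> = 1024 / 2 ^ (7 * l)"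
  proof -
    have "B ^ 8 = 256 * 2 ^ (104 * l)" by (simp add: B_def power_mult_distrib flip: power_mult)
    moreover have "\<tau>\<^sup>2 = 1 / 2 ^ (40 * l)" by (simp add: \<tau>_def power_one_over flip: power_mult)
    moreover have "(2::real) ^ (151 * l) = 2 ^ (104 * l) * 2 ^ (40 * l) * 2 ^ (7 * l)" by (simp flip: power_add)
    ultimately show ?thesis by simp
  qed
  finally show ?thesis by simp
qed

text \<open>The block is \<open>[1] @ w @ v\<close>. The digit 1 makes the last two denominators
  comparable, \<open>w\<close> selects the phase that hits, and \<open>v\<close> is a bounded
  beginning of a tail at which it hits. As \<open>v\<close> has 153 l digits, its cylinder has
  length at most 2^(-153 l), while n / q^2 is at most 2^(152 l): the digits after the block move the
  phase by at most 2^(-l). The lower bound on n / q^2 provides the frequency for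
  \<open>cf_phase_correlation\<close>.\<close>

theorem cf_hitting_word:
  fixes n \<gamma> :: real
  assumes M: "611 \<le> M" and l: "8 \<le> l" and p: "0 \<notin> set p"
    and n: "2 ^ (151 * l) \<le> n / (den1 p)\<^sup>2" "n / (den1 p)\<^sup>2 \<le> 2 ^ (152 * l)"
  shows "\<exists>u\<in>words M (161 * l + 1). \<forall>x\<in>{0..1}. nint_dist (n * cf (p @ u) x - \<gamma>) \<le> 2 / 2 ^ l"
proof -
  define r where "r = p @ [1]"
  have r: "0 \<notin> set r" "den1 r \<le> 2 * den2 r" "den1 p \<le> den1 r" "den1 r \<le> 2 * den1 p"
    using p den_bounds[OF p] by (auto simp: r_def)
  have q: "1 \<le> den1 p" using den1_ge_1[OF p] .
  have n0: "0 < n"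
  proof -
    have "0 < n / (den1 p)\<^sup>2" using n(1) by (smt (verit) zero_less_power)
    then show ?thesis by (simp add: zero_less_divide_iff)
  qed
  have "(den1 r)\<^sup>2 \<le> (2 * den1 p)\<^sup>2" using r q by (intro power_mono) auto
  then have "4 * n / (2 * den1 p)\<^sup>2 \<le> 4 * n / (den1 r)\<^sup>2"
    using n0 r q by (intro divide_left_mono) auto
  then have nr: "2 ^ (151 * l) \<le> 4 * n / (den1 r)\<^sup>2" using n(1) by (simp add: power_mult_distrib)
  let ?W = "words 2 (8 * l)" and ?E = "\<Union>v\<in>words M (153 * l). cyl v"
  have E: "(1/2) ^ l \<le> measure lebesgue ?E"
  proof -
    \<comment> \<open>M + 1 = 612 is the least value with 153 * 2 / (M + 1) \<le> 1/2; Bernoulli's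
      inequality then keeps half of the measure for every 153 digits.\<close>
    have "1 + real 153 * (- 2 / (real M + 1)) \<le> (1 + - 2 / (real M + 1)) ^ 153"
      using M by (intro Bernoulli_inequality) (simp add: field_simps)
    moreover have "1/2 \<le> 1 + real 153 * (- 2 / (real M + 1))" using M by (simp add: field_simps)
    ultimately have "1/2 \<le> (1 + - 2 / (real M + 1)) ^ 153" by (rule order_trans[rotated])
    then have "1/2 \<le> (1 - 2 / (real M + 1)) ^ 153" by simp
    then have "(1/2) ^ l \<le> ((1 - 2 / (real M + 1)) ^ 153) ^ l" by (intro power_mono) auto
    also have "\<dots> = (1 - 2 / (real M + 1)) ^ (153 * l)" by (simp only: power_mult)
    also have "\<dots> \<le> measure lebesgue ?E" using M by (intro measure_words_cyl) auto
    finally show ?thesis .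
  qed
  have "\<exists>w\<in>?W. \<exists>x\<in>?E. nint_dist (n * cf (r @ w) x - \<gamma>) < (1/2) ^ l"
  \<comment> \<open>H is 2 / \<delta>^2 for \<delta> = 2^(-l). The loss H^2 of order 2^(4 l) is
    affordable against 2^(8 l) words and correlations of order 2^(-7 l).\<close>
  proof (rule phases_hit[where H = "2 * 4 ^ l" and \<omega> = "1072 / 2 ^ (7 * l)"])
    show "finite ?W" by simp
    have "card ?W \<noteq> 0" by (simp add: card_words)
    then show "?W \<noteq> {}" by force
    show "2 / ((1/2) ^ l)\<^sup>2 \<le> real (2 * 4 ^ l)"
      by (simp add: power_one_over flip: power_mult power2_eq_square) (simp add: power_mult mult.commute[of l])
    show "?E \<in> lmeasurable" by (intro fmeasurable.finite_UN) auto
    show "?E \<subseteq> {0..1}" using cyl_subset_unit words_nonzero by blast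
    show "continuous_on {0..1} (\<lambda>x. n * cf (r @ w) x)" if "w \<in> ?W" for w
      using r words_nonzero[OF that] by (intro continuous_intros continuous_on_cf) auto
    show "norm (integral {0..1} (\<lambda>x. cis (2 * pi * h * (n * cf (r @ w) x - n * cf (r @ w') x)))) \<le> 1072 / 2 ^ (7 * l)"
      if "w \<in> ?W" "w' \<in> ?W" "w \<noteq> w'" "h \<in> \<int>" "h \<noteq> 0" for w w' and h :: real
      by (rule cf_phase_correlation) (use r l that nr in auto)
    have "4 * (real (2 * 4 ^ l))\<^sup>2 * (1 / real (card ?W) + 1072 / 2 ^ (7 * l))
       = 16 * 2 ^ (4 * l) * (1 / 2 ^ (8 * l) + 1072 / 2 ^ (7 * l))"
      by (simp add: card_words power_mult_distrib power2_eq_square power_mult flip: power_mult_distrib)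
    also have "\<dots> \<le> 16 * 2 ^ (4 * l) * (1 / 2 ^ (7 * l) + 1072 / 2 ^ (7 * l))"
      by (intro mult_left_mono add_right_mono divide_left_mono power_increasing) auto
    also have "\<dots> = 17168 / 2 ^ (3 * l)"
    proof -
      have "(2::real) ^ (7 * l) = 2 ^ (4 * l) * 2 ^ (3 * l)" by (simp flip: power_add)
      then show ?thesis by (simp add: field_simps)
    qed
    also have "\<dots> < (1/2) ^ l"
    proof -
      \<comment> \<open>The origin of \<open>8 \<le> l\<close>: for l = 7 the right hand side would
        be 16384, less than 17168.\<close>
      have "(2::real) ^ (2 * 8) \<le> 2 ^ (2 * l)" using l by (intro power_increasing) auto
      then have "17168 < (2::real) ^ (2 * l)" by simp
      moreover have "(2::real) ^ (3 * l) = 2 ^ l * 2 ^ (2 * l)" by (simp flip: power_add)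
      ultimately show ?thesis by (simp add: field_simps power_one_over)
    qed
    finally show "4 * (real (2 * 4 ^ l))\<^sup>2 * (1 / real (card ?W) + 1072 / 2 ^ (7 * l)) < measure lebesgue ?E"
      using E by linarith
  qed auto
  then obtain w v x where w: "w \<in> ?W" and v: "v \<in> words M (153 * l)" "x \<in> cyl v"
    and x: "nint_dist (n * cf (r @ w) x - \<gamma>) < (1/2) ^ l" by blast
  have nzv: "0 \<notin> set v" using words_nonzero[OF v(1)] .
  have nz: "0 \<notin> set (r @ w)" using r words_nonzero[OF w] by simp
  obtain y where y: "0 < y" "y < 1" "x = cf v y" using subsetD[OF cyl_subset_image[OF nzv] v(2)] by auto
  have x0: "0 \<le> x" "x \<le> 1" using cyl_subset_unit[OF nzv] v by auto
  show ?thesis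
  proof (intro bexI[of _ "[1] @ w @ v"] ballI)
    show "[1] @ w @ v \<in> words M (161 * l + 1)" using w v M by (auto simp: words_def)
    fix z :: real assume z: "z \<in> {0..1}"
    have cz: "0 \<le> cf v z \<and> cf v z \<le> 1" using z nzv by (intro cf_bounds) auto
    have "\<bar>cf (r @ w) (cf v z) - cf (r @ w) x\<bar> \<le> \<bar>cf v z - x\<bar> / (den1 (r @ w))\<^sup>2"
      using nz cz x0 by (intro cf_diff_le) auto
    also have "\<dots> \<le> (1/2) ^ (153 * l) / (den1 p)\<^sup>2"
    proof (rule frac_le)
      have "\<bar>cf v z - x\<bar> \<le> cyl_len v" unfolding y(3) using z y nzv by (intro cf_diff_le_len) auto
      also have "\<dots> \<le> (1/2) ^ (153 * l)" using cyl_len_le_power[OF nzv] v by (simp add: words_def)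
      finally show "\<bar>cf v z - x\<bar> \<le> (1/2) ^ (153 * l)" .
      show "(den1 p)\<^sup>2 \<le> (den1 (r @ w))\<^sup>2"
        using q r den1_append_ge[OF nz] by (intro power_mono) auto
    qed (use q in auto)
    finally have "n * \<bar>cf (r @ w) (cf v z) - cf (r @ w) x\<bar> \<le> n * ((1/2) ^ (153 * l) / (den1 p)\<^sup>2)"
      using n0 by (intro mult_left_mono) auto
    also have "\<dots> = (n / (den1 p)\<^sup>2) * (1/2) ^ (153 * l)" by simp
    also have "\<dots> \<le> 2 ^ (152 * l) * (1/2) ^ (153 * l)" using n(2) by (intro mult_right_mono) auto
    also have "\<dots> = (1/2) ^ l"
    proof -
      have "(2::real) ^ (153 * l) = 2 ^ (152 * l) * 2 ^ l" by (simp flip: power_add)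
      then show ?thesis by (simp add: power_one_over)
    qed
    finally have "\<bar>(n * cf (r @ w) (cf v z) - \<gamma>) - (n * cf (r @ w) x - \<gamma>)\<bar> \<le> (1/2) ^ l"
      using n0 by (simp add: abs_mult flip: right_diff_distrib)
    then have "nint_dist (n * cf (r @ w) (cf v z) - \<gamma>) \<le> (1/2) ^ l + (1/2) ^ l"
      using nint_dist_triangle[of "n * cf (r @ w) (cf v z) - \<gamma>" "n * cf (r @ w) x - \<gamma>"] x by linarith
    then show "nint_dist (n * cf (p @ [1] @ w @ v) z - \<gamma>) \<le> 2 / 2 ^ l"
      by (simp add: r_def cf_append power_one_over)
  qed
qed

section \<open>Trees of continued fractions\<close>

lemma cyl_len_snoc_le:
  assumes "0 \<notin> set (w @ [a])"
  shows "cyl_len (w @ [a]) \<le> cyl_len w / 2"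
proof -
  let ?q = "den1 w" and ?r = "den2 w"
  have b: "1 \<le> ?q" "0 \<le> ?r" "?r \<le> ?q" using den_bounds[of w] assms by auto
  have a: "1 \<le> real a" using assms by (auto simp: Suc_le_eq)
  have aq: "?q \<le> real a * ?q" using mult_right_mono[OF a, of ?q] b by simp
  have "2 * (?q * (?q + ?r)) \<le> (?q + ?r) * (?q + ?r + ?q)"
    using b by (simp add: algebra_simps)
  also have "\<dots> \<le> (real a * ?q + ?r) * (real a * ?q + ?r + ?q)"
    using b aq by (intro mult_mono) auto
  finally have *: "2 * (?q * (?q + ?r)) \<le> (real a * ?q + ?r) * (real a * ?q + ?r + ?q)" .
  have "0 < 2 * (?q * (?q + ?r))" using b by auto
  then have "1 / ((real a * ?q + ?r) * (real a * ?q + ?r + ?q)) \<le> 1 / (2 * (?q * (?q + ?r)))"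
    using * by (intro divide_left_mono mult_pos_pos[of _ "2 * (?q * (?q + ?r))"]) linarith+
  then show ?thesis by (simp add: cyl_len_def mult.commute)
qed

lemma cyl_len_snoc_ge:
  assumes "0 \<notin> set w" "1 \<le> a" "a \<le> M"
  shows "cyl_len w / ((real M + 1) * (real M + 2)) \<le> cyl_len (w @ [a])"
proof -
  let ?q = "den1 w" and ?r = "den2 w"
  have b: "1 \<le> ?q" "0 \<le> ?r" "?r \<le> ?q" using den_bounds[of w] assms by auto
  have a: "real a * ?q \<le> real M * ?q" using assms b by (intro mult_right_mono) auto
  have p: "0 < (real a * ?q + ?r) * (real a * ?q + ?r + ?q)" 
    using assms b by (intro mult_pos_pos add_pos_nonneg add_pos_pos) auto
  have "(real a * ?q + ?r) * (real a * ?q + ?r + ?q) \<le> ((real M + 1) * ?q) * ((real M + 2) * ?q)"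
  proof (intro mult_mono)
    show "real a * ?q + ?r \<le> (real M + 1) * ?q" "real a * ?q + ?r + ?q \<le> (real M + 2) * ?q"
      using a b unfolding distrib_right by linarith+
  qed (use b in auto)
  also have "\<dots> \<le> (real M + 1) * (real M + 2) * (?q * (?q + ?r))"
    using b by (simp add: algebra_simps)
  finally have "1 / ((real M + 1) * (real M + 2) * (?q * (?q + ?r))) \<le> 1 / ((real a * ?q + ?r) * (real a * ?q + ?r + ?q))"
    using p by (intro divide_left_mono mult_pos_pos[OF less_le_trans[OF p] p]) simp_all
  then show ?thesis by (simp add: cyl_len_def mult.commute)
qed

lemma cyl_len_append_le: "0 \<notin> set (w @ v) \<Longrightarrow> cyl_len (w @ v) \<le> cyl_len w"
proof (induction v rule: rev_induct)
  case (snoc a v)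
  have "cyl_len ((w @ v) @ [a]) \<le> cyl_len (w @ v) / 2" using snoc.prems by (intro cyl_len_snoc_le) auto
  also have "\<dots> \<le> cyl_len (w @ v)" using snoc.prems cyl_len_pos[of "w @ v"] by auto
  finally show ?case using snoc by auto
qed simp

text \<open>The strategy \<open>F\<close> either prescribes the next digit or leaves it free. It is
  a function of the whole word so far, because a block depends on the digits before it.\<close>

definition choices :: "nat \<Rightarrow> (nat list \<Rightarrow> nat option) \<Rightarrow> nat list \<Rightarrow> nat set" where
  "choices M F w = (case F w of None \<Rightarrow> {1..M} | Some d \<Rightarrow> {d})"

definition admissible :: "nat \<Rightarrow> (nat list \<Rightarrow> nat option) \<Rightarrow> nat list \<Rightarrow> bool" where
  "admissible M F w \<longleftrightarrow> (\<forall>m<length w. w ! m \<in> choices M F (take m w))"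

definition forced_count :: "(nat list \<Rightarrow> nat option) \<Rightarrow> nat list \<Rightarrow> nat" where
  "forced_count F w = card {m. m < length w \<and> F (take m w) \<noteq> None}"

definition cf_tree :: "nat \<Rightarrow> (nat list \<Rightarrow> nat option) \<Rightarrow> real set" where
  "cf_tree M F = cfval ` {a. \<forall>m. a m \<in> choices M F (pre a m)}"

lemma admissible_Nil [simp]: "admissible M F []"
  by (simp add: admissible_def)

lemma admissible_snoc: "admissible M F (w @ [a]) \<longleftrightarrow> admissible M F w \<and> a \<in> choices M F w"
  by (auto simp: admissible_def nth_append less_Suc_eq)

lemma admissible_digits:
  assumes "\<And>w d. F w = Some d \<Longrightarrow> d \<in> {1..M}"
  shows "admissible M F w \<Longrightarrow> set w \<subseteq> {1..M}"
proof (induction w rule: rev_induct)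
  case (snoc a w)
  then show ?case using assms[of w a] by (auto simp: admissible_snoc choices_def split: option.splits)
qed simp

lemma forced_count_snoc:
  "forced_count F (w @ [a]) = forced_count F w + (if F w = None then 0 else 1)"
proof -
  have "{m. m < length (w @ [a]) \<and> F (take m (w @ [a])) \<noteq> None} =
     {m. m < length w \<and> F (take m w) \<noteq> None} \<union> (if F w = None then {} else {length w})"
    by (auto simp: less_Suc_eq)
  then show ?thesis by (auto simp: forced_count_def)
qed

text \<open>
  The words \<open>w\<close> of scale \<open>d\<close> whose cylinder meets \<open>U\<close> have disjoint cylinders of length comparable
  with \<open>d\<close>, all contained in an interval of length \<open>4 d\<close>.
\<close>

lemma card_cyl_meeting:
  fixes U :: "real set" and d :: real
  assumes "0 < d" "bounded U" "diameter U \<le> d"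
    and N: "\<And>w. w \<in> N \<Longrightarrow> set w \<subseteq> {1..M} \<and> w \<noteq> [] \<and> cyl_len w \<le> d \<and> d < cyl_len (butlast w) \<and>
      (\<exists>x\<in>{0..1}. cf w x \<in> U)"
  shows "finite N" "real (card N) \<le> 4 * ((real M + 1) * (real M + 2))"
proof -
  let ?C = "(real M + 1) * (real M + 2)"
  obtain n where n: "(1/2) ^ n < d" using real_arch_pow_inv[of d "1/2"] assms by auto
  have nz: "0 \<notin> set w" if "w \<in> N" for w using N[OF that] by auto
  have nzb: "0 \<notin> set (butlast w)" if "w \<in> N" for w using nz[OF that] by (auto dest: in_set_butlastD)
  have "N \<subseteq> {w. set w \<subseteq> {1..M} \<and> length w \<le> Suc n}"
  proof
    fix w assume w: "w \<in> N"
    have "d < (1/2) ^ length (butlast w)"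
      using N[OF w] cyl_len_le_power[OF nzb[OF w]] by linarith
    then have "(1/2 :: real) ^ n < (1/2) ^ length (butlast w)" using n by linarith
    then have "length (butlast w) < n" by (simp add: power_strict_decreasing_iff)
    then show "w \<in> {w. set w \<subseteq> {1..M} \<and> length w \<le> Suc n}" using N[OF w] by auto
  qed
  then show fin: "finite N" by (rule finite_subset) (rule finite_lists_length_le, simp)
  show "real (card N) \<le> 4 * ?C"
  proof (cases "N = {}")
    case False
    then obtain w0 x0 where w0: "w0 \<in> N" "cf w0 x0 \<in> U" using N by blast
    define u where "u = cf w0 x0"
    have sub: "cyl w \<subseteq> {u - 2 * d..u + 2 * d}" if w: "w \<in> N" for w
    proof
      fix y assume "y \<in> cyl w"
      then have "y \<in> cf w ` {0<..<1}" using cyl_subset_image[OF nz[OF w]] by blast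
      then obtain z where z: "0 < z" "z < 1" "y = cf w z" by auto
      obtain x where x: "x \<in> {0..1}" "cf w x \<in> U" using N[OF w] by blast
      have "\<bar>y - cf w x\<bar> \<le> d" unfolding z(3)
        using cf_diff_le_len[OF nz[OF w], of z x] z x N[OF w] by auto
      moreover have "\<bar>cf w x - u\<bar> \<le> d"
        using diameter_bounded_bound[OF assms(2) x(2) w0(2)] assms(3) by (simp add: u_def dist_real_def)
      ultimately show "y \<in> {u - 2 * d..u + 2 * d}" by (auto simp: abs_if split: if_splits)
    qed
    \<comment> \<open>The parent of a word of N has a cylinder longer than d, and a last digit of at
      most M shortens it by no more than the factor \<open>?C\<close>.\<close>
    have "real (card N) * (d / ?C) \<le> (\<Sum>w\<in>N. cyl_len w)"
    proof (rule sum_bounded_below)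
      fix w assume w: "w \<in> N"
      have e: "w = butlast w @ [last w]" "last w \<in> {1..M}"
        using N[OF w] subsetD[OF _ last_in_set[of w], of "{1..M}"] by simp_all
      have "d / ?C \<le> cyl_len (butlast w) / ?C" using N[OF w] by (intro divide_right_mono) auto
      also have "\<dots> \<le> cyl_len (butlast w @ [last w])"
        using e nzb[OF w] by (intro cyl_len_snoc_ge) auto
      finally show "d / ?C \<le> cyl_len w" using e by simp
    qed
    also have "\<dots> = measure lebesgue (\<Union>w\<in>N. cyl w)"
    proof (rule measure_UN_cyl[symmetric, OF fin nz])
      fix v w assume v: "v \<in> N" "w \<in> N" "length v \<le> length w" "v = take (length v) w"
      show "v = w"
      proof (rule ccontr)
        assume "v \<noteq> w"
        then have "length v \<noteq> length w" using v by (metis take_all_iff order_refl)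
        \<comment> \<open>A proper prefix of w is a prefix of its parent, so its cylinder would be
          longer than d.\<close>
        then have "v = take (length v) (butlast w)" using v by (simp add: take_butlast)
        then have b: "butlast w = v @ drop (length v) (butlast w)" by (metis append_take_drop_id)
        then have "cyl_len (butlast w) \<le> cyl_len v"
          using cyl_len_append_le[of v "drop (length v) (butlast w)"] nzb[OF v(2)] by simp
        then show False using N[OF v(1)] N[OF v(2)] by linarith
      qed
    qed
    also have "\<dots> \<le> measure lebesgue {u - 2 * d..u + 2 * d}"
    proof (rule measure_mono_fmeasurable)
      show "(\<Union>w\<in>N. cyl w) \<in> sets lebesgue"
        using fin by (intro sets.finite_UN fmeasurableD cyl_lmeasurable)
    qed (use sub in auto)
    also have "\<dots> = 4 * d" using assms by simp
    finally have "real (card N) * d / ?C \<le> 4 * d" by simp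
    then have "real (card N) * d \<le> 4 * d * ?C" by (subst (asm) pos_divide_le_eq) auto
    then have "real (card N) * d \<le> (4 * ?C) * d" by (simp only: mult_ac)
    then show ?thesis using assms(1) by simp
  qed simp
qed

text \<open>
  The mass \<open>cyl_len w powr s' * C ^ forced_count F w\<close> does not decrease when a word is replaced by its
  admissible children. Given a cover that is too economical, follow a branch along which the mass of
  the cover below the current word stays smaller than the mass of that word; its limit is not covered.
\<close>

theorem cf_tree_hausdorff:
  fixes s s' :: real
  assumes s: "0 < s" "s < s'" "s' < 1" and M: "1 \<le> M" "1 \<le> (1 - 2 / (real M + 1)) * 2 powr (1 - s')"
    and F: "\<And>w d. F w = Some d \<Longrightarrow> d \<in> {1..M}"
    and sparse: "\<And>\<zeta>. 0 < \<zeta> \<Longrightarrow> \<exists>C. \<forall>w. admissible M F w \<longrightarrow> real (forced_count F w) \<le> \<zeta> * real (length w) + C"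
  shows "0 < hausdorff_premeasure s (1/2) (cf_tree M F)"
proof -
  define Cm where "Cm = (real M + 1) * (real M + 2)"
  \<comment> \<open>A forced digit may shorten the cylinder by the factor \<open>Cm\<close>; the
    weight \<open>C\<close> makes up for this in the s'-th power.\<close>
  define C where "C = Cm powr s'"
  define \<nu> where "\<nu> w = cyl_len w powr s' * C ^ forced_count F w" for w
  have Cm: "6 \<le> Cm" 
  proof -
    have "2 * 3 \<le> (real M + 1) * (real M + 2)" using M by (intro mult_mono) auto
    then show ?thesis by (simp add: Cm_def)
  qed
  have C: "1 < C" unfolding C_def using Cm s by (intro gr_one_powr) auto
  have \<nu>_pos: "0 \<le> \<nu> w" for w using C by (simp add: \<nu>_def)
  have digits: "set w \<subseteq> {1..M}" "0 \<notin> set w" if "admissible M F w" for w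
    using admissible_digits[of F M w] F that by auto
  have fin_ch: "finite (choices M F w)" for w by (auto simp: choices_def split: option.splits)
  have children: "\<nu> w \<le> (\<Sum>a\<in>choices M F w. \<nu> (w @ [a]))" if w: "admissible M F w" for w
  proof (cases "F w")
    case None
    have p: "0 < cyl_len w" using cyl_len_pos digits w by blast
    \<comment> \<open>Every child is at most half as long as its parent, so as s' < 1 the power s' -
      1 of the length gains the factor 2^(1 - s'). By the assumption on M this pays for the part of
      the cylinder lost to digits above M.\<close>
    have "cyl_len (w @ [a]) * (cyl_len w powr (s' - 1) * 2 powr (1 - s')) \<le> cyl_len (w @ [a]) powr s'" if a: "a \<in> {1..M}" for a
    proof -
      have nz: "0 \<notin> set (w @ [a])" using digits[OF w] a by auto
      have p': "0 < cyl_len (w @ [a])" by (rule cyl_len_pos[OF nz])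
      have "(cyl_len w / 2) powr (s' - 1) \<le> cyl_len (w @ [a]) powr (s' - 1)"
        using cyl_len_snoc_le[OF nz] p' s by (intro powr_mono2') auto
      moreover have "(cyl_len w / 2) powr (s' - 1) = cyl_len w powr (s' - 1) * 2 powr (1 - s')"
        using p by (simp add: powr_divide powr_minus_divide[of 2 "s' - 1", simplified])
      moreover have "cyl_len (w @ [a]) * cyl_len (w @ [a]) powr (s' - 1) = cyl_len (w @ [a]) powr s'"
        using p' by (simp add: powr_mult_base)
      ultimately show ?thesis using p' by (metis mult_left_mono less_imp_le)
    qed
    then have le: "(\<Sum>a=1..M. cyl_len (w @ [a])) * (cyl_len w powr (s' - 1) * 2 powr (1 - s')) \<le> (\<Sum>a=1..M. cyl_len (w @ [a]) powr s')"
      unfolding sum_distrib_right by (intro sum_mono) auto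
    have "cyl_len w powr s' * 1 \<le> cyl_len w powr s' * ((1 - 2 / (real M + 1)) * 2 powr (1 - s'))"
      using M by (intro mult_left_mono) auto
    also have "\<dots> = (cyl_len w * cyl_len w powr (s' - 1)) * ((1 - 2 / (real M + 1)) * 2 powr (1 - s'))"
      using p by (simp add: powr_mult_base)
    also have "\<dots> = cyl_len w * (1 - 2 / (real M + 1)) * (cyl_len w powr (s' - 1) * 2 powr (1 - s'))" by simp
    also have "\<dots> \<le> (\<Sum>a=1..M. cyl_len (w @ [a])) * (cyl_len w powr (s' - 1) * 2 powr (1 - s'))"
      by (intro mult_right_mono sum_cyl_len_children_ge digits[OF w]) auto
    also note le
    finally have "cyl_len w powr s' \<le> (\<Sum>a=1..M. cyl_len (w @ [a]) powr s')" by simp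
    then have "cyl_len w powr s' * C ^ forced_count F w \<le> (\<Sum>a=1..M. cyl_len (w @ [a]) powr s') * C ^ forced_count F w"
      using C by (intro mult_right_mono) auto
    then show ?thesis using None by (simp add: \<nu>_def choices_def forced_count_snoc sum_distrib_right)
  next
    case (Some d)
    have p: "0 < cyl_len w" using cyl_len_pos digits w by blast
    have "cyl_len w / Cm \<le> cyl_len (w @ [d])"
      unfolding Cm_def using F[OF Some] digits[OF w] by (intro cyl_len_snoc_ge) auto
    then have "(cyl_len w / Cm) powr s' \<le> cyl_len (w @ [d]) powr s'"
      using p Cm s by (intro powr_mono2) auto
    then have "cyl_len w powr s' \<le> cyl_len (w @ [d]) powr s' * C"
      using p Cm by (simp add: powr_divide C_def field_simps)
    then have "cyl_len w powr s' * C ^ forced_count F w \<le> cyl_len (w @ [d]) powr s' * C * C ^ forced_count F w"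
      using C by (intro mult_right_mono) auto
    then show ?thesis using Some by (simp add: \<nu>_def choices_def forced_count_snoc)
  qed
  have "\<exists>C0>0. \<forall>w. admissible M F w \<longrightarrow> \<nu> w \<le> C0 * cyl_len w powr s"
  proof -
    \<comment> \<open>The choice makes C^\<zeta> = 2^(s' - s): up to a constant, the weights of the
      forced digits are absorbed by the decay of \<open>cyl_len w powr (s' - s)\<close>.\<close>
    define \<zeta> where "\<zeta> = (s' - s) * ln 2 / ln C"
    have \<zeta>: "0 < \<zeta>" using s C by (simp add: \<zeta>_def)
    have e: "C powr \<zeta> = 2 powr (s' - s)" using C by (simp add: powr_def \<zeta>_def)
    obtain K where K: "\<And>w. admissible M F w \<Longrightarrow> real (forced_count F w) \<le> \<zeta> * real (length w) + K"
      using sparse[OF \<zeta>] by blast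
    have "\<nu> w \<le> C powr K * cyl_len w powr s" if w: "admissible M F w" for w
    proof -
      have p: "0 < cyl_len w" using cyl_len_pos digits w by blast
      have "C ^ forced_count F w = C powr real (forced_count F w)" using C by (simp add: powr_realpow)
      also have "\<dots> \<le> C powr (\<zeta> * real (length w) + K)" using C K[OF w] by (intro powr_mono) auto
      also have "\<dots> = C powr K * (2 powr (s' - s)) powr real (length w)"
        unfolding e[symmetric] by (simp add: powr_add powr_powr)
      finally have 1: "C ^ forced_count F w \<le> C powr K * (2 powr (s' - s)) powr real (length w)" .
      have "cyl_len w powr (s' - s) \<le> ((1/2) ^ length w) powr (s' - s)"
        using cyl_len_le_power digits[OF w] p s by (intro powr_mono2) auto
      also have "\<dots> = 1 / (2 powr (s' - s)) powr real (length w)"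
        by (simp add: powr_powr powr_minus_divide power_one_over powr_divide mult.commute flip: powr_realpow)
      finally have 2: "cyl_len w powr (s' - s) \<le> 1 / (2 powr (s' - s)) powr real (length w)" .
      have "\<nu> w = cyl_len w powr s * (cyl_len w powr (s' - s) * C ^ forced_count F w)"
        by (simp add: \<nu>_def flip: powr_add)
      also have "\<dots> \<le> cyl_len w powr s * (1 / (2 powr (s' - s)) powr real (length w) * (C powr K * (2 powr (s' - s)) powr real (length w)))"
        using 1 2 C by (intro mult_left_mono mult_mono) auto
      finally show ?thesis by (simp add: mult.commute)
    qed
    then show ?thesis using C by (intro exI[of _ "C powr K"]) auto
  qed
  then obtain C0 where C0: "0 < C0" "\<And>w. admissible M F w \<Longrightarrow> \<nu> w \<le> C0 * cyl_len w powr s" by blast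
  define C1 where "C1 = 4 * Cm * C0"
  have C1: "0 < C1" using C0 Cm by (simp add: C1_def)
  \<comment> \<open>c < 1 keeps all scales below 1, the length of the root cylinder. In the initial
    load c enters twice, for the cover and for the padding \<epsilon>, whence the condition on 2
    c.\<close>
  define c where "c = min (1/2) (1 / (4 * C1))"
  have c: "0 < c" "c < 1" "C1 * (2 * c) < 1" using C1 by (auto simp: c_def min_def field_simps)
  have main: "ennreal c \<le> (\<Sum>i. diam_powr s (U i))"
    if U: "cf_tree M F \<subseteq> (\<Union>i. U i)" "\<And>i. bounded (U i)" "\<And>i. diameter (U i) \<le> 1/2" for U :: "nat \<Rightarrow> real set"
  proof (rule ccontr)
    assume "\<not> ?thesis"
    then have small: "(\<Sum>i. diam_powr s (U i)) < ennreal c" by simp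
    \<comment> \<open>Sets of diameter 0 have no scale of their own; \<epsilon> gives every set a
      positive one at total cost c.\<close>
    define \<epsilon> where "\<epsilon> i = c * (1/2) ^ Suc i" for i :: nat
    have \<epsilon>: "0 < \<epsilon> i" "\<epsilon> i < 1" for i
    proof -
      show "0 < \<epsilon> i" using c by (simp add: \<epsilon>_def)
      have "\<epsilon> i \<le> c * 1" unfolding \<epsilon>_def using c by (intro mult_left_mono power_le_one) auto
      then show "\<epsilon> i < 1" using c by simp
    qed
    define d where "d i = max (diameter (U i)) (\<epsilon> i powr (1 / s))" for i
    have d: "0 < d i" "d i < 1" "diameter (U i) \<le> d i" for i
    proof -
      show "0 < d i" using \<epsilon>[of i] by (auto simp: d_def less_max_iff_disj)
      have "\<epsilon> i powr (1 / s) < 1 powr (1 / s)" using \<epsilon>[of i] s by (intro powr_less_mono2) auto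
      then show "d i < 1" using U(3)[of i] by (simp add: d_def)
      show "diameter (U i) \<le> d i" by (simp add: d_def)
    qed
    define N where "N i = {w. admissible M F w \<and> w \<noteq> [] \<and> cyl_len w \<le> d i \<and> d i < cyl_len (butlast w) \<and> (\<exists>x\<in>{0..1}. cf w x \<in> U i)}" for i
    have N: "finite (N i)" "real (card (N i)) \<le> 4 * Cm" for i
      unfolding Cm_def by (rule card_cyl_meeting[of "d i" "U i" "N i" M]; use U d digits in \<open>force simp: N_def\<close>)+
    \<comment> \<open>The mass of the cover words that extend w.\<close>
    define load where "load w = (\<Sum>i. \<Sum>v\<in>N i. if take (length w) v = w then ennreal (\<nu> v) else 0)" for w
    have load_Nil: "load [] < ennreal (\<nu> [])"
    proof -
      have "(\<Sum>v\<in>N i. ennreal (\<nu> v)) \<le> ennreal C1 * (diam_powr s (U i) + ennreal (\<epsilon> i))" for i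
      proof (cases "N i = {}")
        case False
        then have ne: "U i \<noteq> {}" by (auto simp: N_def)
        have d0: "0 \<le> diameter (U i)" using U(2) by (rule diameter_ge_0)
        have "(\<Sum>v\<in>N i. \<nu> v) \<le> (\<Sum>v\<in>N i. C0 * d i powr s)"
        proof (rule sum_mono)
          fix v assume v: "v \<in> N i"
          then have "cyl_len v powr s \<le> d i powr s"
            using cyl_len_pos[of v] digits[of v] s by (intro powr_mono2) (auto simp: N_def less_imp_le)
          then have "C0 * cyl_len v powr s \<le> C0 * d i powr s" using C0 by (intro mult_left_mono) auto
          then show "\<nu> v \<le> C0 * d i powr s" using C0(2)[of v] v by (auto simp: N_def)
        qed
        also have "\<dots> = real (card (N i)) * (C0 * d i powr s)" by simp
        also have "\<dots> \<le> 4 * Cm * (C0 * d i powr s)" using N C0 by (intro mult_right_mono) auto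
        also have "\<dots> = C1 * d i powr s" by (simp add: C1_def)
        also have "d i powr s \<le> diameter (U i) powr s + \<epsilon> i"
          using \<epsilon>[of i] s by (auto simp: d_def max_def powr_powr)
        finally have "(\<Sum>v\<in>N i. \<nu> v) \<le> C1 * (diameter (U i) powr s + \<epsilon> i)" using C1 by simp
        then have "ennreal (\<Sum>v\<in>N i. \<nu> v) \<le> ennreal (C1 * (diameter (U i) powr s + \<epsilon> i))" by (rule ennreal_leI)
        also have "\<dots> = ennreal C1 * (diam_powr s (U i) + ennreal (\<epsilon> i))"
          using ne s C1 \<epsilon>[of i] by (simp add: diam_powr_def ennreal_mult ennreal_plus del: ennreal_plus[symmetric])
        finally show ?thesis using \<nu>_pos by (simp add: sum_ennreal)
      qed simp
      then have "load [] \<le> (\<Sum>i. ennreal C1 * (diam_powr s (U i) + ennreal (\<epsilon> i)))"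
        unfolding load_def by (intro suminf_le) auto
      also have "\<dots> = ennreal C1 * ((\<Sum>i. diam_powr s (U i)) + (\<Sum>i. ennreal (\<epsilon> i)))"
        by (simp add: ennreal_suminf_cmult suminf_add)
      also have "(\<Sum>i. ennreal (\<epsilon> i)) = ennreal c"
      proof (rule suminf_ennreal_eq)
        show "\<epsilon> sums c" using sums_mult[OF power_half_series, of c] by (simp add: \<epsilon>_def[abs_def])
      qed (use \<epsilon> less_imp_le in blast)
      also have "ennreal C1 * ((\<Sum>i. diam_powr s (U i)) + ennreal c) \<le> ennreal C1 * (ennreal c + ennreal c)"
        using small by (intro mult_left_mono add_right_mono) auto
      also have "\<dots> = ennreal (C1 * (2 * c))" using C1 c by (simp add: ennreal_mult flip: ennreal_plus)
      also have "\<dots> < ennreal 1" using c C1 by (simp add: ennreal_less_iff)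
      finally show ?thesis by (simp add: \<nu>_def forced_count_def)
    qed
    \<comment> \<open>A cover word extends at most one child of w, so the loads of the children add
      up to at most that of w, while their masses add up to at least that of w. Hence some child
      again has a load below its mass.\<close>
    have step: "\<exists>a. a \<in> choices M F w \<and> load (w @ [a]) < ennreal (\<nu> (w @ [a]))"
      if w: "admissible M F w" "load w < ennreal (\<nu> w)" for w
    proof (rule ccontr)
      assume no: "\<not> ?thesis"
      have "ennreal (\<nu> w) \<le> ennreal (\<Sum>a\<in>choices M F w. \<nu> (w @ [a]))" using children[OF w(1)] by (rule ennreal_leI)
      also have "\<dots> = (\<Sum>a\<in>choices M F w. ennreal (\<nu> (w @ [a])))" using \<nu>_pos by (simp add: sum_ennreal)
      also have "\<dots> \<le> (\<Sum>a\<in>choices M F w. load (w @ [a]))" using no by (intro sum_mono) (auto simp: not_less)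
      also have "\<dots> = (\<Sum>i. \<Sum>a\<in>choices M F w. \<Sum>v\<in>N i. if take (length (w @ [a])) v = w @ [a] then ennreal (\<nu> v) else 0)"
        unfolding load_def by (rule suminf_sum[symmetric]) auto
      also have "\<dots> \<le> load w"
        unfolding load_def
      proof (intro suminf_le allI)
        fix i
        have "(\<Sum>a\<in>choices M F w. if take (length (w @ [a])) v = w @ [a] then ennreal (\<nu> v) else 0)
            \<le> (if take (length w) v = w then ennreal (\<nu> v) else 0)" for v
        proof (cases "take (length w) v = w")
          case True
          have "(\<Sum>a\<in>choices M F w. if take (length (w @ [a])) v = w @ [a] then ennreal (\<nu> v) else 0)
             \<le> (\<Sum>a\<in>choices M F w. if a = v ! length w then ennreal (\<nu> v) else 0)"
          proof (rule sum_mono)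
            fix a
            have "a = v ! length w" if e: "take (length (w @ [a])) v = w @ [a]"
            proof -
              have "take (length (w @ [a])) v ! length w = a" unfolding e by simp
              then show ?thesis by simp
            qed
            then show "(if take (length (w @ [a])) v = w @ [a] then ennreal (\<nu> v) else 0)
              \<le> (if a = v ! length w then ennreal (\<nu> v) else 0)" by auto
          qed
          also have "\<dots> \<le> ennreal (\<nu> v)" using fin_ch by (simp add: sum.delta)
          finally show ?thesis using True by simp
        next
          case False
          have "take (length (w @ [a])) v \<noteq> w @ [a]" for a
          proof
            assume "take (length (w @ [a])) v = w @ [a]"
            then have "take (length w) (take (length (w @ [a])) v) = take (length w) (w @ [a])" by simp
            then show False using False by simp
          qed
          then show ?thesis by simp
        qed
        then show "(\<Sum>a\<in>choices M F w. \<Sum>v\<in>N i. if take (length (w @ [a])) v = w @ [a] then ennreal (\<nu> v) else 0)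
          \<le> (\<Sum>v\<in>N i. if take (length w) v = w then ennreal (\<nu> v) else 0)"
          by (subst sum.swap) (intro sum_mono)
      qed auto
      finally show False using w(2) by simp
    qed
    define nxt where "nxt w = (SOME a. a \<in> choices M F w \<and> load (w @ [a]) < ennreal (\<nu> (w @ [a])))" for w
    have nxt: "nxt w \<in> choices M F w \<and> load (w @ [nxt w]) < ennreal (\<nu> (w @ [nxt w]))"
      if "admissible M F w" "load w < ennreal (\<nu> w)" for w
      unfolding nxt_def by (rule someI_ex[OF step[OF that]])
    define P where "P = rec_nat [] (\<lambda>_ w. w @ [nxt w])"
    define a where "a m = nxt (P m)" for m
    have P: "P 0 = []" "P (Suc m) = P m @ [nxt (P m)]" for m by (simp_all add: P_def)
    have prea: "pre a m = P m" for m by (induction m) (simp_all add: P pre_Suc a_def)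
    have inv: "admissible M F (P m) \<and> load (P m) < ennreal (\<nu> (P m))" for m
    proof (induction m)
      case (Suc m)
      then show ?case using nxt[of "P m"] by (simp only: P admissible_snoc simp_thms)
    qed (use load_Nil in \<open>simp only: P admissible_Nil simp_thms\<close>)
    have ach: "a m \<in> choices M F (pre a m)" for m
      using inv[of "Suc m"] by (simp add: prea P admissible_snoc a_def)
    have a1: "1 \<le> a i" for i
      using ach[of i] F[of "pre a i"] by (auto simp: choices_def split: option.splits)
    have "cfval a \<in> cf_tree M F" unfolding cf_tree_def using ach by blast
    then obtain i where i: "cfval a \<in> U i" using U(1) by blast
    have len: "cyl_len (P m) \<le> (1/2) ^ m" for m
      using cyl_len_le_power[OF pre_nonzero[of a m, OF a1]] unfolding prea[symmetric] by simp
    obtain k where "(1/2) ^ k < d i" using real_arch_pow_inv[of "d i" "1/2"] d(1)[of i] by auto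
    then have ex: "cyl_len (P k) \<le> d i" using len[of k] by linarith
    define m where "m = (LEAST m. cyl_len (P m) \<le> d i)"
    have m: "cyl_len (P m) \<le> d i" unfolding m_def using ex by (rule LeastI)
    have "m \<noteq> 0"
    proof
      assume "m = 0"
      then show False using m d(2)[of i] P(1) by simp
    qed
    then obtain m' where m': "m = Suc m'" by (cases m) auto
    have "\<not> cyl_len (P m') \<le> d i" using not_less_Least[of m' "\<lambda>m. cyl_len (P m) \<le> d i"] m' m_def by simp
    moreover have "cf (P m) (cfval (\<lambda>i. a (m + i))) \<in> U i"
      using i cfval_pre[of a m] a1 by (simp add: prea)
    moreover have "cfval (\<lambda>i. a (m + i)) \<in> {0..1}" using cfval_bounds[of "\<lambda>i. a (m + i)"] a1 by auto
    ultimately have inN: "P m \<in> N i" using m inv[of m] by (auto simp: N_def m' P(2))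
    \<comment> \<open>\<open>P m\<close> is itself a cover word, so its load contains its own
      mass.\<close>
    have "ennreal (\<nu> (P m)) \<le> (\<Sum>v\<in>N i. if take (length (P m)) v = P m then ennreal (\<nu> v) else 0)"
      using N(1)[of i] inN by (intro order_trans[OF _ member_le_sum[of "P m"]]) auto
    also have "\<dots> \<le> load (P m)"
      unfolding load_def using sum_le_suminf[of "\<lambda>i. \<Sum>v\<in>N i. if take (length (P m)) v = P m then ennreal (\<nu> v) else 0" "{i}"] by simp
    finally show False using inv[of m] by (meson leD)
  qed
  have "ennreal c \<le> hausdorff_premeasure s (1/2) (cf_tree M F)"
    unfolding hausdorff_premeasure_def by (rule Inf_greatest) (use main in blast)
  then show ?thesis using c by (metis ennreal_less_zero_iff less_le_trans)
qed

section \<open>Prescribed blocks of digits\<close>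

text \<open>A stopping time: \<open>den1\<close> does not decrease along a word of positive digits,
  so p is the first prefix whose squared denominator exceeds Z. Squares are used because n / q^2 is
  the scale of the frequency of n \<beta> as a function of the tail.\<close>

definition crossing :: "real \<Rightarrow> nat list \<Rightarrow> bool" where
  "crossing Z p \<longleftrightarrow> p \<noteq> [] \<and> Z < (den1 p)\<^sup>2 \<and> (den1 (butlast p))\<^sup>2 \<le> Z"

lemma crossing_unique:
  assumes "crossing Z (take m w)" "crossing Z (take m' w)" "m \<le> length w" "m' \<le> length w" "0 \<notin> set w"
  shows "m = m'"
proof -
  have *: False if "crossing Z (take m w)" "crossing Z (take m' w)" "m < m'" "m' \<le> length w" for m m'
  proof -
    have e: "butlast (take m' w) = take m w @ drop m (take (m' - 1) w)"
      using that by (simp add: butlast_take drop_take flip: take_add)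
    have "0 \<notin> set (take m w @ drop m (take (m' - 1) w))"
      using assms(5) by (auto dest: in_set_takeD in_set_dropD)
    then have "den1 (take m w) \<le> den1 (butlast (take m' w))" "0 \<notin> set (take m w)"
      unfolding e by (auto intro: den1_append_ge)
    then have "(den1 (take m w))\<^sup>2 \<le> (den1 (butlast (take m' w)))\<^sup>2"
      using den1_ge_1[of "take m w"] by (intro power_mono) auto
    then show False using that by (auto simp: crossing_def)
  qed
  show ?thesis using *[of m m'] *[of m' m] assms by (meson linorder_neqE_nat)
qed

lemma crossing_den_le:
  assumes "crossing Z p" "set p \<subseteq> {1..M}"
  shows "(den1 p)\<^sup>2 \<le> (real M + 1)\<^sup>2 * Z"
proof -
  have p: "p = butlast p @ [last p]" using assms(1) by (simp add: crossing_def)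
  then have lp: "last p \<in> {1..M}" using assms(2) by (metis in_set_conv_decomp subsetD)
  have nz: "0 \<notin> set (butlast p)" "0 \<notin> set p" using assms(2) by (auto dest: in_set_butlastD)
  have "den1 p \<le> (real M + 1) * den1 (butlast p)"
    using den1_snoc_le[OF nz(1), of "last p" M] p lp by simp
  then have "(den1 p)\<^sup>2 \<le> ((real M + 1) * den1 (butlast p))\<^sup>2"
    using den1_ge_1[OF nz(2)] by (intro power_mono) auto
  also have "\<dots> \<le> (real M + 1)\<^sup>2 * Z"
    unfolding power_mult_distrib using assms(1) by (intro mult_left_mono) (auto simp: crossing_def)
  finally show ?thesis .
qed

text \<open>Task t waits until the squared denominator exceeds \<open>Z t\<close> and then
  prescribes the next \<open>L t\<close> digits, which may depend on the word reached. A digit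
  multiplies the denominator by at most M + 1, so \<open>sep\<close> says that one block is over
  before the next threshold is passed. \<open>count\<close> makes the prescribed digits a vanishing
  proportion, because the logarithm of the denominator is at most linear in the length of the
  word.\<close>

locale block_tasks =
  fixes M :: nat and I :: "'t set" and Z :: "'t \<Rightarrow> real" and L :: "'t \<Rightarrow> nat"
    and blk :: "'t \<Rightarrow> nat list \<Rightarrow> nat list"
  assumes M: "1 \<le> M" and Z: "\<And>t. t \<in> I \<Longrightarrow> 1 \<le> Z t"
    and blk: "\<And>t p. t \<in> I \<Longrightarrow> set p \<subseteq> {1..M} \<Longrightarrow> crossing (Z t) p \<Longrightarrow> blk t p \<in> words M (L t)"
    and sep: "\<And>t t'. t \<in> I \<Longrightarrow> t' \<in> I \<Longrightarrow> t \<noteq> t' \<Longrightarrow>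
      (real M + 1) ^ (2 * (L t + 1)) * Z t \<le> Z t' \<or> (real M + 1) ^ (2 * (L t' + 1)) * Z t' \<le> Z t"
    and count: "\<And>\<zeta>. 0 < \<zeta> \<Longrightarrow>
      \<exists>C. \<forall>X\<ge>1. finite {t \<in> I. Z t < X} \<and> (\<Sum>t | t \<in> I \<and> Z t < X. real (L t)) \<le> \<zeta> * ln X + C"
begin

definition forced_by :: "'t \<Rightarrow> nat list \<Rightarrow> nat list \<Rightarrow> nat \<Rightarrow> bool" where
  "forced_by t p w d \<longleftrightarrow> t \<in> I \<and> set p \<subseteq> {1..M} \<and> crossing (Z t) p \<and> (\<exists>u v. w = p @ u \<and> blk t p = u @ d # v)"

definition forced :: "nat list \<Rightarrow> nat option" where
  "forced w = (if \<exists>t p d. forced_by t p w d then Some (SOME d. \<exists>t p. forced_by t p w d) else None)"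

lemma forced_by_digits: "forced_by t p w d \<Longrightarrow> set w \<subseteq> {1..M} \<and> d \<in> {1..M}"
  using blk[of t p] unfolding forced_by_def words_def by force

lemma forced_by_take: "forced_by t p w d \<Longrightarrow> p = take (length p) w \<and> length p \<le> length w \<and> length w < length p + L t"
  using blk[of t p] by (auto simp: forced_by_def words_def)

lemma forced_by_den:
  assumes "forced_by t p w d"
  shows "(den1 w)\<^sup>2 \<le> (real M + 1) ^ (2 * (L t + 1)) * Z t"
proof -
  obtain u v where f: "t \<in> I" "set p \<subseteq> {1..M}" "crossing (Z t) p" "w = p @ u" "blk t p = u @ d # v"
    using assms by (auto simp: forced_by_def)
  have b: "set u \<subseteq> {1..M}" "length u \<le> L t" using blk[OF f(1-3)] f(5) by (auto simp: words_def)
  have nz: "0 \<notin> set p" using f(2) by auto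
  have "den1 w \<le> (real M + 1) ^ length u * den1 p"
    unfolding f(4) using nz b by (intro den1_append_le)
  also have "\<dots> \<le> (real M + 1) ^ L t * den1 p"
    using b den1_ge_1[OF nz] by (intro mult_right_mono power_increasing) auto
  finally have "(den1 w)\<^sup>2 \<le> ((real M + 1) ^ L t * den1 p)\<^sup>2"
    using den1_ge_1[of w] forced_by_digits[OF assms] by (intro power_mono) force+
  also have "\<dots> = (real M + 1) ^ (2 * L t) * (den1 p)\<^sup>2"
    by (simp only: power_mult_distrib power_mult[symmetric] mult.commute[of 2])
  also have "\<dots> \<le> (real M + 1) ^ (2 * L t) * ((real M + 1)\<^sup>2 * Z t)"
    using crossing_den_le[OF f(3,2)] by (intro mult_left_mono) auto
  also have "\<dots> = (real M + 1) ^ (2 * (L t + 1)) * Z t"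
    by (simp add: power_add power2_eq_square)
  finally show ?thesis .
qed

lemma forced_by_Z_less:
  assumes "forced_by t p w d"
  shows "Z t < (den1 w)\<^sup>2"
proof -
  obtain u where f: "crossing (Z t) p" "w = p @ u" "0 \<notin> set w"
    using assms forced_by_digits[OF assms] unfolding forced_by_def by force
  have "den1 p \<le> den1 w" using f(3) unfolding f(2) by (rule den1_append_ge)
  then have "(den1 p)\<^sup>2 \<le> (den1 w)\<^sup>2" using den1_ge_1[of p] f by (intro power_mono) auto
  then show ?thesis using f(1) by (simp add: crossing_def)
qed

text \<open>If two tasks were active at w, both thresholds would lie below the squared denominator
  of w and both blocks would still reach it, against \<open>sep\<close>. For a single task the
  crossing prefix is unique.\<close>

lemma forced_by_unique:
  assumes "forced_by t p w d" "forced_by t' p' w d'"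
  shows "t = t' \<and> p = p' \<and> d = d'"
proof -
  have I: "t \<in> I" "t' \<in> I" using assms by (auto simp: forced_by_def)
  have t: "t = t'"
  proof (rule ccontr)
    assume "t \<noteq> t'"
    then show False
      using sep[OF I] forced_by_den[OF assms(1)] forced_by_den[OF assms(2)]
        forced_by_Z_less[OF assms(1)] forced_by_Z_less[OF assms(2)] by linarith
  qed
  have "0 \<notin> set w" using forced_by_digits[OF assms(1)] by auto
  then have "length p = length p'"
    using crossing_unique[of "Z t" "length p" w "length p'"] forced_by_take[OF assms(1)] forced_by_take[OF assms(2)]
      assms t by (auto simp: forced_by_def)
  then have p: "p = p'" using forced_by_take[OF assms(1)] forced_by_take[OF assms(2)] by metis
  then show ?thesis using assms t by (auto simp: forced_by_def)
qed

lemma forced_eq: "forced_by t p w d \<Longrightarrow> forced w = Some d"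
  unfolding forced_def using forced_by_unique by (auto intro!: some_equality)

lemma forced_SomeD: "forced w = Some d \<Longrightarrow> \<exists>t p. forced_by t p w d"
proof -
  assume f: "forced w = Some d"
  then have ex: "\<exists>d. \<exists>t p. forced_by t p w d" unfolding forced_def by (auto split: if_splits)
  have "d = (SOME d. \<exists>t p. forced_by t p w d)" using f unfolding forced_def by (auto split: if_splits)
  then show ?thesis using someI_ex[OF ex] by simp
qed

lemma forced_digits: "forced w = Some d \<Longrightarrow> d \<in> {1..M}"
  using forced_SomeD forced_by_digits by blast

lemma forced_sparse:
  assumes "0 < \<zeta>"
  shows "\<exists>C. \<forall>w. admissible M forced w \<longrightarrow> real (forced_count forced w) \<le> \<zeta> * real (length w) + C"
proof -
  have l: "0 < ln (real M + 1)" using M by simp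
  \<comment> \<open>The factor 2 ln (M + 1) converts ln X, twice the logarithm of
    \<open>den1 w\<close>, into a bound by the length of w.\<close>
  obtain C where C: "\<And>X. 1 \<le> X \<Longrightarrow> finite {t \<in> I. Z t < X} \<and>
      (\<Sum>t | t \<in> I \<and> Z t < X. real (L t)) \<le> \<zeta> / (2 * ln (real M + 1)) * ln X + C"
    using count[of "\<zeta> / (2 * ln (real M + 1))"] assms l by auto
  have "real (forced_count forced w) \<le> \<zeta> * real (length w) + C" if w: "admissible M forced w" for w
  proof -
    have digits: "set w \<subseteq> {1..M}" using admissible_digits[of forced M w] forced_digits w by blast
    have nz: "0 \<notin> set w" using digits by auto
    define X where "X = (den1 w)\<^sup>2"
    have X: "1 \<le> X" using den1_ge_1[OF nz] by (simp add: X_def)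
    define T where "T = {t \<in> I. Z t < X}"
    define A where "A t = {m. m < length w \<and> (\<exists>p d. forced_by t p (take m w) d)}" for t
    \<comment> \<open>A task has only one crossing prefix along w, so all positions that it forces
      lie in one window of length \<open>L t\<close>.\<close>
    have A: "card (A t) \<le> L t" for t
    proof (cases "A t = {}")
      case False
      then obtain m p d where m: "m < length w" "forced_by t p (take m w) d" by (auto simp: A_def)
      have "A t \<subseteq> {length p..<length p + L t}"
      proof
        fix m' assume "m' \<in> A t"
        then obtain p' d' where m': "m' < length w" "forced_by t p' (take m' w) d'" by (auto simp: A_def)
        have tk: "take (length p) (take m w) = take (length p) w" "take (length p') (take m' w) = take (length p') w"
          "length p \<le> m" "length p' \<le> m'"
          using forced_by_take[OF m(2)] forced_by_take[OF m'(2)] m m' by auto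
        have "length p = length p'"
          using crossing_unique[of "Z t" "length p" w "length p'"] tk m m' nz
            forced_by_take[OF m(2)] forced_by_take[OF m'(2)] by (auto simp: forced_by_def)
        then show "m' \<in> {length p..<length p + L t}"
          using forced_by_take[OF m'(2)] m' by auto
      qed
      then have "card (A t) \<le> card {length p..<length p + L t}" by (intro card_mono) auto
      then show ?thesis by simp
    qed simp
    have "{m. m < length w \<and> forced (take m w) \<noteq> None} \<subseteq> (\<Union>t\<in>T. A t)"
    proof
      fix m assume "m \<in> {m. m < length w \<and> forced (take m w) \<noteq> None}"
      then obtain t p d where m: "m < length w" "forced_by t p (take m w) d"
        using forced_SomeD by blast
      have "den1 (take m w) \<le> den1 (take m w @ drop m w)" using nz by (intro den1_append_ge) simp
      moreover have "1 \<le> den1 (take m w)" using nz by (intro den1_ge_1) (auto dest: in_set_takeD)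
      ultimately have "(den1 (take m w))\<^sup>2 \<le> X" unfolding X_def by (intro power_mono) auto
      then have "t \<in> T" using forced_by_Z_less[OF m(2)] m(2) by (auto simp: T_def forced_by_def)
      then show "m \<in> (\<Union>t\<in>T. A t)" using m by (auto simp: A_def)
    qed
    moreover have finT: "finite T" using C[OF X] by (simp add: T_def)
    ultimately have "forced_count forced w \<le> card (\<Union>t\<in>T. A t)"
      unfolding forced_count_def by (intro card_mono) (auto simp: A_def)
    also have "\<dots> \<le> (\<Sum>t\<in>T. card (A t))" by (rule card_UN_le[OF finT])
    also have "\<dots> \<le> (\<Sum>t\<in>T. L t)" by (intro sum_mono A)
    finally have "real (forced_count forced w) \<le> (\<Sum>t\<in>T. real (L t))" by (simp flip: of_nat_sum)
    also have "\<dots> \<le> \<zeta> / (2 * ln (real M + 1)) * ln X + C" using C[OF X] by (simp add: T_def)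
    also have "\<dots> \<le> \<zeta> / (2 * ln (real M + 1)) * (2 * real (length w) * ln (real M + 1)) + C"
    proof (intro add_right_mono mult_left_mono)
      have "den1 ([] @ w) \<le> (real M + 1) ^ length w * den1 []" using digits by (intro den1_append_le) auto
      then have "ln (den1 w) \<le> ln ((real M + 1) ^ length w)" using den1_ge_1[OF nz] by simp
      then show "ln X \<le> 2 * real (length w) * ln (real M + 1)"
        using den1_ge_1[OF nz] by (simp add: X_def ln_realpow)
    qed (use assms l in auto)
    finally show ?thesis using l by simp
  qed
  then show ?thesis by blast
qed

text \<open>The denominators along \<open>a\<close> are unbounded, so the threshold is passed, and
  not by the empty word, whose denominator is 1 \<le> \<open>Z t\<close>. From there on the forced
  digits are unique and spell out the block.\<close>

lemma tree_follows:
  assumes a: "\<And>m. a m \<in> choices M forced (pre a m)" and t: "t \<in> I"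
  shows "\<exists>p. set p \<subseteq> {1..M} \<and> crossing (Z t) p \<and> (\<exists>x\<in>{0..1}. cfval a = cf (p @ blk t p) x)"
proof -
  have a1: "a i \<in> {1..M}" for i
    using a[of i] forced_digits[of "pre a i"] by (auto simp: choices_def split: option.splits)
  have a2: "1 \<le> a i" for i using a1[of i] by simp
  have nz: "0 \<notin> set (pre a m)" for m using a2 by (rule pre_nonzero)
  have ex: "\<exists>m. Z t < (den1 (pre a m))\<^sup>2"
  proof -
    obtain m where m: "2 * Z t < 2 ^ m" using real_arch_pow[of 2 "2 * Z t"] by auto
    have "2 ^ m \<le> den1 (pre a m) * (den1 (pre a m) + den2 (pre a m))" using den_growth[OF nz[of m]] by simp
    also have "\<dots> \<le> den1 (pre a m) * (2 * den1 (pre a m))"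
      using den_bounds[OF nz[of m]] by (intro mult_left_mono) auto
    finally show ?thesis using m by (intro exI[of _ m]) (simp add: power2_eq_square)
  qed
  define m where "m = (LEAST m. Z t < (den1 (pre a m))\<^sup>2)"
  have m: "Z t < (den1 (pre a m))\<^sup>2" unfolding m_def using ex by (rule LeastI_ex)
  have m0: "m \<noteq> 0"
  proof
    assume "m = 0"
    then show False using m Z[OF t] by simp
  qed
  then obtain m' where m': "m = Suc m'" by (cases m) auto
  have "\<not> Z t < (den1 (pre a m'))\<^sup>2"
    using not_less_Least[of m' "\<lambda>m. Z t < (den1 (pre a m))\<^sup>2"] m' by (simp add: m_def)
  then have c: "crossing (Z t) (pre a m)" using m by (auto simp: crossing_def m' pre_Suc)
  have d: "set (pre a m) \<subseteq> {1..M}" using a1 by (rule set_pre)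
  let ?b = "blk t (pre a m)"
  have b: "length ?b = L t" using blk[OF t d c] by (simp add: words_def)
  have "pre a (m + j) = pre a m @ take j ?b" if "j \<le> L t" for j
    using that
  proof (induction j)
    case (Suc j)
    have "?b = take j ?b @ ?b ! j # drop (Suc j) ?b" using Suc.prems b by (simp add: id_take_nth_drop)
    then have "forced_by t (pre a m) (pre a (m + j)) (?b ! j)"
      using Suc t d c unfolding forced_by_def by (metis Suc_leD)
    then have "a (m + j) = ?b ! j" using a[of "m + j"] by (simp add: forced_eq choices_def)
    then show ?case using Suc b by (simp add: pre_Suc take_Suc_conv_app_nth)
  qed simp
  from this[of "L t"] have "pre a (m + L t) = pre a m @ ?b" using b by simp
  moreover have "cfval a = cf (pre a (m + L t)) (cfval (\<lambda>i. a (m + L t + i)))"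
    using a2 by (rule cfval_pre)
  moreover have "cfval (\<lambda>i. a (m + L t + i)) \<in> {0..1}"
    using cfval_bounds[of "\<lambda>i. a (m + L t + i)"] a2 by auto
  ultimately show ?thesis using c d by metis
qed

theorem block_tasks_hausdorff:
  assumes s: "0 < s" "s < s'" "s' < 1" "1 \<le> (1 - 2 / (real M + 1)) * 2 powr (1 - s')"
  shows "\<exists>G. G \<subseteq> Bad \<inter> {0..1} \<and> 0 < hausdorff_premeasure s (1/2) G \<and>
    (\<forall>\<beta>\<in>G. \<forall>t\<in>I. \<exists>p. set p \<subseteq> {1..M} \<and> crossing (Z t) p \<and> (\<exists>x\<in>{0..1}. \<beta> = cf (p @ blk t p) x))"
proof (rule exI[of _ "cf_tree M forced"], intro conjI ballI)
  show "0 < hausdorff_premeasure s (1/2) (cf_tree M forced)"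
    by (rule cf_tree_hausdorff[OF s(1-3) M s(4) forced_digits forced_sparse])
  show "cf_tree M forced \<subseteq> Bad \<inter> {0..1}"
  proof
    fix \<beta> assume "\<beta> \<in> cf_tree M forced"
    then obtain a where a: "\<beta> = cfval a" "\<And>m. a m \<in> choices M forced (pre a m)" by (auto simp: cf_tree_def)
    have a1: "a i \<in> {1..M}" for i
      using a(2)[of i] forced_digits[of "pre a i"] by (auto simp: choices_def split: option.splits)
    have a2: "1 \<le> a i" for i using a1[of i] by simp
    show "\<beta> \<in> Bad \<inter> {0..1}"
      using cfval_Bad[of a, OF a1] cfval_bounds[of a, OF a2] a(1) by simp
  qed
  show "\<exists>p. set p \<subseteq> {1..M} \<and> crossing (Z t) p \<and> (\<exists>x\<in>{0..1}. \<beta> = cf (p @ blk t p) x)"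
    if \<beta>: "\<beta> \<in> cf_tree M forced" and t: "t \<in> I" for \<beta> t
  proof -
    obtain a where "\<beta> = cfval a" "\<And>m. a m \<in> choices M forced (pre a m)" using \<beta> by (auto simp: cf_tree_def)
    then show ?thesis using tree_follows[of a t] t by simp
  qed
qed

end

section \<open>Dense orbits along lacunary sequences\<close>

lemma linear_le_power2:
  assumes "a + c + 4 \<le> l"
  shows "a * l + c \<le> (2::nat) ^ l"
proof -
  have sq: "4 \<le> l \<Longrightarrow> l * l \<le> 2 ^ l" for l :: nat
  proof (induction l rule: nat_induct_at_least)
    case (Suc l)
    have "2 * l + 1 \<le> l * l" using Suc.hyps mult_le_mono1[of 4 l l] by linarith
    then show ?case using Suc by simp
  qed simp
  have "a * l + c \<le> a * l + c * l" using assms by (intro add_left_mono) auto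
  also have "\<dots> = (a + c) * l" by (simp add: algebra_simps)
  also have "\<dots> \<le> l * l" using assms by (intro mult_right_mono) auto
  also have "\<dots> \<le> 2 ^ l" using assms by (intro sq) auto
  finally show ?thesis .
qed

lemma sum_power4_le: "(\<Sum>l\<le>m. (4::real) ^ l) \<le> 2 * 4 ^ m"
proof (induction m)
  case (Suc m)
  have "0 \<le> (4::real) ^ m" by simp
  then show ?case using Suc unfolding sum.atMost_Suc power_Suc by linarith
qed simp

text \<open>A stage with parameter l prescribes 2^l blocks of length 161 l + 1, which is negligible
  against 4^l; and since 4^l grows geometrically, the last stage dominates the sum. The finitely
  many small l go into C.\<close>

lemma block_length_sum_sparse:
  fixes \<eta> :: real
  assumes "0 < \<eta>"
  shows "\<exists>C. \<forall>Y A. finite A \<longrightarrow> 0 \<le> Y \<longrightarrow> (\<forall>l\<in>A. (4::real) ^ l < Y) \<longrightarrow>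
    (\<Sum>l\<in>A. 2 ^ l * (161 * real l + 1)) \<le> \<eta> * Y + C"
proof -
  obtain a :: nat where a: "322 / \<eta> \<le> real a" using real_arch_simple by blast
  define h where "h l = (2::real) ^ l * (161 * real l + 1)" for l :: nat
  define \<Lambda> where "\<Lambda> = a + a + 4"
  have tail: "h l \<le> \<eta> / 2 * 4 ^ l" if l: "\<Lambda> \<le> l" for l
  proof -
    have "a * l + a \<le> 2 ^ l" using l by (intro linear_le_power2) (simp add: \<Lambda>_def)
    then have "real a * real l + real a \<le> 2 ^ l" by (metis of_nat_add of_nat_mult of_nat_numeral of_nat_power of_nat_le_iff)
    moreover have "322 / \<eta> * real l \<le> real a * real l" using a by (intro mult_right_mono) auto
    ultimately have "322 / \<eta> * real l + 322 / \<eta> \<le> 2 ^ l" using a by linarith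
    then have "322 * real l + 322 \<le> \<eta> * 2 ^ l" using assms by (simp add: field_simps)
    then have "161 * real l + 1 \<le> \<eta> / 2 * 2 ^ l" by simp
    then have "2 ^ l * (161 * real l + 1) \<le> 2 ^ l * (\<eta> / 2 * 2 ^ l)" by (intro mult_left_mono) auto
    also have "\<dots> = \<eta> / 2 * 4 ^ l" by (simp flip: power_mult_distrib)
    finally show ?thesis by (simp add: h_def)
  qed
  have "(\<Sum>l\<in>A. h l) \<le> \<eta> * Y + (\<Sum>l<\<Lambda>. h l)" if A: "finite A" "0 \<le> Y" "\<forall>l\<in>A. (4::real) ^ l < Y" for A Y
  proof -
    have h0: "0 \<le> h l" for l by (simp add: h_def)
    have "(\<Sum>l\<in>A. h l) \<le> (\<Sum>l\<in>A. \<eta> / 2 * 4 ^ l + (if l < \<Lambda> then h l else 0))"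
      using tail assms by (intro sum_mono) (auto simp: not_less)
    also have "\<dots> = \<eta> / 2 * (\<Sum>l\<in>A. 4 ^ l) + (\<Sum>l\<in>A \<inter> {..<\<Lambda>}. h l)"
      using A by (simp add: sum.distrib sum_distrib_left sum.inter_filter lessThan_def Int_def)
    also have "(\<Sum>l\<in>A \<inter> {..<\<Lambda>}. h l) \<le> (\<Sum>l<\<Lambda>. h l)" using h0 by (intro sum_mono2) auto
    also have "(\<Sum>l\<in>A. (4::real) ^ l) \<le> 2 * Y"
    proof (cases "A = {}")
      case False
      have "(\<Sum>l\<in>A. (4::real) ^ l) \<le> (\<Sum>l\<le>Max A. 4 ^ l)" using A by (intro sum_mono2) auto
      also have "\<dots> \<le> 2 * 4 ^ Max A" by (rule sum_power4_le)
      also have "\<dots> \<le> 2 * Y" using A False by (auto simp: less_imp_le)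
      finally show ?thesis .
    qed (use A in simp)
    finally show ?thesis using assms by simp
  qed
  then show ?thesis unfolding h_def by blast
qed

text \<open>Rounding the fractional part of \<gamma> down to the grid costs 1 / 2^l, dropping the
  integer part nothing.\<close>

lemma nint_dist_grid:
  assumes "nint_dist (y - real g / 2 ^ l) \<le> 2 / 2 ^ l" "g = nat \<lfloor>2 ^ l * frac \<gamma>\<rfloor>"
  shows "nint_dist (y - \<gamma>) \<le> 3 / 2 ^ l"
proof -
  have fl: "0 \<le> \<lfloor>2 ^ l * frac \<gamma>\<rfloor>" by simp
  have "real g = of_int \<lfloor>2 ^ l * frac \<gamma>\<rfloor>" using fl assms(2) by simp
  then have "\<bar>2 ^ l * frac \<gamma> - real g\<bar> \<le> 1" by linarith
  then have g: "\<bar>frac \<gamma> - real g / 2 ^ l\<bar> \<le> 1 / 2 ^ l"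
    by (simp add: field_simps abs_le_iff)
  define m where "m = round (y - real g / 2 ^ l)"
  have "nint_dist (y - \<gamma>) \<le> \<bar>y - \<gamma> - of_int (m - \<lfloor>\<gamma>\<rfloor>)\<bar>" by (rule nint_dist_le)
  also have "y - \<gamma> - of_int (m - \<lfloor>\<gamma>\<rfloor>) = (y - real g / 2 ^ l - of_int m) - (frac \<gamma> - real g / 2 ^ l)"
    by (simp add: frac_def)
  also have "\<bar>\<dots>\<bar> \<le> \<bar>y - real g / 2 ^ l - of_int m\<bar> + \<bar>frac \<gamma> - real g / 2 ^ l\<bar>" by (rule abs_triangle_ineq4)
  also have "\<bar>y - real g / 2 ^ l - of_int m\<bar> \<le> 2 / 2 ^ l"
    using assms(1) by (simp add: nint_dist_eq_round m_def)
  finally show ?thesis using g by simp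
qed

lemma doubling_growth:
  fixes S :: "nat \<Rightarrow> nat"
  assumes "\<And>k. 2 * S k \<le> S (Suc k)"
  shows "2 ^ j * S k \<le> S (k + j)"
proof (induction j)
  case (Suc j)
  then show ?case using assms[of "k + j"] by simp
qed simp

text \<open>
  Stage \<open>\<sigma>\<close> treats the sequence \<open>fst (prod_decode \<sigma>)\<close>, so every sequence is treated infinitely often. With
  \<open>l = lam \<sigma>\<close>, the \<open>2 ^ l\<close> points of the grid of mesh \<open>1 / 2 ^ l\<close> are hit at the indices \<open>4 ^ l + g * 2 ^ l\<close>.
  This uses about \<open>l * 2 ^ l\<close> forced digits among the first \<open>4 ^ l\<close>, a negligible proportion.
\<close>

theorem hausdorff_dense_orbits:
  fixes S :: "nat \<Rightarrow> nat \<Rightarrow> nat" and s :: real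
  assumes S: "\<And>i k. 2 * S i k \<le> S i (Suc k)" "\<And>i. 1 \<le> S i 0" and s: "0 < s" "s < 1"
  shows "\<exists>G. G \<subseteq> Bad \<inter> {0..1} \<and> 0 < hausdorff_premeasure s (1/2) G \<and>
    (\<forall>\<beta>\<in>G. \<forall>i N. \<exists>l\<ge>N. \<forall>\<gamma>. \<exists>k\<in>{4 ^ l..2 * 4 ^ l}. nint_dist (real (S i k) * \<beta> - \<gamma>) \<le> 3 / 2 ^ l)"
proof -
  define s' where "s' = (s + 1) / 2"
  have s': "s < s'" "s' < 1" using s by (auto simp: s'_def)
  define c where "c = 2 powr (1 - s')"
  have c: "1 < c" using s' by (simp add: c_def)
  \<comment> \<open>M0 is large enough for the gain c from halving a cylinder to outweigh the loss
    of the digits above M; 611 is what \<open>cf_hitting_word\<close> asks for.\<close>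
  obtain M0 :: nat where M0: "2 / (1 - 1 / c) \<le> real M0" using real_arch_simple by blast
  define M where "M = max 611 M0"
  have M: "611 \<le> M" by (simp add: M_def)
  have Mc: "1 \<le> (1 - 2 / (real M + 1)) * 2 powr (1 - s')"
  proof -
    have p: "0 < 1 - 1 / c" using c by simp
    have "2 / (1 - 1 / c) \<le> real M + 1" using M0 by (simp add: M_def)
    then have "2 / (real M + 1) \<le> 1 - 1 / c" using p by (simp add: field_simps)
    then have "1 / c \<le> 1 - 2 / (real M + 1)" by simp
    then show ?thesis using c by (simp add: c_def field_simps)
  qed
  define \<kappa> where "\<kappa> = M + 1"
  have \<kappa>: "real M + 1 \<le> 2 ^ \<kappa>"
  proof -
    have "M + 1 \<le> 2 ^ (M + 1)" by (rule less_imp_le[OF less_exp])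
    then show ?thesis unfolding \<kappa>_def by (metis of_nat_1 of_nat_add of_nat_le_iff of_nat_numeral of_nat_power)
  qed
  \<comment> \<open>Requirements on a stage. If b bounds the multipliers of an earlier stage, the
    first lets their blocks end before this stage begins. The second makes the growth of S over 2^l
    indices exceed that of the denominator during a block. The third gives thresholds of logarithm
    at least 4^l / 4, the fourth is for \<open>cf_hitting_word\<close>, and the last fits the
    overshoot (M + 1)^2 of a crossing into 2^l.\<close>
  have "\<exists>l0. \<forall>l\<ge>l0. b + 152 * l + \<kappa> * (322 * l + 4) \<le> 4 ^ l \<and> \<kappa> * (322 * l + 4) \<le> 2 ^ l \<and> 304 * l \<le> 4 ^ l \<and> 8 \<le> l \<and> 2 * \<kappa> \<le> l" for b
  proof (intro exI allI impI)
    fix l assume l: "(152 + 322 * \<kappa> + 304) + (b + 4 * \<kappa>) + 4 \<le> l"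
    have "(152 + 322 * \<kappa> + 304) * l + (b + 4 * \<kappa>) \<le> 2 ^ l" using l by (rule linear_le_power2)
    then have *: "152 * l + 322 * \<kappa> * l + 304 * l + b + 4 * \<kappa> \<le> 2 ^ l" by (simp add: algebra_simps)
    moreover have "(2::nat) ^ l \<le> 4 ^ l" by (intro power_mono) auto
    moreover have "\<kappa> * (322 * l + 4) = 322 * \<kappa> * l + 4 * \<kappa>" by (simp add: algebra_simps)
    ultimately show "b + 152 * l + \<kappa> * (322 * l + 4) \<le> 4 ^ l \<and> \<kappa> * (322 * l + 4) \<le> 2 ^ l \<and> 304 * l \<le> 4 ^ l \<and> 8 \<le> l \<and> 2 * \<kappa> \<le> l"
      using l by linarith
  qed
  then obtain thr where thr: "\<And>b l. thr b \<le> l \<Longrightarrow> b + 152 * l + \<kappa> * (322 * l + 4) \<le> 4 ^ l"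
    "\<And>b l. thr b \<le> l \<Longrightarrow> \<kappa> * (322 * l + 4) \<le> 2 ^ l \<and> 304 * l \<le> 4 ^ l \<and> 8 \<le> l \<and> 2 * \<kappa> \<le> l"
    by metis
  define idx where "idx \<sigma> = fst (prod_decode \<sigma>)" for \<sigma>
  \<comment> \<open>S may grow arbitrarily fast, so the next l is chosen only after the largest
    multiplier of the current stage is known, which is S at index 2 * 4^l.\<close>
  define lam where "lam = rec_nat (thr 0) (\<lambda>\<sigma> l. max (Suc l) (thr (S (idx \<sigma>) (2 * 4 ^ l))))"
  have lam: "lam 0 = thr 0" "lam (Suc \<sigma>) = max (Suc (lam \<sigma>)) (thr (S (idx \<sigma>) (2 * 4 ^ lam \<sigma>)))" for \<sigma>
    by (simp_all add: lam_def)
  have lam_mono: "strict_mono lam" by (rule strict_mono_Suc_iff[THEN iffD2]) (simp add: lam less_max_iff_disj)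
  have lam_ge: "thr 0 \<le> lam \<sigma>" for \<sigma> using strict_mono_less_eq[OF lam_mono, of 0 \<sigma>] by (simp add: lam)
  have lam_next: "thr (S (idx \<sigma>) (2 * 4 ^ lam \<sigma>)) \<le> lam \<sigma>'" if "\<sigma> < \<sigma>'" for \<sigma> \<sigma>'
  proof -
    have "lam (Suc \<sigma>) \<le> lam \<sigma>'" using strict_mono_less_eq[OF lam_mono, of "Suc \<sigma>" \<sigma>'] that by simp
    then show ?thesis by (simp add: lam)
  qed
  note basic = thr(2)[OF lam_ge]
  define I where "I = {(\<sigma>, g). g < (2::nat) ^ lam \<sigma>}"
  define ix where "ix t = (4::nat) ^ lam (fst t) + snd t * 2 ^ lam (fst t)" for t :: "nat \<times> nat"
  define n where "n t = S (idx (fst t)) (ix t)" for t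
  \<comment> \<open>Past this threshold n / q^2 is below 2^(152 l), and by the bounded overshoot it
    is still at least 2^(151 l): the window of \<open>cf_hitting_word\<close>.\<close>
  define Z where "Z t = real (n t) / 2 ^ (152 * lam (fst t))" for t
  define L where "L t = 161 * lam (fst t) + 1" for t :: "nat \<times> nat"
  define good where "good t p u \<longleftrightarrow> u \<in> words M (L t) \<and>
    (\<forall>x\<in>{0..1}. nint_dist (real (n t) * cf (p @ u) x - real (snd t) / 2 ^ lam (fst t)) \<le> 2 / 2 ^ lam (fst t))" for t p u
  define blk where "blk t p = (SOME u. good t p u)" for t p
  have S_low: "2 ^ k \<le> S i k" for i k
    using doubling_growth[of "S i" k 0] S(2)[of i] S(1) by (metis add_0 le_trans mult.right_neutral mult_le_mono2)
  have S_mono: "S i k \<le> S i k'" if "k \<le> k'" for i k k'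
    using lift_Suc_mono_le[of "S i" k k'] S(1) that by (metis le_add2 le_trans mult_2)
  have ix_bounds: "4 ^ lam (fst t) \<le> ix t" "t \<in> I \<Longrightarrow> ix t \<le> 2 * 4 ^ lam (fst t)" for t
  proof -
    show "4 ^ lam (fst t) \<le> ix t" by (simp add: ix_def)
    assume "t \<in> I"
    then have "snd t * 2 ^ lam (fst t) \<le> 2 ^ lam (fst t) * 2 ^ lam (fst t)"
      by (intro mult_right_mono) (auto simp: I_def)
    then show "ix t \<le> 2 * 4 ^ lam (fst t)" by (simp add: ix_def flip: power_mult_distrib)
  qed
  have n_low: "2 ^ (4 ^ lam (fst t)) \<le> real (n t)" for t
  proof -
    have "(2::nat) ^ (4 ^ lam (fst t)) \<le> 2 ^ ix t" using ix_bounds by (intro power_increasing) auto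
    also have "\<dots> \<le> n t" unfolding n_def by (rule S_low)
    finally show ?thesis by (metis of_nat_le_iff of_nat_numeral of_nat_power)
  qed
  have blk_good: "good t p (blk t p)" if t: "t \<in> I" and p: "set p \<subseteq> {1..M}" "crossing (Z t) p" for t p
  proof -
    let ?l = "lam (fst t)"
    have nz: "0 \<notin> set p" using p by auto
    have d: "0 < (den1 p)\<^sup>2" using den1_ge_1[OF nz] by simp
    have up: "real (n t) / (den1 p)\<^sup>2 \<le> 2 ^ (152 * ?l)"
    proof -
      have "real (n t) / 2 ^ (152 * ?l) < (den1 p)\<^sup>2" using p by (simp add: crossing_def Z_def)
      then show ?thesis using d by (simp add: field_simps)
    qed
    have "(real M + 1)\<^sup>2 \<le> (2 ^ \<kappa>)\<^sup>2" using \<kappa> by (intro power_mono) auto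
    also have "\<dots> = 2 ^ (2 * \<kappa>)" by (simp add: mult.commute flip: power_mult)
    also have "\<dots> \<le> 2 ^ ?l" using basic by (intro power_increasing) auto
    finally have M2: "(real M + 1)\<^sup>2 \<le> 2 ^ ?l" .
    have "(den1 p)\<^sup>2 \<le> (real M + 1)\<^sup>2 * Z t" by (rule crossing_den_le[OF p(2,1)])
    also have "\<dots> \<le> 2 ^ ?l * Z t" using M2 by (intro mult_right_mono) (auto simp: Z_def)
    also have "\<dots> = real (n t) / 2 ^ (151 * ?l)"
    proof -
      have "(2::real) ^ (152 * ?l) = 2 ^ ?l * 2 ^ (151 * ?l)" by (simp flip: power_add)
      then show ?thesis by (simp add: Z_def)
    qed
    finally have low: "2 ^ (151 * ?l) \<le> real (n t) / (den1 p)\<^sup>2" using d by (simp add: field_simps)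
    obtain u where "u \<in> words M (161 * ?l + 1)"
      "\<forall>x\<in>{0..1}. nint_dist (real (n t) * cf (p @ u) x - real (snd t) / 2 ^ ?l) \<le> 2 / 2 ^ ?l"
      using cf_hitting_word[OF M _ nz low up, of "real (snd t) / 2 ^ ?l"] basic by blast
    then have "good t p u" by (simp add: good_def L_def)
    then show ?thesis unfolding blk_def by (rule someI)
  qed
  have block_growth: "(real M + 1) ^ (2 * (L t + 1)) \<le> 2 ^ (\<kappa> * (322 * lam (fst t) + 4))" for t
  proof -
    have "(real M + 1) ^ (2 * (L t + 1)) \<le> (2 ^ \<kappa>) ^ (2 * (L t + 1))" using \<kappa> by (intro power_mono) auto
    also have "\<dots> = (2 ^ \<kappa>) ^ (322 * lam (fst t) + 4)"
      by (rule arg_cong[where f = "power _"]) (simp add: L_def)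
    also have "\<dots> = 2 ^ (\<kappa> * (322 * lam (fst t) + 4))" by (simp only: power_mult)
    finally show ?thesis .
  qed
  have order: "(real M + 1) ^ (2 * (L t + 1)) * Z t \<le> Z t'"
    if t: "t \<in> I" "t' \<in> I" and lt: "fst t < fst t' \<or> fst t = fst t' \<and> snd t < snd t'" for t t'
    using lt
  proof
    assume lt: "fst t < fst t'"
    let ?l = "lam (fst t)" and ?l' = "lam (fst t')"
    define b where "b = S (idx (fst t)) (2 * 4 ^ ?l)"
    have "n t \<le> b" unfolding n_def b_def using t ix_bounds by (intro S_mono) auto
    also have "b \<le> 2 ^ b" by (rule less_imp_le[OF less_exp])
    finally have nb: "real (n t) \<le> 2 ^ b" by (metis of_nat_le_iff of_nat_numeral of_nat_power)
    have "?l \<le> ?l'" using strict_mono_less_eq[OF lam_mono] lt by simp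
    have "Z t \<le> real (n t) / 1" unfolding Z_def by (intro divide_left_mono) auto
    then have Zb: "Z t \<le> 2 ^ b" using nb by (simp only: div_by_1)
    have "0 \<le> Z t" by (simp add: Z_def)
    then have "(real M + 1) ^ (2 * (L t + 1)) * Z t \<le> 2 ^ (\<kappa> * (322 * ?l + 4)) * 2 ^ b"
      using block_growth[of t] Zb by (intro mult_mono) simp_all
    also have "\<dots> \<le> 2 ^ (\<kappa> * (322 * ?l' + 4)) * 2 ^ b"
      using \<open>?l \<le> ?l'\<close> by (intro mult_right_mono power_increasing mult_left_mono) auto
    also have "\<dots> = 2 ^ (b + 152 * ?l' + \<kappa> * (322 * ?l' + 4)) / 2 ^ (152 * ?l')"
      by (simp add: power_add)
    also have "\<dots> \<le> 2 ^ (4 ^ ?l') / 2 ^ (152 * ?l')"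
      using thr(1)[OF lam_next[OF lt]] by (intro divide_right_mono power_increasing) (auto simp: b_def)
    also have "\<dots> \<le> Z t'" unfolding Z_def using n_low[of t'] by (intro divide_right_mono) auto
    finally show ?thesis .
  next
    assume e: "fst t = fst t' \<and> snd t < snd t'"
    let ?l = "lam (fst t)"
    obtain j where j: "snd t' = snd t + j" "1 \<le> j"
      using e by (metis less_imp_add_positive Suc_leI One_nat_def)
    have k: "ix t' = ix t + j * 2 ^ ?l" using e by (simp add: ix_def j(1) distrib_right)
    have "(2::nat) ^ (\<kappa> * (322 * ?l + 4)) \<le> 2 ^ (j * 2 ^ ?l)"
    proof (intro power_increasing)
      have "\<kappa> * (322 * ?l + 4) \<le> 1 * 2 ^ ?l" using basic by simp
      also have "\<dots> \<le> j * 2 ^ ?l" using j(2) by (rule mult_le_mono1)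
      finally show "\<kappa> * (322 * ?l + 4) \<le> j * 2 ^ ?l" .
    qed simp
    then have "2 ^ (\<kappa> * (322 * ?l + 4)) * n t \<le> 2 ^ (j * 2 ^ ?l) * n t" by (rule mult_le_mono1)
    also have "\<dots> \<le> S (idx (fst t)) (ix t + j * 2 ^ ?l)"
      unfolding n_def by (rule doubling_growth) (rule S(1))
    also have "\<dots> = n t'" using e by (simp add: n_def k)
    finally have le: "2 ^ (\<kappa> * (322 * ?l + 4)) * n t \<le> n t'" .
    have "2 ^ (\<kappa> * (322 * ?l + 4)) * real (n t) \<le> real (n t')"
      using of_nat_mono[OF le, where 'a = real] unfolding of_nat_mult of_nat_power of_nat_numeral .
    moreover have "(real M + 1) ^ (2 * (L t + 1)) * real (n t) \<le> 2 ^ (\<kappa> * (322 * ?l + 4)) * real (n t)"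
      using block_growth by (intro mult_right_mono) auto
    ultimately show ?thesis using e by (simp add: Z_def divide_right_mono)
  qed
  have Z_low: "2 ^ lam (fst t) \<le> Z t \<and> 4 ^ lam (fst t) \<le> 4 * ln (Z t)" for t
  proof -
    let ?l = "lam (fst t)"
    have h: "304 * ?l \<le> 4 ^ ?l" "8 \<le> ?l" using basic by auto
    have "(2::real) ^ (4 ^ ?l - 152 * ?l) * 2 ^ (152 * ?l) = 2 ^ (4 ^ ?l)"
      using h by (simp flip: power_add)
    then have "2 ^ (4 ^ ?l - 152 * ?l) = 2 ^ (4 ^ ?l) / (2::real) ^ (152 * ?l)" by (simp add: field_simps)
    also have "\<dots> \<le> Z t" unfolding Z_def using n_low[of t] by (intro divide_right_mono) auto
    finally have 1: "2 ^ (4 ^ ?l - 152 * ?l) \<le> Z t" .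
    have "(2::real) ^ ?l \<le> 2 ^ (4 ^ ?l - 152 * ?l)" using h by (intro power_increasing) auto
    moreover have "4 ^ ?l \<le> 4 * ln (Z t)"
    proof -
      have "ln (2 ^ (4 ^ ?l - 152 * ?l)) \<le> ln (Z t)"
        using 1 by (subst ln_le_cancel_iff) (auto intro: less_le_trans[of 0 "2 ^ (4 ^ ?l - 152 * ?l)"])
      then have a: "real (4 ^ ?l - 152 * ?l) * ln 2 \<le> ln (Z t)" by (simp add: ln_realpow)
      have "real (4 ^ ?l - 152 * ?l) = 4 ^ ?l - 152 * real ?l" using h by (simp add: of_nat_diff)
      moreover have "304 * real ?l \<le> 4 ^ ?l"
        using of_nat_mono[OF h(1), where 'a = real] unfolding of_nat_mult of_nat_power of_nat_numeral .
      ultimately have b: "4 ^ ?l / 2 \<le> real (4 ^ ?l - 152 * ?l)" by simp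
      have "4 ^ ?l / 2 * (1/2) \<le> real (4 ^ ?l - 152 * ?l) * ln 2"
        using b ln2_ge_two_thirds by (intro mult_mono) auto
      then show ?thesis using a by simp
    qed
    ultimately show ?thesis using 1 by linarith
  qed
  have count: "\<exists>C. \<forall>X\<ge>1. finite {t \<in> I. Z t < X} \<and> (\<Sum>t | t \<in> I \<and> Z t < X. real (L t)) \<le> \<zeta> * ln X + C"
    if \<zeta>: "0 < \<zeta>" for \<zeta>
  proof -
    have "0 < \<zeta> / 4" using \<zeta> by simp
    from block_length_sum_sparse[OF this] obtain C where C: "\<forall>Y A. finite A \<longrightarrow> 0 \<le> Y \<longrightarrow>
      (\<forall>l\<in>A. (4::real) ^ l < Y) \<longrightarrow> (\<Sum>l\<in>A. 2 ^ l * (161 * real l + 1)) \<le> \<zeta> / 4 * Y + C" ..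
    have "finite {t \<in> I. Z t < X} \<and> (\<Sum>t | t \<in> I \<and> Z t < X. real (L t)) \<le> \<zeta> * ln X + C" if X: "1 \<le> X" for X
    proof -
      \<comment> \<open>By \<open>Z_low\<close>, only these stages can contain a threshold below
        X.\<close>
      define B where "B = {\<sigma>. 4 ^ lam \<sigma> < 4 * ln X}"
      have "finite B"
      proof -
        obtain N where N: "4 * ln X < 4 ^ N" using real_arch_pow[of 4 "4 * ln X"] by auto
        have "B \<subseteq> {..N}"
        proof
          fix \<sigma> assume "\<sigma> \<in> B"
          then have "(4::real) ^ lam \<sigma> < 4 ^ N" using N unfolding B_def mem_Collect_eq by linarith
          then have "lam \<sigma> < N" by (rule power_less_imp_less_exp[rotated]) simp
          then show "\<sigma> \<in> {..N}" using strict_mono_imp_increasing[OF lam_mono, of \<sigma>] by simp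
        qed
        then show ?thesis using finite_subset by blast
      qed
      have sub: "{t \<in> I. Z t < X} \<subseteq> (SIGMA \<sigma>:B. {..<2 ^ lam \<sigma>})"
      proof clarify
        fix \<sigma> g assume t: "(\<sigma>, g) \<in> I" "Z (\<sigma>, g) < X"
        have "ln (Z (\<sigma>, g)) < ln X"
          using t Z_low[of "(\<sigma>, g)"] X by (subst ln_less_cancel_iff) (auto intro: less_le_trans[of 0 "2 ^ lam \<sigma>"])
        then show "\<sigma> \<in> B \<and> g \<in> {..<2 ^ lam \<sigma>}"
          using Z_low[of "(\<sigma>, g)"] t by (auto simp: B_def I_def)
      qed
      have fin: "finite (SIGMA \<sigma>:B. {..<(2::nat) ^ lam \<sigma>})" using \<open>finite B\<close> by auto
      have "(\<Sum>t | t \<in> I \<and> Z t < X. real (L t)) \<le> (\<Sum>t\<in>(SIGMA \<sigma>:B. {..<2 ^ lam \<sigma>}). real (L t))"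
        using sub fin by (intro sum_mono2) auto
      also have "\<dots> = (\<Sum>\<sigma>\<in>B. \<Sum>g<2 ^ lam \<sigma>. real (L (\<sigma>, g)))"
        using \<open>finite B\<close> by (subst sum.Sigma) (auto simp: case_prod_unfold)
      also have "\<dots> = (\<Sum>\<sigma>\<in>B. 2 ^ lam \<sigma> * (161 * real (lam \<sigma>) + 1))" by (simp add: L_def algebra_simps)
      also have "\<dots> = (\<Sum>l\<in>lam ` B. 2 ^ l * (161 * real l + 1))"
        using strict_mono_imp_inj_on[OF lam_mono] by (subst sum.reindex) (auto intro: inj_on_subset)
      also have "\<dots> \<le> \<zeta> / 4 * (4 * ln X) + C"
        using \<open>finite B\<close> X by (intro C[rule_format]) (auto simp: B_def)
      finally show ?thesis using finite_subset[OF sub fin] by simp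
    qed
    then show ?thesis by blast
  qed
  interpret block_tasks M I Z L blk
  proof
    show "1 \<le> M" using M by simp
    show "1 \<le> Z t" for t using Z_low[of t] one_le_power[of "2::real" "lam (fst t)"] by linarith
    show "blk t p \<in> words M (L t)" if "t \<in> I" "set p \<subseteq> {1..M}" "crossing (Z t) p" for t p
      using blk_good[OF that] by (simp add: good_def)
    show "(real M + 1) ^ (2 * (L t + 1)) * Z t \<le> Z t' \<or> (real M + 1) ^ (2 * (L t' + 1)) * Z t' \<le> Z t"
      if "t \<in> I" "t' \<in> I" "t \<noteq> t'" for t t'
    proof -
      have "(fst t < fst t' \<or> fst t = fst t' \<and> snd t < snd t') \<or> (fst t' < fst t \<or> fst t' = fst t \<and> snd t' < snd t)"
        using that(3) by (auto simp: prod_eq_iff)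
      then show ?thesis using order[OF that(1,2)] order[OF that(2,1)] by blast
    qed
  qed (rule count)
  obtain G where G: "G \<subseteq> Bad \<inter> {0..1}" "0 < hausdorff_premeasure s (1/2) G"
    "\<And>\<beta> t. \<beta> \<in> G \<Longrightarrow> t \<in> I \<Longrightarrow> \<exists>p. set p \<subseteq> {1..M} \<and> crossing (Z t) p \<and> (\<exists>x\<in>{0..1}. \<beta> = cf (p @ blk t p) x)"
    using block_tasks_hausdorff[OF s(1) s' Mc] by blast
  have "\<exists>l\<ge>N. \<forall>\<gamma>. \<exists>k\<in>{4 ^ l..2 * 4 ^ l}. nint_dist (real (S i k) * \<beta> - \<gamma>) \<le> 3 / 2 ^ l" if \<beta>: "\<beta> \<in> G" for \<beta> i N
  proof (intro exI conjI allI)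
    \<comment> \<open>This stage treats sequence i, and its parameter satisfies
      \<open>lam \<sigma> \<ge> \<sigma> \<ge> N\<close>.\<close>
    define \<sigma> where "\<sigma> = prod_encode (i, N)"
    have idx: "idx \<sigma> = i" by (simp add: idx_def \<sigma>_def)
    have "N \<le> \<sigma>" unfolding \<sigma>_def by (rule le_prod_encode_2)
    also have "\<dots> \<le> lam \<sigma>" by (rule strict_mono_imp_increasing[OF lam_mono])
    finally show "N \<le> lam \<sigma>" .
    fix \<gamma> :: real
    define g where "g = nat \<lfloor>2 ^ lam \<sigma> * frac \<gamma>\<rfloor>"
    have "2 ^ lam \<sigma> * frac \<gamma> < 2 ^ lam \<sigma>" using frac_lt_1[of \<gamma>] by simp
    then have "\<lfloor>2 ^ lam \<sigma> * frac \<gamma>\<rfloor> < 2 ^ lam \<sigma>" by (simp add: floor_less_iff)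
    then have "g < 2 ^ lam \<sigma>" unfolding g_def by (subst nat_less_iff) auto
    then have t: "(\<sigma>, g) \<in> I" by (simp add: I_def)
    obtain p x where p: "set p \<subseteq> {1..M}" "crossing (Z (\<sigma>, g)) p" "x \<in> {0..1}" "\<beta> = cf (p @ blk (\<sigma>, g) p) x"
      using G(3)[OF \<beta> t] by blast
    have "nint_dist (real (n (\<sigma>, g)) * \<beta> - real g / 2 ^ lam \<sigma>) \<le> 2 / 2 ^ lam \<sigma>"
      using blk_good[OF t p(1,2)] p(3,4) by (simp add: good_def)
    then have "nint_dist (real (n (\<sigma>, g)) * \<beta> - \<gamma>) \<le> 3 / 2 ^ lam \<sigma>"
      by (rule nint_dist_grid) (rule g_def)
    then show "\<exists>k\<in>{4 ^ lam \<sigma>..2 * 4 ^ lam \<sigma>}. nint_dist (real (S i k) * \<beta> - \<gamma>) \<le> 3 / 2 ^ lam \<sigma>"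
      using ix_bounds[of "(\<sigma>, g)"] t by (intro bexI[of _ "ix (\<sigma>, g)"]) (auto simp: n_def idx)
  qed
  then show ?thesis using G by blast
qed

section \<open>Good denominators and Hausdorff dimension one\<close>

lemma den_Nats: "den1 w \<in> \<nat> \<and> den2 w \<in> \<nat>"
  by (induction w rule: rev_induct) auto

text \<open>The numerator of the Moebius map has integer coefficients; both are carried along
  because appending a digit mixes them. At x = 0 this makes \<open>cf w 0 * den1 w\<close> an
  integer.\<close>

lemma cf_numerator_Ints:
  assumes "0 \<notin> set w"
  shows "\<exists>P P' :: int. \<forall>x\<ge>0. cf w x * (den1 w + den2 w * x) = of_int P + of_int P' * x"
  using assms
proof (induction w rule: rev_induct)
  case Nil
  show ?case by (rule exI[of _ 0], rule exI[of _ 1]) simp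
next
  case (snoc a w)
  then obtain P P' :: int where IH: "\<And>x. 0 \<le> x \<Longrightarrow> cf w x * (den1 w + den2 w * x) = of_int P + of_int P' * x"
    by auto
  have "cf (w @ [a]) x * (den1 (w @ [a]) + den2 (w @ [a]) * x) = of_int (int a * P + P') + of_int P * x"
    if x: "0 \<le> x" for x
  proof -
    have "a \<noteq> 0" using snoc.prems by auto
    then have p: "0 < real a + x" using x by simp
    have "den1 (w @ [a]) + den2 (w @ [a]) * x = (real a + x) * (den1 w + den2 w * (1 / (real a + x)))"
      using p by (simp add: field_simps)
    moreover have "cf (w @ [a]) x = cf w (1 / (real a + x))" by (simp add: cf_append)
    ultimately have "cf (w @ [a]) x * (den1 (w @ [a]) + den2 (w @ [a]) * x)
      = (real a + x) * (cf w (1 / (real a + x)) * (den1 w + den2 w * (1 / (real a + x))))"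
      by (simp only: mult_ac)
    also have "\<dots> = (real a + x) * (of_int P + of_int P' * (1 / (real a + x)))"
      using IH[of "1 / (real a + x)"] p by simp
    also have "\<dots> = of_int (int a * P + P') + of_int P * x" using p by (simp add: field_simps)
    finally show ?thesis .
  qed
  then show ?case by blast
qed

text \<open>Every other convergent denominator; these at least double.\<close>

lemma Bad_good_denominators:
  assumes "\<alpha> \<in> Bad"
  obtains S :: "nat \<Rightarrow> nat" and C :: real where
    "\<And>k. 2 * S k \<le> S (Suc k)" "1 \<le> S 0" "1 < C" "\<And>k. real (S k) \<le> C ^ k"
    "\<And>k. real (S k) * nint_dist (real (S k) * \<alpha>) \<le> 1"
proof -
  obtain M0 where irr: "\<alpha> \<notin> \<rat>" and M0: "\<And>n. partial_quotient \<alpha> n \<le> M0"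
    using assms by (auto simp: Bad_def)
  define M where "M = nat M0"
  define x where "x n = complete_quotient \<alpha> n" for n
  have x_irr: "x n \<notin> \<rat>" for n
  proof (induction n)
    case (Suc n)
    show ?case
    proof
      assume "x (Suc n) \<in> \<rat>"
      then have "inverse (x (Suc n)) \<in> \<rat>" by (rule Rats_inverse)
      then have "frac (x n) \<in> \<rat>" by (simp add: x_def inverse_eq_divide)
      then have "frac (x n) + of_int \<lfloor>x n\<rfloor> \<in> \<rat>" by (intro Rats_add Rats_of_int)
      then show False using Suc by (simp add: frac_def)
    qed
  qed (simp add: x_def irr)
  have fr: "0 < frac (x n)" "frac (x n) < 1" for n
  proof -
    have "x n \<notin> \<int>" using x_irr[of n] Ints_subset_Rats by blast
    then show "0 < frac (x n)" by simp
  qed (rule frac_lt_1)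
  define b where "b n = nat \<lfloor>x (Suc n)\<rfloor>" for n
  have x1: "1 < x (Suc n)" for n using fr[of n] by (simp add: x_def)
  have b1: "1 \<le> b n" for n using x1[of n] by (simp add: b_def le_nat_iff)
  have bM: "b n \<in> {1..M}" for n
    using b1[of n] M0[of "Suc n"] by (auto simp: b_def M_def partial_quotient_def x_def intro: nat_mono)
  have xb: "x (Suc n) = real (b n) + frac (x (Suc n))" for n
    using x1[of n] by (simp add: b_def frac_def)
  have frac_step: "frac (x n) = 1 / (real (b n) + frac (x (Suc n)))" for n
    unfolding xb[symmetric] by (simp add: x_def)
  \<comment> \<open>The tail after m digits is the fractional part of the m-th complete
    quotient.\<close>
  have cf: "frac \<alpha> = cf (pre b m) (frac (x m))" for m
  proof (induction m)
    case (Suc m)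
    then show ?case using frac_step[of m] by (simp add: pre_Suc cf_append)
  qed (simp add: x_def)
  have nz: "0 \<notin> set (pre b m)" for m using b1 by (rule pre_nonzero)
  define S where "S k = nat \<lfloor>den1 (pre b (2 * k))\<rfloor>" for k
  have S: "real (S k) = den1 (pre b (2 * k))" for k
    using den_Nats[of "pre b (2 * k)"] by (auto simp: S_def elim!: Nats_cases)
  have "2 * S k \<le> S (Suc k)" for k
  proof -
    let ?w = "pre b (2 * k)"
    have d: "1 \<le> den1 ?w" "0 \<le> den2 ?w" using den_bounds[OF nz] by auto
    have m: "u \<le> real (b n) * u" if "0 \<le> u" for u n
      using mult_right_mono[of 1 "real (b n)" u] b1[of n] that by simp
    have e: "pre b (2 * Suc k) = (?w @ [b (2 * k)]) @ [b (Suc (2 * k))]" by (simp add: pre_Suc)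
    have "den1 (pre b (2 * Suc k)) = real (b (Suc (2 * k))) * (real (b (2 * k)) * den1 ?w + den2 ?w) + den1 ?w"
      unfolding e den_snoc ..
    moreover have "den1 ?w \<le> real (b (2 * k)) * den1 ?w" using d by (intro m) auto
    moreover have "real (b (2 * k)) * den1 ?w + den2 ?w \<le> real (b (Suc (2 * k))) * (real (b (2 * k)) * den1 ?w + den2 ?w)"
      using d by (intro m) auto
    ultimately have "2 * den1 ?w \<le> den1 (pre b (2 * Suc k))" using d by linarith
    then have "real (2 * S k) \<le> real (S (Suc k))" using S by simp
    then show ?thesis by (simp only: of_nat_le_iff)
  qed
  moreover have "1 \<le> S 0" by (simp add: S_def)
  moreover have "1 < (real M + 1)\<^sup>2" using bM[of 0] by (intro one_less_power) auto
  moreover have "real (S k) \<le> ((real M + 1)\<^sup>2) ^ k" for k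
    using den1_append_le[of "[]" "pre b (2 * k)" M] set_pre[of b "{1..M}", OF bM] S
    by (simp add: power_mult)
  moreover have "real (S k) * nint_dist (real (S k) * \<alpha>) \<le> 1" for k
  proof -
    let ?w = "pre b (2 * k)" and ?t = "frac (x (2 * k))"
    have q: "1 \<le> den1 ?w" using den1_ge_1[OF nz] .
    obtain P P' :: int where "\<And>x. 0 \<le> x \<Longrightarrow> cf ?w x * (den1 ?w + den2 ?w * x) = of_int P + of_int P' * x"
      using cf_numerator_Ints[OF nz] by blast
    from this[of 0] have P: "cf ?w 0 * den1 ?w = of_int P" by simp
    have t: "0 \<le> ?t" "?t \<le> 1" using fr[of "2 * k"] by auto
    \<comment> \<open>P is the numerator of the convergent of \<open>frac \<alpha>\<close>; the
      other summand restores the integer part of \<alpha>.\<close>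
    have "nint_dist (real (S k) * \<alpha>) \<le> \<bar>real (S k) * \<alpha> - of_int (int (S k) * \<lfloor>\<alpha>\<rfloor> + P)\<bar>" by (rule nint_dist_le)
    also have "real (S k) * \<alpha> - of_int (int (S k) * \<lfloor>\<alpha>\<rfloor> + P) = den1 ?w * (frac \<alpha> - cf ?w 0)"
      using P by (simp add: frac_def S algebra_simps)
    also have "\<bar>\<dots>\<bar> = den1 ?w * \<bar>cf ?w ?t - cf ?w 0\<bar>" using q cf[of "2 * k"] by (simp add: abs_mult)
    also have "\<dots> \<le> den1 ?w * (\<bar>?t - 0\<bar> / (den1 ?w)\<^sup>2)"
      using q t by (intro mult_left_mono cf_diff_le nz) auto
    also have "\<dots> \<le> den1 ?w * (1 / (den1 ?w)\<^sup>2)" using q t by (intro mult_left_mono divide_right_mono) auto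
    also have "\<dots> = 1 / real (S k)" using q by (simp add: S power2_eq_square)
    finally show ?thesis using q S[of k] by (simp add: field_simps)
  qed
  ultimately show ?thesis by (rule that)
qed

section \<open>Pseudo-absolute values along their own sequence\<close>

lemma pseudo_abs_nonneg:
  assumes "pseudo_abs_seq D"
  shows "0 \<le> pseudo_abs D q"
  unfolding pseudo_abs_def
proof (rule cInf_greatest)
  have "int (D 0) dvd q" using assms by (simp add: pseudo_abs_seq_def)
  then show "{1 / real (D k) | k. int (D k) dvd q} \<noteq> {}" by blast
qed auto

lemma pseudo_abs_self_le:
  assumes "pseudo_abs_seq D"
  shows "real (D k) * pseudo_abs D (int (D k)) \<le> 1"
proof -
  have "pseudo_abs D (int (D k)) \<le> 1 / real (D k)"
    unfolding pseudo_abs_def by (rule cInf_lower) (auto intro!: bdd_belowI[of _ 0])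
  moreover have "0 < real (D k)" using assms by (simp add: pseudo_abs_seq_def)
  ultimately show ?thesis by (simp add: field_simps)
qed

text \<open>Strict monotonicity rules out the quotient 1 in the divisibility, so the quotient is at
  least 2.\<close>

lemma pseudo_abs_seq_doubling:
  assumes "pseudo_abs_seq D" "strict_mono D"
  shows "2 * D k \<le> D (Suc k)"
proof -
  have "D k dvd D (Suc k)" using assms(1) unfolding pseudo_abs_seq_def by (metis diff_Suc_1 le_add1 plus_1_eq_Suc)
  then obtain m where m: "D (Suc k) = D k * m" by (elim dvdE)
  have "D k < D k * m" using strict_monoD[OF assms(2), of k "Suc k"] m by simp
  then have "2 \<le> m" by (cases m; cases "m - 1") auto
  then have "D k * 2 \<le> D k * m" by (intro mult_left_mono) auto
  then show ?thesis using m by simp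
qed

section \<open>From dense orbits to the inequalities\<close>

lemma log_power_threshold:
  fixes \<epsilon> C :: real
  assumes "0 < \<epsilon>" "1 < C"
  shows "\<exists>N. \<forall>l\<ge>N. \<forall>y. 1 \<le> y \<longrightarrow> y \<le> 2 * 4 ^ l * ln C \<longrightarrow> 3 / 2 ^ l < 1 / y powr (1/2 - \<epsilon>)"
proof -
  \<comment> \<open>For \<epsilon> \<ge> 1/2 the exponent is not positive. The maximum with 1/4
    keeps e positive, so that the power is monotone in its base, and still below 1/2, so that 2^l
    outgrows (4^l)^e.\<close>
  define e where "e = max (1/2 - \<epsilon>) (1/4)"
  have e: "1/2 - \<epsilon> \<le> e" "0 < e" "2 * e < 1" using assms by (auto simp: e_def max_def)
  define r where "r = 2 powr (1 - 2 * e)"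
  have r: "1 < r" using e by (simp add: r_def)
  define K where "K = 3 * (2 * ln C) powr e"
  obtain N where N: "K < r ^ N" using real_arch_pow[OF r] by blast
  have "3 / 2 ^ l < 1 / y powr (1/2 - \<epsilon>)" if l: "N \<le> l" and y: "1 \<le> y" "y \<le> 2 * 4 ^ l * ln C" for l y
  proof -
    have "y powr (1/2 - \<epsilon>) \<le> y powr e" using y e by (intro powr_mono) auto
    also have "\<dots> \<le> (2 * 4 ^ l * ln C) powr e" using y e by (intro powr_mono2) auto
    also have "\<dots> = (2 * ln C) powr e * (4 ^ l) powr e"
      using assms by (simp add: powr_mult mult_ac)
    also have "(4 ^ l :: real) powr e = (2 ^ l) powr (2 * e)"
    proof -
      have "(4::real) ^ l = (2 ^ l) powr 2" by (simp add: power2_eq_square flip: power_mult_distrib)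
      then show ?thesis by (simp only: powr_powr)
    qed
    finally have 1: "3 * y powr (1/2 - \<epsilon>) \<le> K * (2 ^ l) powr (2 * e)" by (simp add: K_def)
    have "r ^ N \<le> r ^ l" using r l by (intro power_increasing) auto
    then have "K < r ^ l" using N by simp
    also have "r ^ l = (2 ^ l) powr (1 - 2 * e)"
      by (simp add: r_def powr_powr mult.commute flip: powr_realpow)
    finally have "K * (2 ^ l) powr (2 * e) < (2 ^ l) powr (1 - 2 * e) * (2 ^ l) powr (2 * e)"
      by (intro mult_strict_right_mono) auto
    also have "\<dots> = 2 ^ l" by (simp flip: powr_add)
    finally have "3 * y powr (1/2 - \<epsilon>) < 2 ^ l" using 1 by linarith
    then show ?thesis using y by (simp add: field_simps)
  qed
  then show ?thesis by blast
qed

text \<open>l comes before \<gamma>: one stage serves all targets, and only the index k depends on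
  the target.\<close>

definition dense_orbit :: "(nat \<Rightarrow> nat) \<Rightarrow> real \<Rightarrow> bool" where
  "dense_orbit S \<beta> \<longleftrightarrow> (\<forall>N. \<exists>l\<ge>N. \<forall>\<gamma>. \<exists>k\<in>{4 ^ l..2 * 4 ^ l}. nint_dist (real (S k) * \<beta> - \<gamma>) \<le> 3 / 2 ^ l)"

lemma dense_orbit_hits:
  fixes S :: "nat \<Rightarrow> nat"
  assumes "dense_orbit S \<beta>" and S: "\<And>k. 2 * S k \<le> S (Suc k)" "1 \<le> S 0"
  shows "\<exists>l\<ge>N. \<exists>k\<in>{4 ^ l..2 * 4 ^ l}. N \<le> S k \<and> 2 ^ k \<le> S k \<and> nint_dist (real (S k) * \<beta> - \<gamma>) \<le> 3 / 2 ^ l"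
proof -
  obtain l k where l: "N \<le> l" "k \<in> {4 ^ l..2 * 4 ^ l}" "nint_dist (real (S k) * \<beta> - \<gamma>) \<le> 3 / 2 ^ l"
    using assms(1) unfolding dense_orbit_def by blast
  have Sk: "2 ^ k \<le> S k"
    using doubling_growth[of S k 0] S by (metis add_0 le_trans mult.right_neutral mult_le_mono2)
  have "N < 4 ^ N" by (rule less_le_trans[OF less_exp power_mono]) auto
  also have "(4::nat) ^ N \<le> 4 ^ l" using l by (intro power_increasing) auto
  also have "\<dots> \<le> k" using l by simp
  also have "k < 2 ^ k" by (rule less_exp)
  also note Sk
  finally show ?thesis using l Sk by (intro exI[of _ l] bexI[of _ k] conjI) auto
qed

text \<open>The weight w stands for the distance of q \<alpha> to the integers as well as for the
  pseudo-absolute value. In both cases q w(q) \<le> 1 along S, so the smallness comes from the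
  factor with \<beta> alone.\<close>

lemma dense_orbit_infinite_solutions:
  fixes S :: "nat \<Rightarrow> nat" and w :: "nat \<Rightarrow> real" and C \<epsilon> :: real
  assumes dense: "dense_orbit S \<beta>" and S: "\<And>k. 2 * S k \<le> S (Suc k)" "1 \<le> S 0"
    and C: "1 < C" "\<And>k. real (S k) \<le> C ^ k" and w: "\<And>k. real (S k) * w (S k) \<le> 1" and \<epsilon>: "0 < \<epsilon>"
  shows "infinite {q. 0 < q \<and> real q * w q * nint_dist (real q * \<beta> - \<gamma>) < 1 / (ln (real q)) powr (1/2 - \<epsilon>)}"
  unfolding infinite_nat_iff_unbounded_le
proof
  fix m
  obtain N where N: "\<And>l y. N \<le> l \<Longrightarrow> 1 \<le> y \<Longrightarrow> y \<le> 2 * 4 ^ l * ln C \<Longrightarrow> 3 / 2 ^ l < 1 / y powr (1/2 - \<epsilon>)"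
    using log_power_threshold[OF \<epsilon> C(1)] by blast
  obtain l k where l: "max (m + 1) N \<le> l" "k \<in> {4 ^ l..2 * 4 ^ l}" "max (m + 1) N \<le> S k" "2 ^ k \<le> S k"
    "nint_dist (real (S k) * \<beta> - \<gamma>) \<le> 3 / 2 ^ l"
    using dense_orbit_hits[OF dense S, of "max (m + 1) N" \<gamma>] by blast
  let ?q = "S k"
  have q: "0 < ?q" using l(3) by simp
  have "(4::nat) ^ 1 \<le> 4 ^ l" using l(1) by (intro power_increasing) auto
  then have k: "4 \<le> k" using l(2) by simp
  have up: "ln (real ?q) \<le> 2 * 4 ^ l * ln C"
  proof -
    have "ln (real ?q) \<le> ln (C ^ k)" using q C by simp
    also have "\<dots> = real k * ln C" using C by (simp add: ln_realpow)
    also have "\<dots> \<le> real (2 * 4 ^ l) * ln C"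
      using l(2) C by (intro mult_right_mono of_nat_mono) auto
    finally show ?thesis by simp
  qed
  \<comment> \<open>A logarithm of at least 1 lets \<open>log_power_threshold\<close> enlarge its
    exponent.\<close>
  have low: "1 \<le> ln (real ?q)"
  proof -
    have "real (2 ^ k) \<le> real ?q" using l(4) by (rule of_nat_mono)
    then have "ln (2 ^ k) \<le> ln (real ?q)" using q by simp
    then have "real k * ln 2 \<le> ln (real ?q)" by (simp add: ln_realpow)
    moreover have "4 * (1/2) \<le> real k * ln 2" using k ln2_ge_two_thirds by (intro mult_mono) auto
    ultimately show ?thesis by linarith
  qed
  have "real ?q * w ?q * nint_dist (real ?q * \<beta> - \<gamma>) \<le> 1 * nint_dist (real ?q * \<beta> - \<gamma>)"
    using w by (intro mult_right_mono) auto
  also have "\<dots> \<le> 3 / 2 ^ l" using l by simp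
  also have "\<dots> < 1 / (ln (real ?q)) powr (1/2 - \<epsilon>)" using l(1) by (intro N low up) auto
  finally show "\<exists>n\<ge>m. n \<in> {q. 0 < q \<and> real q * w q * nint_dist (real q * \<beta> - \<gamma>) < 1 / (ln (real q)) powr (1/2 - \<epsilon>)}"
    using q l(3) by (intro exI[of _ ?q]) auto
qed

text \<open>Without a bound on the growth of S the precision 3 / 2^l cannot be compared with ln q,
  but it still tends to 0.\<close>

lemma dense_orbit_liminf:
  fixes S :: "nat \<Rightarrow> nat" and w :: "nat \<Rightarrow> real"
  assumes dense: "dense_orbit S \<beta>" and S: "\<And>k. 2 * S k \<le> S (Suc k)" "1 \<le> S 0"
    and w: "\<And>k. real (S k) * w (S k) \<le> 1" "\<And>q. 0 \<le> w q"
  shows "liminf (\<lambda>q. ereal (real q * w q * nint_dist (real q * \<beta> - \<gamma>))) = 0"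
proof (rule antisym)
  show "0 \<le> liminf (\<lambda>q. ereal (real q * w q * nint_dist (real q * \<beta> - \<gamma>)))"
    using w(2) by (intro Liminf_bounded always_eventually) simp
  show "liminf (\<lambda>q. ereal (real q * w q * nint_dist (real q * \<beta> - \<gamma>))) \<le> 0"
  proof (rule ccontr)
    assume "\<not> ?thesis"
    then obtain z where z: "0 < ereal z" "ereal z < liminf (\<lambda>q. ereal (real q * w q * nint_dist (real q * \<beta> - \<gamma>)))"
      using ereal_dense2[of 0] by (auto simp: not_le)
    then have "eventually (\<lambda>q. ereal z < ereal (real q * w q * nint_dist (real q * \<beta> - \<gamma>))) sequentially"
      by (intro less_LiminfD)
    then obtain N1 where N1: "\<And>q. N1 \<le> q \<Longrightarrow> z < real q * w q * nint_dist (real q * \<beta> - \<gamma>)"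
      by (auto simp: eventually_sequentially)
    obtain N2 where "3 / z < 2 ^ N2" using real_arch_pow[of 2 "3 / z"] by auto
    then have N2: "3 / 2 ^ N2 < z" using z by (simp add: field_simps)
    obtain l k where l: "max N1 N2 \<le> l" "max N1 N2 \<le> S k" "nint_dist (real (S k) * \<beta> - \<gamma>) \<le> 3 / 2 ^ l"
      using dense_orbit_hits[OF dense S, of "max N1 N2" \<gamma>] by blast
    have "z < real (S k) * w (S k) * nint_dist (real (S k) * \<beta> - \<gamma>)" using l by (intro N1) simp
    also have "\<dots> \<le> 1 * nint_dist (real (S k) * \<beta> - \<gamma>)" using w(1) by (intro mult_right_mono) auto
    also have "\<dots> \<le> 3 / 2 ^ l" using l by simp
    also have "\<dots> \<le> 3 / 2 ^ N2" using l by (intro divide_left_mono power_increasing) auto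
    finally show False using N2 by simp
  qed
qed

section \<open>Hausdorff dimension one\<close>

lemma hausdorff_premeasure_mono:
  assumes "A \<subseteq> B" "0 \<le> s" "s \<le> t" "0 < t" "\<delta> \<le> 1"
  shows "hausdorff_premeasure t \<delta> A \<le> hausdorff_premeasure s \<delta> B"
  unfolding hausdorff_premeasure_def
proof (rule Inf_greatest, clarify)
  fix U :: "nat \<Rightarrow> 'a set"
  assume U: "B \<subseteq> (\<Union>i. U i)" "\<forall>i. bounded (U i) \<and> diameter (U i) \<le> \<delta>"
  have "diam_powr t (U i) \<le> diam_powr s (U i)" for i
  proof -
    have d: "0 \<le> diameter (U i)" "diameter (U i) \<le> 1"
      using U(2) assms diameter_ge_0 by (auto intro: order_trans)
    have "diameter (U i) powr t \<le> diameter (U i) powr s"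
      using d assms by (intro powr_mono') auto
    \<comment> \<open>This serves the case s = 0, where a nonempty set counts 1.\<close>
    moreover have "diameter (U i) powr t \<le> 1" using d assms by (intro powr_le1) auto
    ultimately show ?thesis using assms by (auto simp: diam_powr_def ennreal_leI simp flip: ennreal_1)
  qed
  then have "(\<Sum>i. diam_powr t (U i)) \<le> (\<Sum>i. diam_powr s (U i))" by (intro suminf_le) auto
  then show "Inf {\<Sum>i. diam_powr t (V i) | V :: nat \<Rightarrow> 'a set. A \<subseteq> (\<Union>i. V i) \<and> (\<forall>i. bounded (V i) \<and> diameter (V i) \<le> \<delta>)}
      \<le> (\<Sum>i. diam_powr s (U i))"
    using U assms(1) by (intro Inf_lower2[of "\<Sum>i. diam_powr t (U i)"]) blast+
qed

text \<open>N intervals of length 1 / N contribute N^(1 - s), which tends to 0.\<close>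

lemma hausdorff_measure_unit_interval:
  fixes A :: "real set"
  assumes "A \<subseteq> {0..1}" "1 < s"
  shows "hausdorff_measure s A = 0"
proof -
  have small: "hausdorff_premeasure s \<delta> A \<le> ennreal e" if \<delta>: "0 < \<delta>" and e: "0 < e" for \<delta> e
  proof -
    obtain N1 :: nat where N1: "1 / \<delta> \<le> real N1" using real_arch_simple by blast
    obtain N2 :: nat where N2: "e powr (1 / (1 - s)) \<le> real N2" using real_arch_simple by blast
    define N where "N = max (max N1 N2) 1"
    have N: "1 \<le> N" "1 / \<delta> \<le> real N" "e powr (1 / (1 - s)) \<le> real N" using N1 N2 by (auto simp: N_def)
    have "real N powr (1 - s) \<le> (e powr (1 / (1 - s))) powr (1 - s)"
      using N(3) e assms by (intro powr_mono2') auto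
    then have Ns: "real N powr (1 - s) \<le> e" using e assms by (simp add: powr_powr)
    define U where "U i = (if i < N then {real i / real N..(real i + 1) / real N} else {})" for i
    have diam: "diameter (U i) = (if i < N then 1 / real N else 0)" for i
      using N by (simp add: U_def diameter_closed_interval divide_right_mono field_simps)
    have cover: "A \<subseteq> (\<Union>i. U i)"
    proof
      fix y assume "y \<in> A"
      then have y: "0 \<le> y" "y \<le> 1" using assms by auto
      \<comment> \<open>The minimum puts y = 1 into the last interval.\<close>
      define i where "i = min (nat \<lfloor>y * real N\<rfloor>) (N - 1)"
      have "i < N" using N by (auto simp: i_def)
      moreover have "real i \<le> y * real N" 
      proof -
        have "real i \<le> real (nat \<lfloor>y * real N\<rfloor>)" by (simp add: i_def)
        also have "\<dots> \<le> y * real N" using y by simp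
        finally show ?thesis .
      qed
      moreover have "y * real N \<le> real i + 1"
      proof (cases "nat \<lfloor>y * real N\<rfloor> \<le> N - 1")
        case True
        then have "real i = of_int \<lfloor>y * real N\<rfloor>" using y by (simp add: i_def)
        then show ?thesis by linarith
      next
        case False
        then have "real i + 1 = real N" using N by (simp add: i_def of_nat_diff)
        then show ?thesis using y by (simp add: mult_left_le_one_le)
      qed
      ultimately have "y \<in> U i" using N by (simp add: U_def field_simps)
      then show "y \<in> (\<Union>i. U i)" by blast
    qed
    have "hausdorff_premeasure s \<delta> A \<le> (\<Sum>i. diam_powr s (U i))"
      unfolding hausdorff_premeasure_def
    proof (rule Inf_lower, intro CollectI exI conjI allI)
      show "bounded (U i)" "diameter (U i) \<le> \<delta>" for i
        using N \<delta> unfolding diam by (auto simp: U_def field_simps)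
    qed (use cover in auto)
    also have "\<dots> = (\<Sum>i<N. diam_powr s (U i))"
      by (rule suminf_finite) (auto simp: diam_powr_def U_def)
    also have "\<dots> = (\<Sum>i<N. ennreal ((1 / real N) powr s))"
      using assms N by (intro sum.cong refl) (auto simp: diam_powr_def diam, auto simp: U_def field_simps)
    also have "\<dots> = ennreal (real N * (1 / real N) powr s)"
      by (simp add: ennreal_mult ennreal_of_nat_eq_real_of_nat)
    also have "real N * (1 / real N) powr s = real N powr (1 - s)"
      using N by (simp add: powr_diff powr_divide)
    finally show ?thesis using Ns by (meson ennreal_leI order_trans)
  qed
  have "hausdorff_premeasure s \<delta> A \<le> 0" if "0 < \<delta>" for \<delta>
  proof (rule ennreal_le_epsilon)
    fix e :: real assume "0 < e"
    then show "hausdorff_premeasure s \<delta> A \<le> 0 + ennreal e" using small[OF that] by simp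
  qed
  then have "hausdorff_measure s A \<le> 0"
    unfolding hausdorff_measure_def by (intro SUP_least) simp
  then show ?thesis by simp
qed

text \<open>In the application the bound on the digits depends on s, so each s has a subset G' of
  its own.\<close>

theorem hausdorff_dim_eq_1:
  fixes G :: "real set"
  assumes "G \<subseteq> {0..1}" and "\<And>s. 0 < s \<Longrightarrow> s < 1 \<Longrightarrow> \<exists>G'\<subseteq>G. 0 < hausdorff_premeasure s (1/2) G'"
  shows "hausdorff_dim G = 1"
proof (rule antisym)
  show "hausdorff_dim G \<le> 1"
  proof (rule ennreal_le_epsilon)
    fix e :: real assume "0 < e"
    then have "hausdorff_measure (1 + e) G = 0" using assms(1) by (intro hausdorff_measure_unit_interval) auto
    then have "hausdorff_dim G \<le> ennreal (1 + e)"
      unfolding hausdorff_dim_def using \<open>0 < e\<close>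
      by (intro Inf_lower CollectI exI[of _ "1 + e"] conjI) auto
    then show "hausdorff_dim G \<le> 1 + ennreal e" using \<open>0 < e\<close> by (simp add: ennreal_plus flip: ennreal_1)
  qed
  show "1 \<le> hausdorff_dim G"
    unfolding hausdorff_dim_def
  proof (rule Inf_greatest, clarify)
    fix s :: real assume s: "0 \<le> s" "hausdorff_measure s G = 0"
    show "1 \<le> ennreal s"
    proof (rule ccontr)
      assume "\<not> 1 \<le> ennreal s"
      then have "s < 1" by (metis ennreal_1 ennreal_leI not_less)
      \<comment> \<open>(1 + s) / 2 lies strictly between 0 and 1 even if s = 0.\<close>
      then obtain G' where G': "G' \<subseteq> G" "0 < hausdorff_premeasure ((1 + s) / 2) (1/2) G'"
        using assms(2)[of "(1 + s) / 2"] s(1) by auto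
      have "hausdorff_premeasure ((1 + s) / 2) (1/2) G' \<le> hausdorff_premeasure s (1/2) G"
        using G' s \<open>s < 1\<close> by (intro hausdorff_premeasure_mono) auto
      also have "\<dots> \<le> hausdorff_measure s G"
        unfolding hausdorff_measure_def by (rule SUP_upper) simp
      finally show False using G' s by simp
    qed
  qed
qed

theorem theorem1p1:
  fixes \<epsilon> :: real and \<alpha> :: "nat \<Rightarrow> real" and D :: "nat \<Rightarrow> nat \<Rightarrow> nat"
  assumes "\<epsilon> > 0"
    and "\<And>i. \<alpha> i \<in> Bad"
    and "\<And>j. pseudo_abs_seq (D j)"
    and "\<And>j. strict_mono (D j)"
  shows "\<exists>G. G \<subseteq> Bad \<and> hausdorff_dim G = 1 \<and>
    (\<forall>\<beta>\<in>G.
      (\<forall>i. \<forall>\<gamma>::real.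
        infinite {q::nat. q > 0 \<and>
          real q * nint_dist (real q * \<alpha> i) * nint_dist (real q * \<beta> - \<gamma>)
            < 1 / (ln (real q)) powr (1/2 - \<epsilon>)}) \<and>
      (\<forall>j. \<forall>\<delta>::real.
        liminf (\<lambda>q::nat. ereal (real q * pseudo_abs (D j) (int q) * nint_dist (real q * \<beta> - \<delta>))) = 0) \<and>
      (\<forall>j. (\<exists>C::real. C > 1 \<and> (\<forall>k. real (D j k) \<le> C ^ k)) \<longrightarrow>
        (\<forall>\<delta>::real.
          infinite {q::nat. q > 0 \<and>
            real q * pseudo_abs (D j) (int q) * nint_dist (real q * \<beta> - \<delta>)
              < 1 / (ln (real q)) powr (1/2 - \<epsilon>)})))"
proof -
  have "\<forall>i. \<exists>S :: nat \<Rightarrow> nat. (\<forall>k. 2 * S k \<le> S (Suc k)) \<and> 1 \<le> S 0 \<and>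
      (\<exists>C>1. \<forall>k. real (S k) \<le> C ^ k) \<and> (\<forall>k. real (S k) * nint_dist (real (S k) * \<alpha> i) \<le> 1)"
    using Bad_good_denominators[OF assms(2)] by metis
  then obtain A :: "nat \<Rightarrow> nat \<Rightarrow> nat" where A: "\<And>i k. 2 * A i k \<le> A i (Suc k)" "\<And>i. 1 \<le> A i 0"
    "\<And>i. \<exists>C>1. \<forall>k. real (A i k) \<le> C ^ k" "\<And>i k. real (A i k) * nint_dist (real (A i k) * \<alpha> i) \<le> 1"
    by metis
  have D: "2 * D j k \<le> D j (Suc k)" "1 \<le> D j 0" for j k
    using pseudo_abs_seq_doubling[OF assms(3,4)] assms(3)[of j] by (auto simp: pseudo_abs_seq_def)
  \<comment> \<open>The two families are interleaved, so that one construction treats both.\<close>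
  define S where "S i = (if even i then A (i div 2) else D (i div 2))" for i :: nat
  \<comment> \<open>All points with the required orbits, rather than one constructed tree; so G
    contains the subsets obtained for every s < 1.\<close>
  define G where "G = {\<beta> \<in> Bad \<inter> {0..1}. \<forall>i. dense_orbit (S i) \<beta>}"
  have dense: "dense_orbit (A i) \<beta>" "dense_orbit (D i) \<beta>" if "\<beta> \<in> G" for \<beta> i
  proof -
    have "dense_orbit (S (2 * i)) \<beta>" "dense_orbit (S (2 * i + 1)) \<beta>" using that by (auto simp: G_def)
    then show "dense_orbit (A i) \<beta>" "dense_orbit (D i) \<beta>" by (simp_all add: S_def)
  qed
  have "hausdorff_dim G = 1"
  proof (rule hausdorff_dim_eq_1)
    fix s :: real assume s: "0 < s" "s < 1"
    have "2 * S i k \<le> S i (Suc k)" "1 \<le> S i 0" for i k using A D by (auto simp: S_def)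
    then obtain G' where "G' \<subseteq> Bad \<inter> {0..1}" "0 < hausdorff_premeasure s (1/2) G'"
      "\<forall>\<beta>\<in>G'. \<forall>i. dense_orbit (S i) \<beta>"
      using hausdorff_dense_orbits[of S s, OF _ _ s] unfolding dense_orbit_def by metis
    then show "\<exists>G'\<subseteq>G. 0 < hausdorff_premeasure s (1/2) G'" unfolding G_def by blast
  qed (auto simp: G_def)
  moreover have "infinite {q::nat. q > 0 \<and>
      real q * nint_dist (real q * \<alpha> i) * nint_dist (real q * \<beta> - \<gamma>) < 1 / (ln (real q)) powr (1/2 - \<epsilon>)}"
    if "\<beta> \<in> G" for \<beta> i \<gamma>
  proof -
    obtain C where "1 < C" "\<And>k. real (A i k) \<le> C ^ k" using A(3) by blast
    then show ?thesis
      by (rule dense_orbit_infinite_solutions[OF dense(1)[OF that] A(1,2) _ _ _ assms(1),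
            where w = "\<lambda>q. nint_dist (real q * \<alpha> i)"]) (rule A(4))
  qed
  moreover have "liminf (\<lambda>q::nat. ereal (real q * pseudo_abs (D j) (int q) * nint_dist (real q * \<beta> - \<delta>))) = 0"
    if "\<beta> \<in> G" for \<beta> j \<delta>
    by (rule dense_orbit_liminf[OF dense(2)[OF that, of j] D(1,2)[of j]])
      (simp_all add: pseudo_abs_self_le[OF assms(3)] pseudo_abs_nonneg[OF assms(3)])
  moreover have "infinite {q::nat. q > 0 \<and>
      real q * pseudo_abs (D j) (int q) * nint_dist (real q * \<beta> - \<delta>) < 1 / (ln (real q)) powr (1/2 - \<epsilon>)}"
    if "\<beta> \<in> G" "1 < C" "\<forall>k. real (D j k) \<le> C ^ k" for \<beta> j C \<delta>
    by (rule dense_orbit_infinite_solutions[OF dense(2)[OF that(1), of j] D(1,2)[of j] that(2) _ _ assms(1),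
          where w = "\<lambda>q. pseudo_abs (D j) (int q)"]) (use that pseudo_abs_self_le assms(3) in auto)
  ultimately show ?thesis
    by (intro exI[of _ G]) (auto simp: G_def)
qed

end
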